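(* The space of all symmetric cubic laminations is compact. The set of all non-degenerate comajors of symmetric cubic laminations is a lamination (that is, these chords pairwise do not cross and, together with the points of the unit circle regarded as degenerate leaves, their union is closed).
   Context: Laminations. Identify the unit circle $\mathbb S$ with $\mathbb R/\mathbb Z$, let $\mathbb D$ be the open unit disk and $\sigma_3(t)=3t \bmod 1$. A chord $\overline{ab}$ is the segment joining $a,b\in\mathbb S$ (degenerate, i.e. a point of $\mathbb S$, if $a=b$). Distinct chords cross if they meet inside $\mathbb D$. Put $\sigma_3(\overline{ab})=\overline{\sigma_3(a)\sigma_3(b)}$, and let $-\ell$ be the image of $\ell$ under rotation by $180^\circ$ ($t\mapsto t+\frac12$). A lamination is a set of chords (leaves), pairwise non-crossing, whose union is closed; all points of $\mathbb S$ are regarded as degenerate leaves. It is cubic ($\sigma_3$-invariant) if: (D1) for each leaf $\ell$, $\sigma_3(\ell)$ is a leaf or a point of $\mathbb S$; (D2) for each leaf $\ell$ there is a leaf $\ell'$ with $\sigma_3(\ell')=\ell$, and for each leaf $\ell$ with $\sigma_3(\ell)$ non-degenerate there are three pairwise disjoint leaves $\ell_1=\ell,\ell_2,\ell_3$ with $\sigma_3(\ell_i)=\sigma_3(\ell)$. It is symmetric if moreover $-\ell$ is a leaf whenever $\ell$ is. The space of laminations carries the Hausdorff metric (a lamination being viewed as a compact subset of the compact space of all, possibly degenerate, chords). Majors and comajors. The length $\|\overline{ab}\|\in[0,\frac12]$ is the length of the shorter arc of $\mathbb S=\mathbb R/\mathbb Z$ between $a$ and $b$. For a symmetric lamination $\mathcal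 L$ having a non-degenerate leaf, a major is a non-degenerate leaf $M$ of $\mathcal L$ for which $\bigl|\|M\|-\frac13\bigr|$ is minimal. If a major $M$ is not critical ($\|M\|\ne\frac13$), then $M$ lies in a unique triple of pairwise disjoint leaves of $\mathcal L$ with the same $\sigma_3$-image, and a leaf of this triple other than $M$ which has length $<\frac16$ (or length $\frac16$, if such a sibling exists) is a comajor of $\mathcal L$. If the majors are critical, the comajors are the points of $\mathbb S$ that have the same $\sigma_3$-image as a major $M$ but are not endpoints of $M$ (degenerate comajors).
   Formalization: A sibling of length exactly 1/6 counts as a comajor only if the major M is a diameter; otherwise leaves of length 1/6, which tie with the diameter as majors, would give crossing comajors such as (5/6,1) and (11/12,1/12). *)

theory Defs
  imports "HOL-Analysis.Analysis"
begin

section \<open>Hausdorff metric\<close>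

definition hausdorff_dist :: "('a \<Rightarrow> 'a \<Rightarrow> real) \<Rightarrow> 'a set \<Rightarrow> 'a set \<Rightarrow> real" where
  "hausdorff_dist d A B = max (SUP a\<in>A. INF b\<in>B. d a b) (SUP b\<in>B. INF a\<in>A. d a b)"

definition nonempty_compacts :: "'a metric \<Rightarrow> 'a set set" where
  "nonempty_compacts m = {A. A \<noteq> {} \<and> compactin (mtopology_of m) A}"

text \<open>The distance is set to 0 off the carrier only because \<^locale>\<open>Metric_space\<close> demands a
  distance function that is nonnegative everywhere.\<close>

definition hausdorff_metric :: "'a metric \<Rightarrow> 'a set metric" where
  "hausdorff_metric m = metric (nonempty_compacts m,
     \<lambda>A B. if A \<in> nonempty_compacts m \<and> B \<in> nonempty_compacts m
           then hausdorff_dist (mdist m) A B else 0)"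

context Metric_space
begin

lemma hausdorff_INF_less:
  assumes "A \<subseteq> M" "B \<subseteq> M" "A \<noteq> {}" "B \<noteq> {}" "mbounded A" "mbounded B"
    and "a \<in> A" "hausdorff_dist d A B < e"
  shows "\<exists>b\<in>B. d a b < e"
proof -
  obtain K where K: "\<And>x y. x \<in> A \<union> B \<Longrightarrow> y \<in> A \<union> B \<Longrightarrow> d x y \<le> K"
    using assms mbounded_Un[of A B] mbounded_alt[of "A \<union> B"] by metis
  obtain b0 where b0: "b0 \<in> B" using assms by auto
  have bdd: "bdd_below (d x ` B)" for x
    by (rule bdd_belowI[of _ 0]) auto
  have "bdd_above ((\<lambda>a. INF b\<in>B. d a b) ` A)"
  proof (rule bdd_aboveI[of _ K], clarify)
    fix x assume "x \<in> A"
    have "(INF b\<in>B. d x b) \<le> d x b0" by (intro cINF_lower bdd b0)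
    also have "\<dots> \<le> K" using K \<open>x \<in> A\<close> b0 by auto
    finally show "(INF b\<in>B. d x b) \<le> K" .
  qed
  then have "(INF b\<in>B. d a b) \<le> (SUP a\<in>A. INF b\<in>B. d a b)"
    by (intro cSUP_upper assms)
  also have "\<dots> < e" using assms(8) by (simp add: hausdorff_dist_def)
  finally show ?thesis
    using assms(4) bdd[of a] by (subst (asm) cINF_less_iff) auto
qed

lemma hausdorff_dist_commute: "hausdorff_dist d A B = hausdorff_dist d B A"
  by (simp add: hausdorff_dist_def commute max.commute)

lemma hausdorff_dist_le:
  assumes "A \<noteq> {}" "B \<noteq> {}"
    and "\<And>a. a \<in> A \<Longrightarrow> \<exists>b\<in>B. d a b \<le> e" "\<And>b. b \<in> B \<Longrightarrow> \<exists>a\<in>A. d a b \<le> e"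
  shows "hausdorff_dist d A B \<le> e"
proof -
  have bdd: "bdd_below (d x ` C)" "bdd_below ((\<lambda>y. d y x) ` C)" for x C
    by (rule bdd_belowI[of _ 0]; auto)+
  have "(INF b\<in>B. d a b) \<le> e" if "a \<in> A" for a
    using assms(3)[OF that] bdd by (meson cINF_lower order_trans)
  moreover have "(INF a\<in>A. d a b) \<le> e" if "b \<in> B" for b
    using assms(4)[OF that] bdd by (meson cINF_lower order_trans)
  ultimately show ?thesis
    unfolding hausdorff_dist_def using assms by (auto intro!: cSUP_least)
qed

lemma hausdorff_dist_less_eps:
  assumes "A \<noteq> {}" "B \<noteq> {}" "e > 0"
    and "compactin mtopology A" "compactin mtopology B"
    and "a \<in> A"
  shows "\<exists>b\<in>B. d a b < hausdorff_dist d A B + e"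
proof (rule hausdorff_INF_less)
  show "A \<subseteq> M" "B \<subseteq> M"
    using compactin_subset_topspace[OF assms(4)] compactin_subset_topspace[OF assms(5)] by simp_all
  show "mbounded A" "mbounded B"
    using assms(4,5) compactin_imp_mbounded by simp_all
qed (use assms in simp_all)

lemma hausdorff_dist_nonneg:
  assumes "A \<noteq> {}" "B \<noteq> {}" "compactin mtopology A" "compactin mtopology B"
  shows "0 \<le> hausdorff_dist d A B"
proof (rule field_le_epsilon)
  fix e :: real assume e: "e > 0"
  obtain a where "a \<in> A" using assms by auto
  then obtain b where "d a b < hausdorff_dist d A B + e"
    using hausdorff_dist_less_eps[OF assms(1,2) e assms(3,4)] by blast
  then show "0 \<le> hausdorff_dist d A B + e" using nonneg[of a b] by linarith
qed

lemma Metric_space_hausdorff: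
  defines "C \<equiv> {A. A \<noteq> {} \<and> compactin mtopology A}"
  shows "Metric_space C (\<lambda>A B. if A \<in> C \<and> B \<in> C then hausdorff_dist d A B else 0)"
proof
  fix A B :: "'a set"
  show "0 \<le> (if A \<in> C \<and> B \<in> C then hausdorff_dist d A B else 0)"
    by (auto simp: C_def hausdorff_dist_nonneg)
  show "(if A \<in> C \<and> B \<in> C then hausdorff_dist d A B else 0) =
        (if B \<in> C \<and> A \<in> C then hausdorff_dist d B A else 0)"
    by (auto simp: hausdorff_dist_commute)
next
  fix A B assume C: "A \<in> C" "B \<in> C"
  then have AB: "A \<noteq> {}" "B \<noteq> {}" "compactin mtopology A" "compactin mtopology B"
    by (auto simp: C_def)
  have sub: "X \<subseteq> Y" if X: "X \<noteq> {}" "Y \<noteq> {}" "compactin mtopology X" "compactin mtopology Y"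
    and 0: "hausdorff_dist d X Y = 0" for X Y
  proof
    fix x assume x: "x \<in> X"
    have M: "X \<subseteq> M" "Y \<subseteq> M"
      using compactin_subset_topspace[OF X(3)] compactin_subset_topspace[OF X(4)] by simp_all
    have "\<exists>y\<in>Y. y \<in> mball x r" if r: "r > 0" for r
    proof -
      obtain y where "y \<in> Y" "d x y < r"
        using hausdorff_dist_less_eps[OF X(1,2) r X(3,4) x] 0 by auto
      then show ?thesis using M x by (auto simp: in_mball)
    qed
    then have "x \<in> mtopology closure_of Y"
      unfolding metric_closure_of using M x by blast
    moreover have "closedin mtopology Y"
      using X(4) compactin_imp_closedin Hausdorff_space_mtopology by blast
    ultimately show "x \<in> Y" by (simp add: closure_of_closedin)
  qed
  have "hausdorff_dist d A B = 0 \<longleftrightarrow> A = B"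
  proof
    assume "hausdorff_dist d A B = 0"
    then show "A = B" using sub AB hausdorff_dist_commute by (metis subset_antisym)
  next
    assume "A = B"
    have "A \<subseteq> M" using compactin_subset_topspace[OF AB(3)] by simp
    have "(INF b\<in>A. d a b) = 0" if "a \<in> A" for a
    proof (rule antisym)
      have "(INF b\<in>A. d a b) \<le> d a a"
        using that by (intro cINF_lower) (auto intro!: bdd_belowI[of _ 0])
      then show "(INF b\<in>A. d a b) \<le> 0" using that \<open>A \<subseteq> M\<close> by auto
      show "0 \<le> (INF b\<in>A. d a b)" using AB by (intro cINF_greatest) auto
    qed
    then have "(SUP a\<in>A. INF b\<in>A. d a b) = 0" using AB by simp
    then show "hausdorff_dist d A B = 0"
      using \<open>A = B\<close> commute by (simp add: hausdorff_dist_def)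
  qed
  then show "(if A \<in> C \<and> B \<in> C then hausdorff_dist d A B else 0) = 0 \<longleftrightarrow> A = B"
    using C by simp
next
  fix A B D assume C: "A \<in> C" "B \<in> C" "D \<in> C"
  then have ABC: "A \<noteq> {}" "B \<noteq> {}" "D \<noteq> {}" "compactin mtopology A" "compactin mtopology B"
    "compactin mtopology D" by (auto simp: C_def)
  have tri: "\<exists>z\<in>Z. d x z \<le> hausdorff_dist d X Y + hausdorff_dist d Y Z + e"
    if X: "X \<noteq> {}" "Y \<noteq> {}" "Z \<noteq> {}" "compactin mtopology X" "compactin mtopology Y"
      "compactin mtopology Z" and e: "e > 0" and x: "x \<in> X" for X Y Z e x
  proof -
    have e2: "e/2 > 0" using e by simp
    obtain y where y: "y \<in> Y" "d x y < hausdorff_dist d X Y + e/2"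
      using hausdorff_dist_less_eps[OF X(1,2) e2 X(4,5) x] by auto
    obtain z where z: "z \<in> Z" "d y z < hausdorff_dist d Y Z + e/2"
      using hausdorff_dist_less_eps[OF X(2,3) e2 X(5,6) y(1)] by auto
    have "x \<in> M" "y \<in> M" "z \<in> M"
      using compactin_subset_topspace[OF X(4)] compactin_subset_topspace[OF X(5)] compactin_subset_topspace[OF X(6)]
        x y(1) z(1) by auto
    then have "d x z \<le> d x y + d y z" by (rule triangle)
    then show ?thesis using y z by force
  qed
  have "hausdorff_dist d A D \<le> hausdorff_dist d A B + hausdorff_dist d B D"
  proof (rule field_le_epsilon)
    fix e :: real assume e: "e > 0"
    show "hausdorff_dist d A D \<le> hausdorff_dist d A B + hausdorff_dist d B D + e"
    proof (rule hausdorff_dist_le)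
      fix c assume c: "c \<in> D"
      show "\<exists>a\<in>A. d a c \<le> hausdorff_dist d A B + hausdorff_dist d B D + e"
        using tri[OF ABC(3,2,1) ABC(6,5,4) e c] hausdorff_dist_commute commute
        by (metis add.commute)
    qed (use ABC tri e in auto)
  qed
  then show "(if A \<in> C \<and> D \<in> C then hausdorff_dist d A D else 0) \<le>
      (if A \<in> C \<and> B \<in> C then hausdorff_dist d A B else 0) +
      (if B \<in> C \<and> D \<in> C then hausdorff_dist d B D else 0)"
    using C by simp
qed

end

lemma
  shows mspace_hausdorff_metric: "mspace (hausdorff_metric m) = nonempty_compacts m"
    and mdist_hausdorff_metric:
      "A \<in> nonempty_compacts m \<Longrightarrow> B \<in> nonempty_compacts m \<Longrightarrow>
       mdist (hausdorff_metric m) A B = hausdorff_dist (mdist m) A B"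
proof -
  have M: "Metric_space (nonempty_compacts m)
     (\<lambda>A B. if A \<in> nonempty_compacts m \<and> B \<in> nonempty_compacts m
           then hausdorff_dist (mdist m) A B else 0)"
    using Metric_space.Metric_space_hausdorff[OF Metric_space_mspace_mdist, of m]
    unfolding nonempty_compacts_def mtopology_of_def by simp
  show "mspace (hausdorff_metric m) = nonempty_compacts m"
    unfolding hausdorff_metric_def using M by (rule Metric_space.mspace_metric)
  show "mdist (hausdorff_metric m) A B = hausdorff_dist (mdist m) A B"
    if "A \<in> nonempty_compacts m" "B \<in> nonempty_compacts m"
    unfolding hausdorff_metric_def Metric_space.mdist_metric[OF M] using that by simp
qed


section \<open>Chords\<close>

text \<open>\<open>t \<mapsto> circle_pt t\<close> is the identification of \<open>\<real>/\<int>\<close> with the unit circle; reals represent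
  their classes mod 1.\<close>

definition circle_pt :: "real \<Rightarrow> complex" where
  "circle_pt t = cis (2 * pi * t)"

definition chord :: "real \<Rightarrow> real \<Rightarrow> complex set" where
  "chord s t = closed_segment (circle_pt s) (circle_pt t)"

definition chords :: "complex set set" where
  "chords = {chord s t | s t. True}"

definition degenerate_chords :: "complex set set" where
  "degenerate_chords = {{circle_pt t} | t. True}"

lemma circle_pt_eq_iff: "circle_pt s = circle_pt t \<longleftrightarrow> s - t \<in> \<int>"
proof -
  have "circle_pt s = circle_pt t \<longleftrightarrow> cis (2 * pi * (s - t)) = 1"
    by (simp add: circle_pt_def right_diff_distrib flip: cis_divide)
  also have "\<dots> \<longleftrightarrow> cos (2 * pi * (s - t)) = 1"
    by (auto simp: complex_eq_iff) (metis cos_one_sin_zero)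
  also have "\<dots> \<longleftrightarrow> s - t \<in> \<int>"
    by (auto simp: cos_one_2pi_int Ints_def)
  finally show ?thesis .
qed

lemma circle_pt_image: "range circle_pt = sphere 0 1"
proof -
  have "z \<in> range circle_pt" if "norm z = 1" for z
  proof -
    have "sgn z = z" using that by (simp add: sgn_eq)
    moreover have "z \<noteq> 0" using that by auto
    ultimately have "circle_pt (Arg z / (2 * pi)) = z"
      using cis_Arg[of z] by (simp add: circle_pt_def)
    then show ?thesis by (metis rangeI)
  qed
  then show ?thesis by (auto simp: circle_pt_def)
qed

lemma chord_eq_iff:
  "chord s t = chord s' t' \<longleftrightarrow> s - s' \<in> \<int> \<and> t - t' \<in> \<int> \<or> s - t' \<in> \<int> \<and> t - s' \<in> \<int>"
  by (auto simp: chord_def doubleton_eq_iff circle_pt_eq_iff)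

lemma degenerate_chord_iff: "chord s t \<in> degenerate_chords \<longleftrightarrow> s - t \<in> \<int>"
proof
  assume "chord s t \<in> degenerate_chords"
  then obtain u where "chord s t = chord u u"
    by (auto simp: degenerate_chords_def chord_def)
  then show "s - t \<in> \<int>"
    unfolding chord_eq_iff using Ints_diff[of "s - u" "t - u"] by auto
next
  assume "s - t \<in> \<int>"
  then show "chord s t \<in> degenerate_chords"
    by (auto simp: chord_def degenerate_chords_def simp flip: circle_pt_eq_iff)
qed

text \<open>Distinct chords cross if they meet inside the open disk; chords that merely share an endpoint
  do not cross.\<close>

definition cross :: "complex set \<Rightarrow> complex set \<Rightarrow> bool" where
  "cross l m \<longleftrightarrow> l \<noteq> m \<and> l \<inter> m \<inter> ball 0 1 \<noteq> {}"

definition sigma3 :: "complex set \<Rightarrow> complex set" where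
  "sigma3 l = (THE m. \<exists>s t. l = chord s t \<and> m = chord (3 * s) (3 * t))"

lemma sigma3_chord: "sigma3 (chord s t) = chord (3 * s) (3 * t)"
  unfolding sigma3_def
proof (rule the_equality)
  have *: "3 * x - 3 * y \<in> \<int>" if "x - y \<in> \<int>" for x y :: real
    using Ints_mult[OF _ that, of 3] by (simp add: algebra_simps)
  fix m assume "\<exists>s' t'. chord s t = chord s' t' \<and> m = chord (3 * s') (3 * t')"
  then obtain s' t' where "chord s t = chord s' t'" and m: "m = chord (3 * s') (3 * t')" by blast
  then have "chord (3 * s) (3 * t) = chord (3 * s') (3 * t')"
    unfolding chord_eq_iff using * by blast
  then show "m = chord (3 * s) (3 * t)" using m by simp
qed blast

text \<open>Rotation by 180 degrees is \<open>z \<mapsto> -z\<close>.\<close>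

lemma uminus_chord: "uminus ` chord s t = chord (s + 1/2) (t + 1/2)"
proof -
  have "circle_pt (x + 1/2) = - circle_pt x" for x
    by (simp add: circle_pt_def distrib_left flip: cis_mult)
  then show ?thesis
    by (simp add: chord_def closed_segment_linear_image[OF linear_uminus])
qed

text \<open>The two arcs between \<open>s\<close> and \<open>t\<close> have lengths \<open>frac (t - s)\<close> and \<open>frac (s - t)\<close>.\<close>

definition arc_dist :: "real \<Rightarrow> real \<Rightarrow> real" where
  "arc_dist s t = min (frac (t - s)) (frac (s - t))"

definition chord_length :: "complex set \<Rightarrow> real" where
  "chord_length l = (THE r. \<exists>s t. l = chord s t \<and> r = arc_dist s t)"

lemma chord_length_chord: "chord_length (chord s t) = arc_dist s t"
  unfolding chord_length_def
proof (rule the_equality)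
  have *: "frac x = frac y" if "x - y \<in> \<int>" for x y :: real
  proof -
    obtain k where "x - y = of_int k" using \<open>x - y \<in> \<int>\<close> by (rule Ints_cases)
    then have "x = y + of_int k" by simp
    then show ?thesis by (simp add: frac_def)
  qed
  fix r assume "\<exists>s' t'. chord s t = chord s' t' \<and> r = arc_dist s' t'"
  then obtain s' t' where eq: "chord s t = chord s' t'" and r: "r = arc_dist s' t'" by blast
  from eq consider "s - s' \<in> \<int>" "t - t' \<in> \<int>" | "s - t' \<in> \<int>" "t - s' \<in> \<int>"
    unfolding chord_eq_iff by blast
  then show "r = arc_dist s t"
  proof cases
    case 1
    have "frac (t - s) = frac (t' - s')" "frac (s - t) = frac (s' - t')"
      using Ints_diff[OF 1] Ints_diff[OF 1(2,1)] by (intro *; simp add: algebra_simps)+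
    then show ?thesis by (simp add: r arc_dist_def)
  next
    case 2
    have "frac (t - s) = frac (s' - t')" "frac (s - t) = frac (t' - s')"
      using Ints_diff[OF 2] Ints_diff[OF 2(2,1)] by (intro *; simp add: algebra_simps)+
    then show ?thesis by (simp add: r arc_dist_def min.commute)
  qed
qed blast


section \<open>Laminations\<close>

text \<open>A lamination contains all points of the circle as degenerate leaves.\<close>

definition lamination :: "complex set set \<Rightarrow> bool" where
  "lamination L \<longleftrightarrow>
     L \<subseteq> chords \<and> degenerate_chords \<subseteq> L \<and>
     (\<forall>l\<in>L. \<forall>m\<in>L. \<not> cross l m) \<and>
     closed (\<Union>L)"

definition sibling_triple :: "complex set set \<Rightarrow> complex set set \<Rightarrow> bool" where
  "sibling_triple L T \<longleftrightarrow>
     T \<subseteq> L \<and> card T = 3 \<and> disjoint T \<and> (\<forall>l\<in>T. \<forall>m\<in>T. sigma3 l = sigma3 m)"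

definition cubic_lamination :: "complex set set \<Rightarrow> bool" where
  "cubic_lamination L \<longleftrightarrow>
     lamination L \<and>
     (\<forall>l\<in>L. sigma3 l \<in> L \<or> sigma3 l \<in> degenerate_chords) \<and>
     (\<forall>l\<in>L. \<exists>l'\<in>L. sigma3 l' = l) \<and>
     (\<forall>l\<in>L. sigma3 l \<notin> degenerate_chords \<longrightarrow> (\<exists>T. sibling_triple L T \<and> l \<in> T))"

definition symmetric_lamination :: "complex set set \<Rightarrow> bool" where
  "symmetric_lamination L \<longleftrightarrow> cubic_lamination L \<and> (\<forall>l\<in>L. uminus ` l \<in> L)"

definition chord_metric :: "complex set metric" where
  "chord_metric = submetric (hausdorff_metric euclidean_metric) chords"

definition lamination_metric :: "complex set set metric" where
  "lamination_metric = hausdorff_metric chord_metric"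

lemma mspace_chord_metric: "mspace chord_metric = chords"
  unfolding chord_metric_def mspace_submetric mspace_hausdorff_metric nonempty_compacts_def
  by (auto simp: chords_def chord_def)


section \<open>Majors and comajors\<close>

definition major :: "complex set set \<Rightarrow> complex set \<Rightarrow> bool" where
  "major L M \<longleftrightarrow>
     M \<in> L \<and> M \<notin> degenerate_chords \<and>
     (\<forall>l \<in> L - degenerate_chords. \<bar>chord_length M - 1/3\<bar> \<le> \<bar>chord_length l - 1/3\<bar>)"

text \<open>A noncritical major has a sibling of length \<open>1/6\<close> only if the minimal distance to \<open>1/3\<close> is
  \<open>1/6\<close>. The lamination then contains a diameter, and its leaves of length \<open>1/6\<close> tie with the
  diameter for the minimum. The comajors are then the siblings of the diameter, hence the condition
  \<open>chord_length M = 1/2\<close>: if all six sides of the hexagon spanned by the preimages of the endpoints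
  of the diameter are leaves, then a side can lie in two triples, and siblings taken from the
  sides instead of the diameter would cross comajors of other laminations. In all other cases the
  triple of \<open>M\<close> is unique.\<close>

definition comajor :: "complex set set \<Rightarrow> complex set \<Rightarrow> bool" where
  "comajor L c \<longleftrightarrow>
     (\<exists>M. major L M \<and>
       (if chord_length M = 1/3
        then c \<in> degenerate_chords \<and> sigma3 c = sigma3 M \<and> c \<inter> M = {}
        else \<exists>T. sibling_triple L T \<and> M \<in> T \<and> c \<in> T \<and> c \<noteq> M \<and>
               (chord_length c < 1/6 \<or> chord_length c = 1/6 \<and> chord_length M = 1/2)))"

end

theory Submission
  imports Defs "HOL-Complex_Analysis.Great_Picard"
begin

text \<open>A lamination is determined by the closed set of pairs of endpoints of its leaves, so compactness
  reduces to two facts: closed subsets of a compact space subconverge (apply Arzela--Ascoli to their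
  distance functions), and all the defining conditions of a symmetric lamination are closed. The
  existence of three disjoint siblings is a closed condition because distinct points of the circle
  with the same cube stay at a fixed distance.

  A nondegenerate comajor with endpoints \<open>p\<close> and \<open>p + s\<close> determines its triple: the other two
  leaves have lengths \<open>1/3 \<plusminus> s\<close>, and no leaf has a length strictly between. This description
  passes to limits, so the set of comajors is closed.

  Suppose that two comajors cross. Their endpoints are then ordered \<open>p\<^sub>1 < p\<^sub>2 < q\<^sub>1 < q\<^sub>2\<close>, and the forward
  images of both avoid two antipodal strips of width \<open>q\<^sub>1 - p\<^sub>2\<close> that are swept out by critical chords. The strips cut
  the circle into three pieces on each of which tripling preserves the cyclic order, so the images of the two
  comajors cross forever. Points with the same itinerary form finite classes, which are pairwise
  unlinked, and recurrence makes the classes eventually periodic. Along a cycle of classes, every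
  shortest gap contains a critical value or its antipode. Comparing gap lengths as in Milnor's
  proof for quadratic orbit portraits shows that some map \<open>\<plusminus>\<sigma>\<^sub>3\<^sup>j\<close> rotates one class by one step. It
  therefore maps an image of the first comajor to a leaf of the same lamination crossing it.\<close>

section \<open>Cyclic order and rotating classes\<close>

text \<open>That the images of two crossing comajors cross forever is no contradiction in itself:
  they belong to different laminations, and only leaves of one lamination are known not to cross.
  Hence the detour through classes and rotations, which ends with two crossing leaves of the first
  lamination.

  The strips come from the majors. For a comajor of length \<open>s\<close>, the majors of lengths
  \<open>1/3 + s\<close> and \<open>1/3 - s\<close> bound a strip whose two arcs on the circle are
  translates of the comajor's own arc. A leaf with an end strictly inside has length at most
  \<open>s\<close> or strictly within \<open>s\<close> of \<open>1/3\<close>; the latter is excluded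
  because the majors are nearest to \<open>1/3\<close>, the former by considering only leaves longer
  than \<open>s\<close>, such as all proper images of the comajor. The common strip of two
  laminations is cut out by the overlap of the two comajors, whence the width
  \<open>q\<^sub>1 - p\<^sub>2\<close>.

  Each critical chord in the strip has its own critical value, so one of them avoids the finitely
  many class points. Symmetry enters because a shortest gap may hold only the antipode of that
  value; a half turn then repairs this.\<close>

text \<open>The positively oriented arc from \<open>a\<close> to \<open>b\<close> on the circle
  \<open>[0, 1)\<close>. It is 0, not 1, for equal endpoints, so comparing lengths from a fixed
  point expresses the cyclic order.\<close>

definition arc_len :: "real \<Rightarrow> real \<Rightarrow> real" where
  "arc_len a b = (if a \<le> b then b - a else b - a + 1)"

text \<open>The disjuncts are the two possible orders of \<open>x\<close> and \<open>y\<close>. The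
  inequalities are strict, so pairs with a common point are never linked.\<close>

definition linked :: "real \<Rightarrow> real \<Rightarrow> real \<Rightarrow> real \<Rightarrow> bool" where
  "linked a b x y \<longleftrightarrow> 0 < arc_len a x \<and> arc_len a x < arc_len a b \<and> arc_len a b < arc_len a y
     \<or> 0 < arc_len a y \<and> arc_len a y < arc_len a b \<and> arc_len a b < arc_len a x"

lemma arc_bounds: "a \<in> {0..<1} \<Longrightarrow> b \<in> {0..<1} \<Longrightarrow> 0 \<le> arc_len a b \<and> arc_len a b < 1"
  by (auto simp: arc_len_def)

lemma arc_frac: "arc_len (frac s) (frac t) = frac (t - s)"
proof -
  have "t - s = frac t - frac s + of_int (\<lfloor>t\<rfloor> - \<lfloor>s\<rfloor>)" by (simp add: frac_def)
  then have "t - s - arc_len (frac s) (frac t) = of_int (\<lfloor>t\<rfloor> - \<lfloor>s\<rfloor> - (if frac s \<le> frac t then 0 else 1))"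
    by (simp add: arc_len_def)
  then have "t - s - arc_len (frac s) (frac t) \<in> \<int>" by (metis Ints_of_int)
  moreover have "0 \<le> arc_len (frac s) (frac t)" "arc_len (frac s) (frac t) < 1"
    using arc_bounds[of "frac s" "frac t"] by (auto simp: frac_lt_1)
  ultimately show ?thesis by (metis frac_unique_iff)
qed

lemma ex_min_on:
  fixes g :: "'a \<Rightarrow> 'b :: linorder"
  assumes "finite S" "S \<noteq> {}" obtains s where "s \<in> S" "\<And>t. t \<in> S \<Longrightarrow> g s \<le> g t"
  using arg_min_if_finite(1)[OF assms, of g] arg_min_least[OF assms, of _ g] by blast

lemma arc_arc: "a \<in> {0..<1} \<Longrightarrow> b \<in> {0..<1} \<Longrightarrow> c \<in> {0..<1} \<Longrightarrow> arc_len (arc_len c a) (arc_len c b) = arc_len a b"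
  by (auto simp: arc_len_def)

text \<open>Seen from \<open>c\<close>, the point \<open>y\<close> comes before \<open>d\<close>,
  and \<open>a\<close> and \<open>e\<close> come after \<open>d\<close>. An arc from
  \<open>a\<close> to \<open>e\<close> through \<open>y\<close> must therefore run through
  \<open>c\<close> and cover the whole arc from \<open>c\<close> to \<open>d\<close>.\<close>

lemma arc_less_of_covering:
  assumes "a \<in> {0..<1}" "e \<in> {0..<1}" "c \<in> {0..<1}" "d \<in> {0..<1}" "y \<in> {0..<1}"
    and "arc_len a y < arc_len a e" "arc_len c y < arc_len c d" "arc_len c d < arc_len c a" "arc_len c d < arc_len c e"
  shows "arc_len c d < arc_len a e"
proof -
  have "arc_len (arc_len c a) (arc_len c y) < arc_len (arc_len c a) (arc_len c e)" using assms arc_arc by metis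
  moreover have "arc_len (arc_len c a) (arc_len c e) = arc_len a e" using assms arc_arc by metis
  moreover have "arc_len c a < 1" "arc_len c e < 1" "0 \<le> arc_len c y"
    using assms(1-5) by (auto simp: arc_len_def)
  ultimately show ?thesis using assms(7-9) by (auto simp: arc_len_def[of "arc_len c a"] split: if_splits)
qed

text \<open>Points of the circle are represented in \<open>[0, 1)\<close>. In the application \<open>f\<close> is tripling, \<open>neg\<close>
  is rotation by \<open>1/2\<close>, \<open>R\<close> relates points with the same itinerary, and \<open>y\<close> is a critical value.\<close>

locale rotating_classes =
  fixes U :: "real set" and R :: "real \<Rightarrow> real \<Rightarrow> bool" and f neg :: "real \<Rightarrow> real" and y :: real
  assumes fin: "finite U" and U01: "U \<subseteq> {0..<1}" and y01: "y \<in> {0..<1}"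
    and f_img: "f ` U = U" and neg_img: "\<And>a. a \<in> U \<Longrightarrow> neg a \<in> U"
    and neg_neg: "\<And>a. a \<in> U \<Longrightarrow> neg (neg a) = a"
    and f_neg: "\<And>a. a \<in> U \<Longrightarrow> f (neg a) = neg (f a)"
    and R_refl: "\<And>a. R a a" and R_sym: "\<And>a b. R a b \<Longrightarrow> R b a"
    and R_trans: "\<And>a b c. R a b \<Longrightarrow> R b c \<Longrightarrow> R a c"
    and R_f: "\<And>a b. R a b \<Longrightarrow> R (f a) (f b)"
    and R_neg: "\<And>a b. a \<in> U \<Longrightarrow> b \<in> U \<Longrightarrow> R a b \<Longrightarrow> R (neg a) (neg b)"
    and arc_f: "\<And>a b c. a \<in> U \<Longrightarrow> b \<in> U \<Longrightarrow> c \<in> U \<Longrightarrow> R a b \<Longrightarrow> R a c \<Longrightarrow>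
       arc_len a b < arc_len a c \<longleftrightarrow> arc_len (f a) (f b) < arc_len (f a) (f c)"
    and arc_neg: "\<And>a b. a \<in> {0..<1} \<Longrightarrow> b \<in> {0..<1} \<Longrightarrow> arc_len (neg a) (neg b) = arc_len a b"
    and neg_neg_y: "neg (neg y) = y" and neg_y01: "neg y \<in> {0..<1}"
    and expand: "\<And>a b. a \<in> U \<Longrightarrow> b \<in> U \<Longrightarrow> R a b \<Longrightarrow> a \<noteq> b \<Longrightarrow>
       arc_len (f a) (f b) = 3 * arc_len a b \<or> arc_len (f a) y < arc_len (f a) (f b) \<or> arc_len (f a) (neg y) < arc_len (f a) (f b)"
    and y_notin: "y \<notin> U"
    and unlinked: "\<And>a b c d. a \<in> U \<Longrightarrow> b \<in> U \<Longrightarrow> c \<in> U \<Longrightarrow> d \<in> U \<Longrightarrow>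
       R a b \<Longrightarrow> R c d \<Longrightarrow> linked a b c d \<Longrightarrow> R a c"
    and three: "\<And>a. a \<in> U \<Longrightarrow> \<exists>b\<in>U. \<exists>c\<in>U. R a b \<and> R a c \<and> b \<noteq> a \<and> c \<noteq> a \<and> b \<noteq> c"
begin

section \<open>Neighbours and gaps within a class\<close>

definition cls :: "real \<Rightarrow> real set" where "cls a = {b\<in>U. R a b}"

definition succ :: "real \<Rightarrow> real" where
  "succ a = arg_min_on (arc_len a) (cls a - {a})"

definition gap :: "real \<Rightarrow> real" where "gap a = arc_len a (succ a)"

lemma U_bounds: "a \<in> U \<Longrightarrow> 0 \<le> a \<and> a < 1"
  using U01 by auto

lemma arc_eq_iff: "a \<in> {0..<1} \<Longrightarrow> b \<in> {0..<1} \<Longrightarrow> c \<in> {0..<1} \<Longrightarrow> arc_len a b = arc_len a c \<longleftrightarrow> b = c"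
  by (auto simp: arc_len_def split: if_splits)

lemma arc_0_iff: "a \<in> {0..<1} \<Longrightarrow> b \<in> {0..<1} \<Longrightarrow> arc_len a b \<le> 0 \<longleftrightarrow> a = b"
  by (auto simp: arc_len_def)

lemma succ_props:
  assumes "a \<in> U"
  shows "succ a \<in> U" "R a (succ a)" "succ a \<noteq> a"
    and "\<And>b. b \<in> U \<Longrightarrow> R a b \<Longrightarrow> b \<noteq> a \<Longrightarrow> gap a \<le> arc_len a b"
proof -
  let ?S = "cls a - {a}"
  have f: "finite ?S" using fin by (auto simp: cls_def)
  have n: "?S \<noteq> {}" using three[OF assms] by (auto simp: cls_def)
  have "succ a \<in> ?S" unfolding succ_def by (rule arg_min_if_finite(1)[OF f n])
  then show "succ a \<in> U" "R a (succ a)" "succ a \<noteq> a" by (auto simp: cls_def)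
  show "gap a \<le> arc_len a b" if "b \<in> U" "R a b" "b \<noteq> a" for b
    unfolding gap_def succ_def
    using arg_min_least[OF f n, of b "arc_len a"] that by (auto simp: cls_def)
qed

lemma gap_pos: "a \<in> U \<Longrightarrow> 0 < gap a"
  unfolding gap_def using arc_0_iff[of a "succ a"] succ_props[of a] U01 by fastforce

lemma succ_eqI:
  assumes "a \<in> U" "b \<in> U" "R a b" "b \<noteq> a"
    and "\<And>c. c \<in> U \<Longrightarrow> R a c \<Longrightarrow> c \<noteq> a \<Longrightarrow> arc_len a b \<le> arc_len a c"
  shows "succ a = b"
proof -
  have "arc_len a (succ a) = arc_len a b"
    using assms succ_props[OF assms(1)] unfolding gap_def by (meson order_antisym)
  then show ?thesis using arc_eq_iff U01 assms succ_props(1) by blast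
qed

lemma f_U: "a \<in> U \<Longrightarrow> f a \<in> U" using f_img by blast

lemma f_inj: "inj_on f U"
  using f_img fin by (simp add: eq_card_imp_inj_on)

lemma funpow_inj: "inj_on (f ^^ n) U \<and> (f ^^ n) ` U = U"
proof (induction n)
  case (Suc n)
  then have "inj_on f ((f ^^ n) ` U)" using f_inj by simp
  with Suc have "inj_on (f \<circ> (f ^^ n)) U" by (intro comp_inj_on) auto
  moreover have "(f \<circ> (f ^^ n)) ` U = U" using Suc f_img by (metis image_comp)
  ultimately show ?case by (simp add: comp_def)
qed auto

text \<open>Finite order makes the inverse of \<open>f\<close> on \<open>U\<close> a forward power
  of \<open>f\<close>, so whatever \<open>f\<close> preserves it also reflects. Powers are compared
  as partial maps on \<open>U\<close>, of which there are finitely many.\<close>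

lemma period: obtains k where "k > 0" "\<And>a. a \<in> U \<Longrightarrow> (f ^^ k) a = a"
proof -
  let ?g = "\<lambda>n. restrict_map (\<lambda>a. Some ((f ^^ n) a)) U"
  have "range ?g \<subseteq> {m. dom m = U \<and> ran m \<subseteq> U}"
    using funpow_inj by (fastforce simp: ran_def restrict_map_def split: if_splits)
  moreover have "finite {m. dom m = U \<and> ran m \<subseteq> U}"
    using finite_set_of_finite_maps[OF fin fin] .
  ultimately have "finite (range ?g)" by (rule finite_subset)
  then have "\<not> inj ?g" using finite_imageD by fastforce
  then obtain i j where ij: "i < j" "?g i = ?g j"
    unfolding inj_def by (metis linorder_neqE_nat)
  show ?thesis
  proof (rule that[of "j - i"])
    show "j - i > 0" using ij by simp
    fix a assume a: "a \<in> U"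
    have "(f ^^ i) a = (f ^^ j) a"
      using a fun_cong[OF ij(2), of a] by (simp add: restrict_map_def)
    also have "\<dots> = (f ^^ i) ((f ^^ (j - i)) a)"
      using ij by (simp flip: funpow_add comp_apply[of "f ^^ i" "f ^^ (j - i)"])
    finally show "(f ^^ (j - i)) a = a"
      using funpow_inj a by (metis image_eqI inj_onD)
  qed
qed

lemma R_f_iff: assumes "a \<in> U" "b \<in> U" shows "R (f a) (f b) \<longleftrightarrow> R a b"
proof
  obtain k where k: "k > 0" "\<And>a. a \<in> U \<Longrightarrow> (f ^^ k) a = a" using period by blast
  have *: "R x y \<Longrightarrow> R ((f ^^ n) x) ((f ^^ n) y)" for n x y
    by (induction n) (auto intro: R_f)
  assume "R (f a) (f b)"
  moreover have "(f ^^ (k - 1)) (f x) = x" if "x \<in> U" for x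
    using k(2)[OF that] k(1) by (cases k) (simp_all add: funpow_swap1)
  ultimately show "R a b" using *[of "f a" "f b" "k - 1"] assms by simp
qed (rule R_f)

text \<open>By \<open>R_f_iff\<close>, \<open>f\<close> maps classes onto classes, and
  \<open>arc_f\<close> keeps the cyclic order inside them.\<close>

lemma succ_f: assumes a: "a \<in> U" shows "succ (f a) = f (succ a)"
proof (rule succ_eqI)
  show "f a \<in> U" "f (succ a) \<in> U" "R (f a) (f (succ a))"
    using assms succ_props f_U R_f by auto
  show "f (succ a) \<noteq> f a" using f_inj succ_props[OF a] a by (meson inj_onD)
  fix c assume c: "c \<in> U" "R (f a) c" "c \<noteq> f a"
  obtain d where d: "d \<in> U" "c = f d" using c f_img by blast
  have "R a d" "d \<noteq> a" using c d R_f_iff a by auto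
  then have "\<not> arc_len a d < arc_len a (succ a)" using succ_props(4)[OF a d(1)] by (simp add: gap_def)
  then show "arc_len (f a) (f (succ a)) \<le> arc_len (f a) c"
    using arc_f[OF a d(1) succ_props(1)[OF a] \<open>R a d\<close> succ_props(2)[OF a]] d by auto
qed

lemma succ_neg: assumes a: "a \<in> U" shows "succ (neg a) = neg (succ a)"
proof (rule succ_eqI)
  show "neg a \<in> U" "neg (succ a) \<in> U" "R (neg a) (neg (succ a))"
    using assms succ_props neg_img R_neg by auto
  show "neg (succ a) \<noteq> neg a" using neg_neg succ_props[OF a] a by metis
  fix c assume c: "c \<in> U" "R (neg a) c" "c \<noteq> neg a"
  have d: "neg c \<in> U" "R a (neg c)" "neg c \<noteq> a"
    using neg_img R_neg[OF neg_img[OF a] c(1,2)] neg_neg c a by metis+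
  have "arc_len (neg a) (neg (succ a)) = arc_len a (succ a)" "arc_len (neg a) (neg (neg c)) = arc_len a (neg c)"
    using arc_neg U01 a d succ_props(1)[OF a] by blast+
  then show "arc_len (neg a) (neg (succ a)) \<le> arc_len (neg a) c"
    using succ_props(4)[OF a d] neg_neg c by (simp add: gap_def)
qed

section \<open>The commutative group generated by \<open>f\<close> and \<open>neg\<close>, and its
  orbits\<close>

definition mov :: "nat \<Rightarrow> nat \<Rightarrow> real \<Rightarrow> real" where "mov i j a = (neg ^^ i) ((f ^^ j) a)"

lemma f_pow_U: "a \<in> U \<Longrightarrow> (f ^^ j) a \<in> U" by (induction j) (auto intro: f_U)
lemma neg_pow_U: "a \<in> U \<Longrightarrow> (neg ^^ j) a \<in> U" by (induction j) (auto intro: neg_img)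
lemma mov_U: "a \<in> U \<Longrightarrow> mov i j a \<in> U" by (simp add: mov_def f_pow_U neg_pow_U)

lemma f_neg_pow: "a \<in> U \<Longrightarrow> f ((neg ^^ i) a) = (neg ^^ i) (f a)"
  by (induction i) (auto simp: f_neg neg_pow_U)

lemma f_pow_neg_pow: "a \<in> U \<Longrightarrow> (f ^^ j) ((neg ^^ i) a) = (neg ^^ i) ((f ^^ j) a)"
  by (induction j) (auto simp: f_neg_pow f_pow_U)

lemma mov_mov: "a \<in> U \<Longrightarrow> mov i j (mov k l a) = mov (i + k) (j + l) a"
  by (simp add: mov_def f_pow_neg_pow f_pow_U funpow_add)

text \<open>Both generators have finite order on \<open>U\<close>, so inverses are again of the form
  \<open>mov k l\<close>. This is what makes \<open>orb\<close> a symmetric relation.\<close>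

lemma mov_inv: assumes "a \<in> U" shows "\<exists>k l. \<forall>a\<in>U. mov k l (mov i j a) = a"
proof -
  obtain k where k: "k > 0" "\<And>a. a \<in> U \<Longrightarrow> (f ^^ k) a = a" using period by blast
  have fk: "(f ^^ (k * j)) a = a" if "a \<in> U" for a
    by (induction j) (auto simp: funpow_add k that)
  have ni: "(neg ^^ (i + i)) a = a" if "a \<in> U" for a
  proof (induction i)
    case (Suc i)
    then show ?case using neg_neg that by simp
  qed simp
  have kj: "k * j - j + j = k * j" using k(1) by (cases k) auto
  have "mov i (k * j - j) (mov i j a) = a" if "a \<in> U" for a
    unfolding mov_mov[OF that] kj using fk[OF that] ni[OF that] by (simp add: mov_def)
  then show ?thesis by blast
qed

lemma mov_R: "a \<in> U \<Longrightarrow> b \<in> U \<Longrightarrow> R a b \<Longrightarrow> R (mov i j a) (mov i j b)"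
proof -
  assume a: "a \<in> U" "b \<in> U" "R a b"
  have 1: "R ((f ^^ j) a) ((f ^^ j) b)" by (induction j) (auto intro: R_f a)
  show ?thesis unfolding mov_def
    by (induction i) (auto intro!: R_neg neg_pow_U f_pow_U 1 a)
qed

lemma mov_succ: "a \<in> U \<Longrightarrow> mov i j (succ a) = succ (mov i j a)"
proof -
  assume a: "a \<in> U"
  have 1: "(f ^^ j) (succ a) = succ ((f ^^ j) a)" by (induction j) (auto simp: succ_f f_pow_U a)
  show ?thesis unfolding mov_def 1
    by (induction i) (auto simp: succ_neg neg_pow_U f_pow_U a)
qed

definition orb :: "real \<Rightarrow> real set" where "orb a = {mov i j a | i j. True}"

lemma orb_sub: "a \<in> U \<Longrightarrow> orb a \<subseteq> U" by (auto simp: orb_def mov_U)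
lemma orb_refl: "a \<in> orb a" unfolding orb_def mov_def by (metis (mono_tags, lifting) CollectI funpow_0)
lemma orb_trans: "a \<in> U \<Longrightarrow> b \<in> orb a \<Longrightarrow> c \<in> orb b \<Longrightarrow> c \<in> orb a"
  unfolding orb_def using mov_mov by fastforce
lemma orb_sym: "a \<in> U \<Longrightarrow> b \<in> orb a \<Longrightarrow> a \<in> orb b"
proof -
  assume "a \<in> U" "b \<in> orb a"
  then obtain i j where "b = mov i j a" by (auto simp: orb_def)
  with mov_inv[OF \<open>a \<in> U\<close>, of i j] \<open>a \<in> U\<close> show ?thesis unfolding orb_def
    by (smt (verit) mem_Collect_eq)
qed

text \<open>If \<open>b\<close> were missing from \<open>S\<close>, the point of \<open>S\<close>
  nearest before \<open>b\<close> would have a successor in \<open>S\<close> that is nearer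
  still.\<close>

lemma succ_closed:
  assumes a: "a \<in> U" and S: "S \<subseteq> cls a" "S \<noteq> {}" "\<And>s. s \<in> S \<Longrightarrow> succ s \<in> S"
  shows "S = cls a"
proof (rule ccontr)
  assume "S \<noteq> cls a"
  then obtain b where b: "b \<in> U" "R a b" "b \<notin> S" using S by (auto simp: cls_def)
  have fS: "finite S" using S fin by (auto simp: cls_def intro: finite_subset)
  obtain s where s: "s \<in> S" "\<And>t. t \<in> S \<Longrightarrow> arc_len s b \<le> arc_len t b"
    using ex_min_on[OF fS S(2), of "\<lambda>s. arc_len s b"] by blast
  have sU: "s \<in> U" "R a s" using s S by (auto simp: cls_def)
  have "gap s \<le> arc_len s b" using succ_props(4)[OF sU(1) b(1)] sU b R_trans R_sym s by blast
  moreover have "arc_len s b \<le> arc_len (succ s) b" using s S by auto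
  moreover have "succ s \<noteq> b" using s S b by auto
  ultimately show False
    using gap_pos[OF sU(1)] U_bounds[OF sU(1)] U_bounds[OF b(1)] U_bounds[OF succ_props(1)[OF sU(1)]]
    unfolding gap_def arc_len_def by (auto split: if_splits)
qed

section \<open>Gaps that contain the critical value\<close>

definition holds_y :: "real \<Rightarrow> bool" where "holds_y a \<longleftrightarrow> a \<in> U \<and> arc_len a y < gap a"

lemma holds_y_unique:
  assumes "holds_y a" "holds_y b" "R a b" shows "a = b"
proof (rule ccontr)
  assume "a \<noteq> b"
  have ab: "a \<in> U" "b \<in> U" using assms by (auto simp: holds_y_def)
  have "arc_len a y < arc_len a b" "arc_len b y < arc_len b a"
    using assms ab succ_props(4) R_sym \<open>a \<noteq> b\<close> unfolding holds_y_def by fastforce+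
  then show False using U_bounds[OF ab(1)] U_bounds[OF ab(2)] y01 \<open>a \<noteq> b\<close>
    unfolding arc_len_def by (auto split: if_splits)
qed

lemma holds_y_exists:
  assumes a: "a \<in> U" shows "\<exists>b. holds_y b \<and> R a b"
proof -
  have fS: "finite (cls a)" "cls a \<noteq> {}" using fin a R_refl by (auto simp: cls_def)
  obtain s where s: "s \<in> cls a" "\<And>t. t \<in> cls a \<Longrightarrow> arc_len s y \<le> arc_len t y"
    using ex_min_on[OF fS, of "\<lambda>s. arc_len s y"] by blast
  have sU: "s \<in> U" "R a s" using s by (auto simp: cls_def)
  have "arc_len s y \<le> arc_len (succ s) y" using s succ_props[OF sU(1)] sU R_trans by (auto simp: cls_def)
  then have "arc_len s y < gap s"
    using U_bounds[OF sU(1)] U_bounds[OF succ_props(1)[OF sU(1)]] y01 y_notin succ_props(1,3)[OF sU(1)] sU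
    unfolding gap_def arc_len_def by (auto split: if_splits)
  then show ?thesis using sU by (auto simp: holds_y_def)
qed

text \<open>A shortest gap of the orbit cannot be three times as long as the gap that
  \<open>f\<close> maps to it, since that one is at least as long. So \<open>expand\<close> puts
  \<open>y\<close> or \<open>neg y\<close> into it, and in the second case \<open>neg\<close> moves
  it to a gap of the same length that holds \<open>y\<close>.\<close>

lemma shrink:
  assumes a: "a \<in> U" obtains b where "b \<in> orb a" "holds_y b" "gap b \<le> gap a"
proof -
  have fS: "finite (orb a)" "orb a \<noteq> {}" using orb_sub[OF a] fin orb_refl finite_subset by blast+
  obtain s where s: "s \<in> orb a" "\<And>t. t \<in> orb a \<Longrightarrow> gap s \<le> gap t"
    using ex_min_on[OF fS, of gap] by blast
  have sU: "s \<in> U" using s orb_sub a by blast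
  obtain k where k: "k > 0" "\<And>a. a \<in> U \<Longrightarrow> (f ^^ k) a = a" using period by blast
  define t where "t = (f ^^ (k - 1)) s"
  have "t = mov 0 (k - 1) s" by (simp add: t_def mov_def)
  then have "t \<in> orb s" by (auto simp: orb_def)
  then have t: "t \<in> orb a" using orb_trans[OF a s(1)] by blast
  then have tU: "t \<in> U" using orb_sub a by blast
  have ft: "f t = s" unfolding t_def using k sU
    by (metis Suc_diff_1 comp_apply funpow.simps(2))
  have "gap t > 0" "gap s \<le> gap t" using gap_pos tU s t by auto
  then have "arc_len (f t) (f (succ t)) \<noteq> 3 * arc_len t (succ t)"
    using succ_f[OF tU] ft by (simp add: gap_def)
  then consider "arc_len s y < gap s" | "arc_len s (neg y) < gap s"
    using expand[OF tU succ_props(1,2)[OF tU]] succ_props(3)[OF tU] succ_f[OF tU] ft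
    unfolding gap_def by metis
  then show thesis
  proof cases
    case 1
    then show ?thesis using that[of s] s sU a orb_refl by (auto simp: holds_y_def)
  next
    case 2
    have nU: "neg s \<in> U" using sU neg_img by auto
    have "arc_len (neg s) (neg (neg y)) = arc_len s (neg y)"
      using U01 sU neg_y01 by (intro arc_neg) auto
    moreover have "gap (neg s) = gap s"
      unfolding gap_def succ_neg[OF sU] using U01 sU succ_props(1)[OF sU] by (intro arc_neg) auto
    ultimately have "holds_y (neg s)" using 2 nU by (simp add: holds_y_def neg_neg_y)
    moreover have "neg s = mov 1 0 s" by (simp add: mov_def)
    then have "neg s \<in> orb s" by (auto simp: orb_def)
    then have "neg s \<in> orb a" using orb_trans[OF a s(1)] by blast
    ultimately show ?thesis using that[of "neg s"] \<open>gap (neg s) = gap s\<close> s orb_refl by auto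
  qed
qed

text \<open>\<open>shrink\<close> leads from \<open>a\<close> to some \<open>c\<close> whose gap
  holds \<open>y\<close> and is no longer than that of \<open>a\<close>. If \<open>c\<close> is in
  the class of \<open>a0\<close>, then it is \<open>a0\<close>. Otherwise the gap of
  \<open>c\<close> is at least as long as that of \<open>a0\<close>, which forces the class of
  \<open>a0\<close> into the gap of \<open>c\<close>. All gaps of that class except the outer one
  are then shorter than the gap of \<open>c\<close>.\<close>

lemma orbit_or_largest:
  assumes a0: "holds_y a0" "\<forall>b. holds_y b \<longrightarrow> gap a0 \<le> gap b"
    and a: "a \<in> U" "R a0 a"
  shows "a \<in> orb a0 \<or> (\<forall>b\<in>U. R a0 b \<longrightarrow> b \<noteq> a \<longrightarrow> gap b < gap a)"
proof -
  have a0U: "a0 \<in> U" using a0 by (simp add: holds_y_def)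
  obtain c where c: "c \<in> orb a" "holds_y c" "gap c \<le> gap a" using shrink[OF a(1)] .
  have cU: "c \<in> U" using c by (simp add: holds_y_def)
  show ?thesis
  proof (cases "R c a0")
    case True
    then have "c = a0" using holds_y_unique c a0 by blast
    then show ?thesis using orb_sym[OF a(1)] c by blast
  next
    case False
    let ?d = "succ c"
    have dU: "?d \<in> U" "R c ?d" using succ_props[OF cU] by auto
    have ne: "b \<noteq> c \<and> b \<noteq> ?d" if "R a0 b" for b
      using that False dU R_sym R_trans by blast
    \<comment> \<open>Otherwise the gap of \<open>a0\<close>, which also holds \<open>y\<close>,
      would strictly cover the gap of \<open>c\<close>, against the minimal choice of
      \<open>a0\<close>.\<close>
    have "\<exists>b\<in>U. R a0 b \<and> arc_len c b < gap c"
    proof (rule ccontr)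
      assume con: "\<not> ?thesis"
      let ?e = "succ a0"
      have e: "?e \<in> U" "R a0 ?e" using succ_props[OF a0U] by auto
      have "\<not> arc_len c a0 < gap c" "\<not> arc_len c ?e < gap c" using con a0U R_refl e by auto
      moreover have "arc_len a0 y < arc_len a0 ?e" "arc_len c y < arc_len c ?d" "arc_len a0 ?e \<le> arc_len c ?d"
        using a0 c by (auto simp: holds_y_def gap_def)
      moreover have "arc_len c a0 \<noteq> arc_len c ?d" "arc_len c ?e \<noteq> arc_len c ?d"
        using arc_eq_iff U01 cU dU a0U e ne R_refl by blast+
      ultimately show False
        using arc_less_of_covering[of a0 ?e c ?d y] subsetD[OF U01 a0U] subsetD[OF U01 e(1)]
          subsetD[OF U01 cU] subsetD[OF U01 dU(1)] y01 unfolding gap_def by linarith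
    qed
    then obtain b0 where b0: "b0 \<in> U" "R a0 b0" "arc_len c b0 < gap c" by blast
    \<comment> \<open>One point of the class inside the gap of \<open>c\<close> and one outside
      would be linked with \<open>c\<close> and \<open>?d\<close>, merging the two classes.\<close>
    have all: "arc_len c b < gap c" if b: "b \<in> U" "R a0 b" for b
    proof (rule ccontr)
      assume "\<not> arc_len c b < gap c"
      moreover have "arc_len c b \<noteq> arc_len c ?d"
        using arc_eq_iff U01 b dU cU ne by blast
      moreover have "0 < arc_len c b0" using arc_0_iff[of c b0] U01 cU b0 ne by fastforce
      ultimately have "linked c ?d b0 b" using b0 unfolding linked_def gap_def by auto
      moreover have "R b0 b" using b0 b R_trans R_sym by blast
      ultimately have "R c b0" using unlinked[OF cU dU(1) b0(1) b(1) dU(2)] by blast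
      then show False using False b0 R_trans R_sym by blast
    qed
    let ?P = "cls a0"
    have fS: "finite ?P" "?P \<noteq> {}" using fin a0U R_refl by (auto simp: cls_def)
    \<comment> \<open>\<open>h\<close> is the last point of the class inside the gap of
      \<open>c\<close>; the gap after \<open>h\<close> is the only one that leaves the gap of
      \<open>c\<close>.\<close>
    obtain h where h: "h \<in> ?P" "\<And>t. t \<in> ?P \<Longrightarrow> arc_len c t \<le> arc_len c h"
      using ex_min_on[OF fS, of "\<lambda>t. - arc_len c t"] by (metis neg_le_iff_le)
    have hU: "h \<in> U" "R a0 h" using h by (auto simp: cls_def)
    have small: "gap b < gap c" if b: "b \<in> U" "R a0 b" "b \<noteq> h" for b
    proof -
      have "arc_len c b \<le> arc_len c h" using h b by (auto simp: cls_def)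
      moreover have "arc_len c h < gap c" using all hU by blast
      moreover have "gap b \<le> arc_len b h" using succ_props(4)[OF b(1) hU(1)] b hU R_trans R_sym by blast
      ultimately show ?thesis
        using U_bounds[OF cU] U_bounds[OF hU(1)] U_bounds[OF b(1)] ne[OF hU(2)] ne[OF b(2)] b(3)
        unfolding arc_len_def by (auto split: if_splits)
    qed
    then have "a = h" using a c by fastforce
    then show ?thesis using small c by fastforce
  qed
qed

text \<open>By \<open>orbit_or_largest\<close> at most one point of the class lies outside the orbit
  of \<open>a0\<close>. A move taking \<open>a0\<close> to a third point of the class would have to
  fix this exceptional point; but moves commute with \<open>succ\<close>, so one fixed point makes
  the whole class fixed. Hence \<open>succ a0\<close> lies in the orbit of \<open>a0\<close>, and a
  move that takes \<open>a0\<close> to \<open>succ a0\<close> advances every point of the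
  class.\<close>

lemma rotation:
  assumes "U \<noteq> {}"
  obtains a0 i j where "a0 \<in> U" "\<And>a. a \<in> U \<Longrightarrow> R a0 a \<Longrightarrow> mov i j a = succ a"
proof -
  have "Collect holds_y \<subseteq> U" by (auto simp: holds_y_def)
  then have fH: "finite (Collect holds_y)" "Collect holds_y \<noteq> {}"
    using fin holds_y_exists assms finite_subset by blast+
  obtain a0 where a0: "holds_y a0" "\<forall>b. holds_y b \<longrightarrow> gap a0 \<le> gap b"
    using ex_min_on[OF fH, of gap] by (metis mem_Collect_eq)
  have a0U: "a0 \<in> U" using a0 by (simp add: holds_y_def)
  note key = orbit_or_largest[OF a0]
  have orb: "a \<in> orb a0" if a: "a \<in> U" "R a0 a" for a
  proof (rule ccontr)
    assume na: "a \<notin> orb a0"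
    then have "a \<noteq> a0" using orb_refl by blast
    obtain c where c: "c \<in> U" "R a0 c" "c \<noteq> a0" "c \<noteq> a" using three[OF a0U] by metis
    have uniq: "x = a" if "x \<in> U" "R a0 x" "x \<notin> orb a0" for x
      using key[OF a] key[OF that(1,2)] na that a by (metis order_less_asym)
    have "c \<in> orb a0" using uniq c by blast
    then obtain i j where ij: "c = mov i j a0" by (auto simp: orb_def)
    have "R a0 (mov i j a)" using mov_R[OF a0U a(1,2), of i j] ij c R_trans by blast
    moreover have "mov i j a \<notin> orb a0"
    proof
      assume "mov i j a \<in> orb a0"
      moreover have "mov i j a \<in> orb a" by (auto simp: orb_def)
      then have "a \<in> orb (mov i j a)" using orb_sym[OF a(1)] by blast
      ultimately show False using orb_trans a0U na by blast
    qed
    ultimately have fix_a: "mov i j a = a" using uniq mov_U a by blast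
    have "{x \<in> cls a0. mov i j x = x} = cls a0"
    proof (rule succ_closed[OF a0U])
      show "{x \<in> cls a0. mov i j x = x} \<noteq> {}" using a fix_a by (auto simp: cls_def)
      show "succ s \<in> {x \<in> cls a0. mov i j x = x}" if "s \<in> {x \<in> cls a0. mov i j x = x}" for s
        using that mov_succ[of s i j] succ_props(1,2)[of s] R_trans by (auto simp: cls_def)
    qed auto
    then have "mov i j a0 = a0" using a0U R_refl by (auto simp: cls_def)
    then show False using ij c by simp
  qed
  have "succ a0 \<in> orb a0" using orb succ_props[OF a0U] by blast
  then obtain i j where ij: "mov i j a0 = succ a0" by (auto simp: orb_def)
  have "{x \<in> cls a0. mov i j x = succ x} = cls a0"
  proof (rule succ_closed[OF a0U])
    show "{x \<in> cls a0. mov i j x = succ x} \<noteq> {}" using a0U ij R_refl by (auto simp: cls_def)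
    show "succ s \<in> {x \<in> cls a0. mov i j x = succ x}" if "s \<in> {x \<in> cls a0. mov i j x = succ x}" for s
      using that mov_succ[of s i j] succ_props(1,2)[of s] R_trans by (auto simp: cls_def)
  qed auto
  then show thesis using that[OF a0U, of i j] by (auto simp: cls_def)
qed

text \<open>Each of the two arcs between \<open>p\<close> and \<open>q\<close> contains a point of
  the class, so \<open>succ p\<close> falls strictly inside one and \<open>succ q\<close> strictly
  inside the other.\<close>

lemma succ_linked:
  assumes p: "p \<in> U" "q \<in> U" "r \<in> U" "t \<in> U" "R p q" "R p r" "R p t" and l: "linked p q r t"
  shows "linked p q (succ p) (succ q)"
proof -
  have *: "linked p q (succ p) (succ q)"
    if rt: "0 < arc_len p r" "arc_len p r < arc_len p q" "arc_len p q < arc_len p t" "r \<in> U" "t \<in> U" "R p r" "R p t" for r t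
  proof -
    have "r \<noteq> p" "t \<noteq> q" using rt by (auto simp: arc_len_def)
    then have "gap p \<le> arc_len p r" "gap q \<le> arc_len q t" "0 < gap p" "0 < gap q"
      using succ_props(4) gap_pos p rt R_trans R_sym by metis+
    then show ?thesis
      using rt(1-3) U_bounds[OF p(1)] U_bounds[OF p(2)] U_bounds[OF rt(4)] U_bounds[OF rt(5)]
        U_bounds[OF succ_props(1)[OF p(1)]] U_bounds[OF succ_props(1)[OF p(2)]]
      unfolding linked_def gap_def arc_len_def by (auto split: if_splits)
  qed
  show ?thesis using l p *[of r t] *[of t r] unfolding linked_def by blast
qed

end

section \<open>Tripling on the complement of the critical strips\<close>

lemma frac_eqI: "x - r \<in> \<int> \<Longrightarrow> 0 \<le> r \<Longrightarrow> r < 1 \<Longrightarrow> frac x = r"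
  by (simp add: frac_unique_iff)

lemma frac_cong: assumes "x - y \<in> \<int>" shows "frac x = frac y"
proof (rule frac_eqI)
  have "x - frac y = (x - y) + of_int \<lfloor>y\<rfloor>" by (simp add: frac_def)
  then show "x - frac y \<in> \<int>" using assms by (metis Ints_add Ints_of_int)
qed (simp_all add: frac_lt_1)

lemma frac_in: "frac x \<in> {0..<1}" by (simp add: frac_lt_1)

lemma arc_eq_frac: "a \<in> {0..<1} \<Longrightarrow> b \<in> {0..<1} \<Longrightarrow> arc_len a b = frac (b - a)"
  using arc_frac[of a b] by (simp add: frac_eq)

definition triple_pt :: "real \<Rightarrow> real" where "triple_pt t = frac (3 * t)"
definition half_turn :: "real \<Rightarrow> real" where "half_turn t = frac (t + 1/2)"

lemma triple_in: "triple_pt t \<in> {0..<1}" by (simp add: triple_pt_def frac_lt_1)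
lemma half_in: "half_turn t \<in> {0..<1}" by (simp add: half_turn_def frac_lt_1)

lemma half_half: "t \<in> {0..<1} \<Longrightarrow> half_turn (half_turn t) = t"
proof -
  assume t: "t \<in> {0..<1}"
  have "frac (frac (t + 1/2) + 1/2) = t"
  proof (rule frac_eqI)
    have "frac (t + 1/2) + 1/2 - t = 1 - of_int \<lfloor>t + 1/2\<rfloor>" by (simp add: frac_def)
    then show "frac (t + 1/2) + 1/2 - t \<in> \<int>" by (metis Ints_1 Ints_diff Ints_of_int)
  qed (use t in auto)
  then show ?thesis by (simp add: half_turn_def)
qed

lemma triple_half: "triple_pt (half_turn t) = half_turn (triple_pt t)"
proof -
  have "3 * frac (t + 1/2) - (frac (3 * t) + 1/2) = of_int (1 - 3 * \<lfloor>t + 1/2\<rfloor> + \<lfloor>3 * t\<rfloor>)"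
    by (simp add: frac_def)
  then have "3 * frac (t + 1/2) - (frac (3 * t) + 1/2) \<in> \<int>" by (metis Ints_of_int)
  then show ?thesis unfolding triple_pt_def half_turn_def by (rule frac_cong)
qed

lemma arc_half: "arc_len (half_turn a) (half_turn b) = arc_len a b" if "a \<in> {0..<1}" "b \<in> {0..<1}"
  unfolding half_turn_def arc_frac using arc_eq_frac[OF that] by simp

lemma arc_less_cong:
  assumes "a \<in> {0..<1}" "b \<in> {0..<1}" "c \<in> {0..<1}" "a' \<in> {0..<1}" "b' \<in> {0..<1}" "c' \<in> {0..<1}"
    and "a < b \<longleftrightarrow> a' < b'" "b < a \<longleftrightarrow> b' < a'" "a < c \<longleftrightarrow> a' < c'" "c < a \<longleftrightarrow> c' < a'"
      "b < c \<longleftrightarrow> b' < c'"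
  shows "arc_len a b < arc_len a c \<longleftrightarrow> arc_len a' b' < arc_len a' c'"
  using assms by (auto simp: arc_len_def)

lemma linked_cong:
  assumes "\<And>s t u. s \<in> {a, b, x, y} \<Longrightarrow> t \<in> {a, b, x, y} \<Longrightarrow> u \<in> {a, b, x, y} \<Longrightarrow>
      arc_len s t < arc_len s u \<longleftrightarrow> arc_len (h s) (h t) < arc_len (h s) (h u)"
  shows "linked a b x y \<longleftrightarrow> linked (h a) (h b) (h x) (h y)"
proof -
  have *: "linked a b x y \<longleftrightarrow> arc_len a a < arc_len a x \<and> arc_len a x < arc_len a b \<and> arc_len a b < arc_len a y
     \<or> arc_len a a < arc_len a y \<and> arc_len a y < arc_len a b \<and> arc_len a b < arc_len a x" for a b x y
    unfolding linked_def by (simp add: arc_len_def[of a a])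
  show ?thesis unfolding * using assms by auto
qed

lemma linked_order:
  assumes "a \<in> {0..<1}" "b \<in> {0..<1}" "x \<in> {0..<1}" "y \<in> {0..<1}"
  shows "linked a b x y \<longleftrightarrow> a < x \<and> x < b \<and> (y < a \<or> b < y) \<or> b < x \<and> x < a \<and> (y < b \<or> a < y) \<or>
     a < y \<and> y < b \<and> (x < a \<or> b < x) \<or> b < y \<and> y < a \<and> (x < b \<or> a < x)"
  using assms unfolding linked_def arc_len_def by auto

text \<open>In coordinates starting at the end of a strip of width \<open>v\<close>, the two strips meet the circle in
  four arcs of length \<open>v\<close> ending at \<open>1/3\<close>, \<open>1/2\<close>, \<open>5/6\<close> and \<open>1\<close>. Piece 2 lies between the strips
  and consists of two arcs; the value 0 marks the strips.\<close>

definition piece :: "real \<Rightarrow> real \<Rightarrow> nat" where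
  "piece v s = (if s \<le> 1/3 - v then 1 else if 1/3 \<le> s \<and> s \<le> 1/2 - v then 2
     else if 1/2 \<le> s \<and> s \<le> 5/6 - v then 3 else if 5/6 \<le> s \<and> s \<le> 1 - v then 2 else 0)"

text \<open>\<open>v\<close> is the width of the strips and \<open>c\<close> the origin of the
  coordinate used in \<open>piece\<close>. Up to \<open>v = 1/6\<close> the four strip arcs do not
  overlap.\<close>

locale strips =
  fixes v c :: real
  assumes v0: "0 < v" and v6: "v \<le> 1/6"
begin

definition tau :: "real \<Rightarrow> real" where "tau t = frac (t - c)"

definition pc :: "real \<Rightarrow> nat" where "pc t = piece v (tau t)"

text \<open>A lift of tripling that is increasing on each piece, with values in
  \<open>[0, 1 - 3 * v]\<close>. Modulo 1 it differs from \<open>3 * tau\<close> by a constant on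
  each piece. On piece 3 this constant is \<open>3/2\<close>, not an integer; that is harmless, as
  only differences within a piece are compared.\<close>

definition phi :: "real \<Rightarrow> real" where
  "phi t = (if tau t \<le> 1/3 - v then 3 * tau t else if tau t \<le> 1/2 - v then 3 * tau t - 1
     else if tau t \<le> 5/6 - v then 3 * tau t - 3/2 else 3 * tau t - 2)"

lemma tau_in: "tau t \<in> {0..<1}" by (simp add: tau_def frac_lt_1)
lemma tau_bounds: "0 \<le> tau t" "tau t < 1" by (simp_all add: tau_def frac_lt_1)

lemma arc_tau: "a \<in> {0..<1} \<Longrightarrow> b \<in> {0..<1} \<Longrightarrow> arc_len (tau a) (tau b) = arc_len a b"
  by (simp add: tau_def arc_frac arc_eq_frac)

lemma phi_in: "pc t \<noteq> 0 \<Longrightarrow> 0 \<le> phi t \<and> phi t \<le> 1 - 3 * v"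
  using tau_bounds[of t] v0 v6 by (auto simp: pc_def piece_def phi_def split: if_splits)

lemma phi_less: "pc a = pc b \<Longrightarrow> pc a \<noteq> 0 \<Longrightarrow> phi a < phi b \<longleftrightarrow> tau a < tau b"
  using tau_bounds[of a] tau_bounds[of b] v0 v6 by (auto simp: pc_def piece_def phi_def split: if_splits)

lemma phi_diff: "pc a = pc b \<Longrightarrow> pc a \<noteq> 0 \<Longrightarrow> phi b - phi a - (3 * tau b - 3 * tau a) \<in> \<int>"
  using tau_bounds[of a] tau_bounds[of b] v0 v6 by (auto simp: pc_def piece_def phi_def split: if_splits)

lemma arc_triple:
  assumes "pc a = pc b" "pc a \<noteq> 0"
  shows "arc_len (triple_pt a) (triple_pt b) = arc_len (phi a) (phi b)"
proof -
  have p: "phi a \<in> {0..<1}" "phi b \<in> {0..<1}" using phi_in[of a] phi_in[of b] assms v0 by auto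
  have "3 * b - 3 * a - (3 * tau b - 3 * tau a) = of_int (3 * \<lfloor>b - c\<rfloor> - 3 * \<lfloor>a - c\<rfloor>)"
    by (simp add: tau_def frac_def)
  then have "3 * b - 3 * a - (3 * tau b - 3 * tau a) \<in> \<int>" by (metis Ints_of_int)
  then have "(3 * b - 3 * a - (3 * tau b - 3 * tau a)) - (phi b - phi a - (3 * tau b - 3 * tau a)) \<in> \<int>"
    using phi_diff[OF assms] by (rule Ints_diff)
  then have "frac (3 * b - 3 * a) = frac (phi b - phi a)" by (intro frac_cong) (simp add: algebra_simps)
  then show ?thesis unfolding triple_pt_def arc_frac using arc_eq_frac[OF p] by simp
qed

text \<open>Cyclic order depends only on the linear order of representatives in
  \<open>[0, 1)\<close>, and on one piece \<open>phi\<close> and \<open>tau\<close> order points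
  alike.\<close>

lemma arc_triple_less:
  assumes "a \<in> {0..<1}" "b \<in> {0..<1}" "d \<in> {0..<1}" "pc a = pc b" "pc a = pc d" "pc a \<noteq> 0"
  shows "arc_len a b < arc_len a d \<longleftrightarrow> arc_len (triple_pt a) (triple_pt b) < arc_len (triple_pt a) (triple_pt d)"
proof -
  have "arc_len (tau a) (tau b) < arc_len (tau a) (tau d) \<longleftrightarrow> arc_len (phi a) (phi b) < arc_len (phi a) (phi d)"
    by (rule arc_less_cong)
      (use phi_in[of a] phi_in[of b] phi_in[of d] assms v0 tau_in in \<open>auto simp: phi_less\<close>)
  then show ?thesis using assms by (simp add: arc_tau arc_triple)
qed

lemma linked_triple:
  assumes "{a, b, x, y} \<subseteq> {0..<1}" "\<And>s. s \<in> {a, b, x, y} \<Longrightarrow> pc s = k" "k \<noteq> 0"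
  shows "linked a b x y \<longleftrightarrow> linked (triple_pt a) (triple_pt b) (triple_pt x) (triple_pt y)"
  by (rule linked_cong, rule arc_triple_less) (use assms in \<open>(blast | metis)+\<close>)

lemma triple_inj:
  assumes "a \<in> {0..<1}" "b \<in> {0..<1}" "pc a = pc b" "pc a \<noteq> 0" "triple_pt a = triple_pt b"
  shows "a = b"
proof (rule ccontr)
  assume "a \<noteq> b"
  then have "arc_len a a < arc_len a b" using assms by (auto simp: arc_len_def)
  then show False using arc_triple_less[of a a b] assms by simp
qed

text \<open>The common image of \<open>c + 1/2 - x\<close> and \<open>c + 5/6 - x\<close>, which for \<open>0 < x < v\<close> are the endpoints of a
  critical chord in one of the strips.\<close>

definition crit_value :: "real \<Rightarrow> real" where "crit_value x = frac (3 * (c + 1/2 - x))"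

lemma arc_crit_value:
  "arc_len (triple_pt a) (crit_value x) = frac (3/2 - 3 * x - 3 * tau a)"
  "arc_len (triple_pt a) (half_turn (crit_value x)) = frac (1 - 3 * x - 3 * tau a)"
proof -
  have "3 * (c + 1/2 - x) - 3 * a - (3/2 - 3 * x - 3 * tau a) = of_int (- 3 * \<lfloor>a - c\<rfloor>)"
    by (simp add: tau_def frac_def algebra_simps)
  then show "arc_len (triple_pt a) (crit_value x) = frac (3/2 - 3 * x - 3 * tau a)"
    unfolding triple_pt_def crit_value_def arc_frac by (metis Ints_of_int frac_cong)
  have "(frac (3 * (c + 1/2 - x)) + 1/2) - 3 * a - (1 - 3 * x - 3 * tau a) =
      of_int (1 - \<lfloor>3 * (c + 1/2 - x)\<rfloor> - 3 * \<lfloor>a - c\<rfloor>)"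
    by (simp add: tau_def frac_def algebra_simps)
  then show "arc_len (triple_pt a) (half_turn (crit_value x)) = frac (1 - 3 * x - 3 * tau a)"
    unfolding triple_pt_def crit_value_def half_turn_def arc_frac by (metis Ints_of_int frac_cong)
qed

text \<open>The ends of a gap of a piece have images \<open>3 * v\<close> apart, and the arc between
  these images is swept out by the values \<open>crit_value x\<close> or by their antipodes. An arc
  between points of the piece either jumps over no gap, and is tripled, or its image contains such
  an arc.\<close>

lemma expand_or_wrap:
  assumes ab: "a \<in> {0..<1}" "b \<in> {0..<1}" "pc a = pc b" "pc a \<noteq> 0" "a \<noteq> b"
  shows "arc_len (triple_pt a) (triple_pt b) = 3 * arc_len a b \<or>
    3 * v \<le> arc_len (triple_pt a) (triple_pt b) \<and> (\<forall>x. 0 < x \<longrightarrow> x < v \<longrightarrow>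
      arc_len (triple_pt a) (crit_value x) < arc_len (triple_pt a) (triple_pt b) \<or>
      arc_len (triple_pt a) (half_turn (crit_value x)) < arc_len (triple_pt a) (triple_pt b))"
proof -
  let ?s = "tau a" and ?t = "tau b"
  let ?goal = "\<lambda>r. r = 3 * arc_len ?s ?t \<or> 3 * v \<le> r \<and> (\<forall>x. 0 < x \<longrightarrow> x < v \<longrightarrow>
      frac (3/2 - 3 * x - 3 * ?s) < r \<or> frac (1 - 3 * x - 3 * ?s) < r)"
  have ne: "?s \<noteq> ?t" using ab arc_tau[of a b] by (auto simp: arc_len_def split: if_splits)
  \<comment> \<open>Distances from the image of \<open>a\<close> to the critical value, or its
    antipode, hidden in the next gap of the piece: \<open>fr\<close> for piece 1, \<open>fr2\<close>
    and \<open>fr4\<close> for the two arcs of piece 2, \<open>fr3\<close> for piece 3.\<close>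
  have fr: "frac (1 - 3 * x - 3 * ?s) = 1 - 3 * x - 3 * ?s"
    if "0 < x" "x < v" "?s \<le> 1/3 - v" for x
    by (rule frac_eqI) (use that tau_bounds[of a] in auto)
  have fr2: "frac (3/2 - 3 * x - 3 * ?s) = 3/2 - 3 * x - 3 * ?s"
    if "0 < x" "x < v" "1/3 \<le> ?s" "?s \<le> 1/2 - v" for x
    by (rule frac_eqI) (use that tau_bounds[of a] in auto)
  have fr3: "frac (3/2 - 3 * x - 3 * ?s) = 5/2 - 3 * x - 3 * ?s"
    if "0 < x" "x < v" "1/2 \<le> ?s" "?s \<le> 5/6 - v" for x
    by (rule frac_eqI) (use that tau_bounds[of a] in auto)
  have fr4: "frac (1 - 3 * x - 3 * ?s) = 3 - 3 * x - 3 * ?s"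
    if "0 < x" "x < v" "5/6 \<le> ?s" "?s \<le> 1 - v" for x
    by (rule frac_eqI) (use that tau_bounds[of a] in auto)
  consider (1) "?s \<le> 1/3 - v" "?t \<le> 1/3 - v"
    | (2) "1/3 \<le> ?s" "?s \<le> 1/2 - v" "1/3 \<le> ?t" "?t \<le> 1/2 - v"
    | (3) "1/3 \<le> ?s" "?s \<le> 1/2 - v" "5/6 \<le> ?t" "?t \<le> 1 - v"
    | (4) "5/6 \<le> ?s" "?s \<le> 1 - v" "1/3 \<le> ?t" "?t \<le> 1/2 - v"
    | (5) "5/6 \<le> ?s" "?s \<le> 1 - v" "5/6 \<le> ?t" "?t \<le> 1 - v"
    | (6) "1/2 \<le> ?s" "?s \<le> 5/6 - v" "1/2 \<le> ?t" "?t \<le> 5/6 - v"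
    using ab(3,4) unfolding pc_def piece_def by (auto split: if_splits)
  then have "?goal (arc_len (phi a) (phi b))"
  proof cases
    case 1
    then have "phi a = 3 * ?s" "phi b = 3 * ?t" by (auto simp: phi_def)
    then show ?thesis using 1 v0 tau_bounds[of a] tau_bounds[of b] by (auto simp: arc_len_def fr)
  next
    case 2
    then have "phi a = 3 * ?s - 1" "phi b = 3 * ?t - 1" using v0 by (auto simp: phi_def)
    then show ?thesis using 2 v0 v6 tau_bounds[of a] tau_bounds[of b] by (auto simp: arc_len_def fr2)
  next
    case 3
    then have "phi a = 3 * ?s - 1" "phi b = 3 * ?t - 2" using v0 by (auto simp: phi_def)
    then show ?thesis using 3 v0 v6 tau_bounds[of a] tau_bounds[of b] by (auto simp: arc_len_def fr2)
  next
    case 4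
    then have "phi a = 3 * ?s - 2" "phi b = 3 * ?t - 1" using v0 by (auto simp: phi_def)
    then show ?thesis using 4 v0 v6 tau_bounds[of a] tau_bounds[of b] by (auto simp: arc_len_def fr4)
  next
    case 5
    then have "phi a = 3 * ?s - 2" "phi b = 3 * ?t - 2" using v0 by (auto simp: phi_def)
    then show ?thesis using 5 v0 v6 tau_bounds[of a] tau_bounds[of b] by (auto simp: arc_len_def fr4)
  next
    case 6
    then have "phi a = 3 * ?s - 3/2" "phi b = 3 * ?t - 3/2" using v0 by (auto simp: phi_def)
    then show ?thesis using 6 v0 v6 tau_bounds[of a] tau_bounds[of b] by (auto simp: arc_len_def fr3)
  qed
  then show ?thesis using ab by (simp add: arc_tau arc_triple arc_crit_value)
qed

text \<open>The half turn exchanges the two strips, hence the pieces they cut off.\<close>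

lemma pc_half: "pc (half_turn t) = (if pc t = 1 then 3 else if pc t = 3 then 1 else pc t)"
proof -
  have "half_turn t - c - (tau t + 1/2) = of_int (\<lfloor>t - c\<rfloor> - \<lfloor>t + 1/2\<rfloor>)"
    by (simp add: tau_def half_turn_def frac_def)
  then have "tau (half_turn t) = frac (tau t + 1/2)"
    unfolding tau_def[of "half_turn t"] by (metis Ints_of_int frac_cong)
  moreover have "frac (tau t + 1/2) = (if tau t < 1/2 then tau t + 1/2 else tau t - 1/2)"
    by (rule frac_eqI) (use tau_bounds[of t] in auto)
  ultimately have "tau (half_turn t) = (if tau t < 1/2 then tau t + 1/2 else tau t - 1/2)" by simp
  then show ?thesis using tau_bounds[of t] v0 v6 unfolding pc_def piece_def by auto
qed

text \<open>Of the three pieces, only piece 1 has points below \<open>1/3\<close> and only piece 3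
  has points in \<open>[1/2, 5/6)\<close>, so each of these two is confined to an arc free of the
  others.\<close>

lemma pieces_unlinked:
  assumes "{a, b, x, y} \<subseteq> {0..<1}" "pc a = pc b" "pc x = pc y" "pc a \<noteq> 0" "pc x \<noteq> 0" "linked a b x y"
  shows "pc a = pc x"
proof -
  have "linked (tau a) (tau b) (tau x) (tau y)"
    using assms(1,6) by (simp add: linked_def arc_tau)
  then have l: "tau a < tau x \<and> tau x < tau b \<and> (tau y < tau a \<or> tau b < tau y) \<or>
     tau b < tau x \<and> tau x < tau a \<and> (tau y < tau b \<or> tau a < tau y) \<or>
     tau a < tau y \<and> tau y < tau b \<and> (tau x < tau a \<or> tau b < tau x) \<or>
     tau b < tau y \<and> tau y < tau a \<and> (tau x < tau b \<or> tau a < tau x)"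
    by (rule iffD1[OF linked_order[OF tau_in tau_in tau_in tau_in]])
  have pc_range: "pc t \<in> {0, 1, 2, 3}" for t
    unfolding pc_def piece_def by simp
  have p1: "pc t = 1 \<Longrightarrow> tau t \<le> 1/3 - v" and p3: "pc t = 3 \<Longrightarrow> 1/2 \<le> tau t \<and> tau t \<le> 5/6 - v"
    and p2: "pc t = 2 \<Longrightarrow> 1/3 \<le> tau t \<and> tau t \<le> 1/2 - v \<or> 5/6 \<le> tau t" for t
    unfolding pc_def piece_def by (auto split: if_splits)
  have p23: "1/3 \<le> tau t" if "pc t = 2 \<or> pc t = 3" for t
    using p2[of t] p3[of t] that by auto
  have less: False if "tau a < 1/3" "tau b < 1/3" "1/3 \<le> tau x" "1/3 \<le> tau y"
    using l that by (elim disjE conjE) linarith+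
  have less': False if "tau x < 1/3" "tau y < 1/3" "1/3 \<le> tau a" "1/3 \<le> tau b"
    using l that by (elim disjE conjE) linarith+
  show ?thesis
  proof (rule ccontr)
    assume "pc a \<noteq> pc x"
    then consider "pc a = 1" "pc x = 2 \<or> pc x = 3" | "pc a = 2 \<or> pc a = 3" "pc x = 1"
      | "pc a = 2" "pc x = 3" | "pc a = 3" "pc x = 2"
      using pc_range[of a] pc_range[of x] assms(4,5) by auto
    then show False
    proof cases
      case c: 1
      show ?thesis using c less p1[of a] p1[of b] p23[of x] p23[of y] assms(2,3) v0 by fastforce
    next
      case c: 2
      show ?thesis using c less' p1[of x] p1[of y] p23[of a] p23[of b] assms(2,3) v0 by fastforce
    next
      case c: 3
      have *: "tau a < 1/2 \<or> 5/6 \<le> tau a" "tau b < 1/2 \<or> 5/6 \<le> tau b"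
        "1/2 \<le> tau x" "tau x < 5/6" "1/2 \<le> tau y" "tau y < 5/6"
        using p2[of a] p2[of b] p3[of x] p3[of y] c assms(2,3) v0 by auto
      show ?thesis using l * by (elim disjE conjE) linarith+
    next
      case c: 4
      have *: "tau x < 1/2 \<or> 5/6 \<le> tau x" "tau y < 1/2 \<or> 5/6 \<le> tau y"
        "1/2 \<le> tau a" "tau a < 5/6" "1/2 \<le> tau b" "tau b < 5/6"
        using p2[of x] p2[of y] p3[of a] p3[of b] c assms(2,3) v0 by auto
      show ?thesis using l * by (elim disjE conjE) linarith+
    qed
  qed
qed

end

section \<open>Itineraries\<close>

context strips begin

definition same_itin :: "real \<Rightarrow> real \<Rightarrow> bool" where
  "same_itin a b \<longleftrightarrow> (\<forall>n. pc ((triple_pt ^^ n) a) = pc ((triple_pt ^^ n) b))"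

definition regular :: "real \<Rightarrow> bool" where
  "regular a \<longleftrightarrow> (\<forall>n. pc ((triple_pt ^^ n) a) \<noteq> 0)"

lemma pow_in: "a \<in> {0..<1} \<Longrightarrow> (triple_pt ^^ n) a \<in> {0..<1}"
  using triple_in by (cases n) auto

lemma same_itin_pow: "same_itin a b \<Longrightarrow> same_itin ((triple_pt ^^ n) a) ((triple_pt ^^ n) b)"
  unfolding same_itin_def by (simp flip: funpow_add comp_apply[of "triple_pt ^^ _" "triple_pt ^^ n"])

lemma same_itin_triple: "same_itin a b \<Longrightarrow> same_itin (triple_pt a) (triple_pt b)"
  using same_itin_pow[of a b 1] by simp

lemma regular_pow: "regular a \<Longrightarrow> regular ((triple_pt ^^ n) a)"
  unfolding regular_def by (simp flip: funpow_add comp_apply[of "triple_pt ^^ _" "triple_pt ^^ n"])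

lemma same_itin_regular: "same_itin a b \<Longrightarrow> regular a \<Longrightarrow> regular b"
  unfolding same_itin_def regular_def by simp

lemma same_itin_refl: "same_itin a a"
  and same_itin_sym: "same_itin a b \<Longrightarrow> same_itin b a"
  and same_itin_trans: "same_itin a b \<Longrightarrow> same_itin b d \<Longrightarrow> same_itin a d"
  unfolding same_itin_def by auto

lemma pow_half: "(triple_pt ^^ n) (half_turn a) = half_turn ((triple_pt ^^ n) a)"
  by (induction n) (auto simp: triple_half)

lemma same_itin_half: "same_itin a b \<Longrightarrow> same_itin (half_turn a) (half_turn b)"
  unfolding same_itin_def by (simp add: pow_half pc_half)

lemma regular_half: "regular a \<Longrightarrow> regular (half_turn a)"
  unfolding regular_def by (simp add: pow_half pc_half)

lemma pow_inj:
  assumes "a \<in> {0..<1}" "b \<in> {0..<1}" "same_itin a b" "regular a" "(triple_pt ^^ n) a = (triple_pt ^^ n) b"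
  shows "a = b"
  using assms
proof (induction n)
  case (Suc n)
  then have "(triple_pt ^^ n) a = (triple_pt ^^ n) b"
    using triple_inj[OF pow_in[of a n] pow_in[of b n]] by (auto simp: same_itin_def regular_def)
  with Suc show ?case by blast
qed simp

text \<open>The arc from \<open>a\<close> to \<open>b\<close> triples until it first wraps, which
  must happen because its length stays below 1. Afterwards every step leaves at least
  \<open>3 * v\<close>, by wrapping again or by tripling something already that long.\<close>

lemma separation:
  assumes ab: "a \<in> {0..<1}" "b \<in> {0..<1}" "same_itin a b" "regular a" "a \<noteq> b"
  shows "\<exists>N. \<forall>n\<ge>N. 3 * v \<le> arc_len ((triple_pt ^^ n) a) ((triple_pt ^^ n) b)"
proof -
  define d where "d n = arc_len ((triple_pt ^^ n) a) ((triple_pt ^^ n) b)" for n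
  have ne: "(triple_pt ^^ n) a \<noteq> (triple_pt ^^ n) b" for n
    using pow_inj[OF ab(1-4)] ab(5) by blast
  have step: "d (Suc n) = 3 * d n \<or> 3 * v \<le> d (Suc n)" for n
    using expand_or_wrap[OF pow_in[OF ab(1)] pow_in[OF ab(2)] _ _ ne, of n] ab(3,4)
    by (auto simp: d_def same_itin_def regular_def)
  have d1: "0 \<le> d n" "d n < 1" for n
    unfolding d_def using arc_bounds pow_in ab by blast+
  have d0: "0 < d 0" using ab by (auto simp: d_def arc_len_def)
  have "\<exists>N. 3 * v \<le> d N"
  proof (rule ccontr)
    assume "\<nexists>N. 3 * v \<le> d N"
    then have "d (Suc n) = 3 * d n" for n using step by blast
    then have eq: "d n = 3 ^ n * d 0" for n by (induction n) auto
    obtain n where "1 / d 0 < 3 ^ n" using real_arch_pow[of 3 "1 / d 0"] by auto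
    then have "1 < d n" using eq[of n] d0 by (simp add: field_simps)
    then show False using d1[of n] by simp
  qed
  then obtain N where N: "3 * v \<le> d N" by blast
  have "3 * v \<le> d (N + k)" for k
  proof (induction k)
    case (Suc k)
    then show ?case using step[of "N + k"] d1[of "N + k"] by auto
  qed (simp add: N)
  then show ?thesis unfolding d_def by (metis le_Suc_ex)
qed

lemma finite_separation:
  assumes "finite S" "\<And>x. x \<in> S \<Longrightarrow> x \<in> {0..<1}" "\<And>x. x \<in> S \<Longrightarrow> regular x"
    and "\<And>x y. x \<in> S \<Longrightarrow> y \<in> S \<Longrightarrow> same_itin x y"
  obtains M where "\<And>n x y. n \<ge> M \<Longrightarrow> x \<in> S \<Longrightarrow> y \<in> S \<Longrightarrow> x \<noteq> y \<Longrightarrow>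
    3 * v \<le> arc_len ((triple_pt ^^ n) x) ((triple_pt ^^ n) y)"
proof -
  have *: "eventually (\<lambda>n. x \<noteq> y \<longrightarrow> 3 * v \<le> arc_len ((triple_pt ^^ n) x) ((triple_pt ^^ n) y)) sequentially"
    if "x \<in> S" "y \<in> S" for x y
  proof (cases "x = y")
    case False
    then show ?thesis
      using separation[OF assms(2)[OF that(1)] assms(2)[OF that(2)] assms(4)[OF that] assms(3)[OF that(1)]]
      unfolding eventually_sequentially by blast
  qed simp
  have "eventually (\<lambda>n. \<forall>x\<in>S. \<forall>y\<in>S. x \<noteq> y \<longrightarrow>
      3 * v \<le> arc_len ((triple_pt ^^ n) x) ((triple_pt ^^ n) y)) sequentially"
    by (intro eventually_ball_finite ballI assms(1) *)
  then show thesis using that unfolding eventually_sequentially by blast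
qed

text \<open>As long as the pairs are linked they lie in one piece by \<open>pieces_unlinked\<close>,
  and tripling then keeps them linked.\<close>

lemma same_itin_if_linked:
  assumes "{a, b, x, y} \<subseteq> {0..<1}" "same_itin a b" "same_itin x y" "regular a" "regular x" "linked a b x y"
  shows "same_itin a x"
proof -
  let ?g = "\<lambda>n. triple_pt ^^ n"
  have "linked (?g n a) (?g n b) (?g n x) (?g n y) \<and> pc (?g n a) = pc (?g n x)" for n
  proof (induction n)
    case 0
    then show ?case using assms pieces_unlinked[of a b x y]
      unfolding same_itin_def regular_def by (metis funpow_0)
  next
    case (Suc n)
    have in01: "{?g m a, ?g m b, ?g m x, ?g m y} \<subseteq> {0..<1}" for m
      using assms(1) pow_in by auto
    have eq: "pc (?g m a) = pc (?g m b)" "pc (?g m x) = pc (?g m y)" "pc (?g m a) \<noteq> 0" "pc (?g m x) \<noteq> 0" for m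
      using assms unfolding same_itin_def regular_def by auto
    have l: "linked (?g (Suc n) a) (?g (Suc n) b) (?g (Suc n) x) (?g (Suc n) y)"
    proof -
      have "pc s = pc (?g n a)" if "s \<in> {?g n a, ?g n b, ?g n x, ?g n y}" for s
        using that eq[of n] Suc by auto
      from linked_triple[OF in01[of n] this eq(3)] Suc show ?thesis by simp
    qed
    then show ?case using pieces_unlinked[OF in01 eq l] by simp
  qed
  then show ?thesis unfolding same_itin_def by blast
qed

text \<open>After enough steps any finitely many points of the class are pairwise
  \<open>3 * v\<close> apart, so they occupy different boxes of length \<open>3 * v\<close>. At most
  \<open>?K\<close> such boxes meet the circle.\<close>

lemma finite_same_itin:
  assumes a: "a \<in> {0..<1}" "regular a"
  shows "finite {b \<in> {0..<1}. same_itin a b}"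
proof (rule ccontr)
  let ?K = "nat \<lceil>1 / (3 * v)\<rceil> + 1"
  assume "infinite {b \<in> {0..<1}. same_itin a b}"
  then obtain S where S: "finite S" "card S = Suc ?K" "S \<subseteq> {b \<in> {0..<1}. same_itin a b}"
    using infinite_arbitrarily_large[of _ "Suc ?K"] by blast
  have S': "x \<in> {0..<1}" "regular x" if "x \<in> S" for x
    using that S(3) same_itin_regular[OF _ a(2)] by auto
  have Ssim: "same_itin x y" if "x \<in> S" "y \<in> S" for x y
  proof -
    have "same_itin a x" "same_itin a y" using that S(3) by auto
    then show ?thesis by (rule same_itin_trans[OF same_itin_sym])
  qed
  obtain M where M: "\<And>n x y. n \<ge> M \<Longrightarrow> x \<in> S \<Longrightarrow> y \<in> S \<Longrightarrow> x \<noteq> y \<Longrightarrow>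
    3 * v \<le> arc_len ((triple_pt ^^ n) x) ((triple_pt ^^ n) y)"
    using finite_separation[OF S(1) S' Ssim] by blast
  let ?g = "triple_pt ^^ M"
  have far: "3 * v \<le> arc_len (?g x) (?g y)" if "x \<in> S" "y \<in> S" "x \<noteq> y" for x y
    using M that by blast
  define h where "h x = nat \<lfloor>?g x / (3 * v)\<rfloor>" for x
  have "inj_on h S"
  proof (rule inj_onI, rule ccontr)
    fix x y assume xy: "x \<in> S" "y \<in> S" "h x = h y" "x \<noteq> y"
    have g: "0 \<le> ?g x" "0 \<le> ?g y" using pow_in[OF S'(1)] xy by auto
    then have "\<lfloor>?g x / (3 * v)\<rfloor> = \<lfloor>?g y / (3 * v)\<rfloor>"
      using xy v0 by (simp add: h_def nat_eq_iff2)
    then have "\<bar>?g x / (3 * v) - ?g y / (3 * v)\<bar> < 1" by linarith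
    then have "\<bar>?g x - ?g y\<bar> < 3 * v" using v0 by (simp add: abs_if field_simps split: if_splits)
    then show False using far[of x y] far[of y x] xy by (auto simp: arc_len_def split: if_splits)
  qed
  moreover have "h ` S \<subseteq> {..<?K}"
  proof clarify
    fix x assume "x \<in> S"
    then have g: "0 \<le> ?g x" "?g x < 1" using pow_in[OF S'(1)] by auto
    have "?g x / (3 * v) \<le> 1 / (3 * v)" using g v0 by (simp add: divide_right_mono)
    then have "\<lfloor>?g x / (3 * v)\<rfloor> \<le> \<lceil>1 / (3 * v)\<rceil>" by linarith
    then show "h x < ?K" unfolding h_def by linarith
  qed
  ultimately have "card S \<le> ?K" using card_inj_on_le[of h S "{..<?K}"] by simp
  then show False using S(2) by simp
qed

section \<open>Critical values and recurrence of classes\<close>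

lemma crit_value_in: "crit_value x \<in> {0..<1}"
  by (simp add: crit_value_def frac_lt_1)

text \<open>Two parameters in \<open>(0, v)\<close> differ by less than \<open>1/6\<close>, so
  tripling cannot identify the values. Infinitely many critical values result, and one of them
  misses any given finite set.\<close>

lemma crit_value_inj:
  assumes "0 < x" "x < v" "0 < x'" "x' < v" "crit_value x = crit_value x'" shows "x = x'"
proof -
  have "3 * (c + 1/2 - x) - 3 * (c + 1/2 - x') - 3 * (x' - x) = 0" by (simp add: algebra_simps)
  moreover have "3 * (c + 1/2 - x) - 3 * (c + 1/2 - x') =
      of_int (\<lfloor>3 * (c + 1/2 - x)\<rfloor> - \<lfloor>3 * (c + 1/2 - x')\<rfloor>)"
    using assms(5) by (simp add: crit_value_def frac_def)
  ultimately obtain k :: int where k: "3 * (x' - x) = of_int k" by (metis eq_iff_diff_eq_0)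
  have "\<bar>3 * (x' - x)\<bar> < 1" using assms v6 by auto
  then have "\<bar>real_of_int k\<bar> < 1" using k by simp
  then have "k = 0" by linarith
  then show ?thesis using k by simp
qed

text \<open>By pigeonhole there are times \<open>n < m\<close> at which all four points are within
  \<open>v\<close> of their earlier positions. Then the pair of \<open>a\<close>, \<open>b\<close>
  at time \<open>n\<close> is linked even with the pair of \<open>x\<close>, \<open>y\<close> at
  time \<open>m\<close>, and linked pairs share an itinerary.\<close>

lemma recurrence:
  assumes in01: "{a, b, x, y} \<subseteq> {0..<1}" and sim: "same_itin a b" "same_itin x y"
    and reg: "regular a" and l: "linked a b x y" and ax: "same_itin a x"
  obtains n m where "n < m" "same_itin ((triple_pt ^^ n) a) ((triple_pt ^^ m) a)"
proof -
  let ?g = "\<lambda>n. triple_pt ^^ n"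
  let ?S = "{a, b, x, y}"
  have S: "s \<in> {0..<1}" "regular s" "same_itin a s" if "s \<in> ?S" for s
  proof -
    show "s \<in> {0..<1}" using that in01 by blast
    show "same_itin a s" using that sim(1) ax same_itin_trans[OF ax sim(2)] same_itin_refl by auto
    then show "regular s" using same_itin_regular reg by blast
  qed
  have S2: "same_itin s t" if "s \<in> ?S" "t \<in> ?S" for s t
    using same_itin_trans[OF same_itin_sym[OF S(3)] S(3)] that by blast
  have "finite ?S" by simp
  from finite_separation[OF this S(1,2) S2]
  obtain M where far: "\<And>n s t. n \<ge> M \<Longrightarrow> s \<in> ?S \<Longrightarrow> t \<in> ?S \<Longrightarrow> s \<noteq> t \<Longrightarrow> 3 * v \<le> arc_len (?g n s) (?g n t)"
    by blast
  define h where "h n = (\<lfloor>?g n a / v\<rfloor>, \<lfloor>?g n b / v\<rfloor>, \<lfloor>?g n x / v\<rfloor>, \<lfloor>?g n y / v\<rfloor>)" for n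
  let ?I = "{0..\<lfloor>1/v\<rfloor>}"
  have "\<lfloor>?g n s / v\<rfloor> \<in> ?I" if "s \<in> ?S" for s n
  proof -
    have "0 \<le> ?g n s" "?g n s < 1" using pow_in[OF S(1)[OF that], of n] by auto
    then have "0 \<le> ?g n s / v" "?g n s / v \<le> 1 / v" using v0 by (auto simp: divide_right_mono)
    then show ?thesis by (auto intro: floor_mono)
  qed
  then have "h ` {M..} \<subseteq> ?I \<times> ?I \<times> ?I \<times> ?I" unfolding h_def by auto
  then have "finite (h ` {M..})" by (rule finite_subset) auto
  then have "\<not> inj_on h {M..}" using finite_imageD infinite_Ici by blast
  then obtain n m where nm: "n < m" "n \<ge> M" "m \<ge> M" "h n = h m"
    unfolding inj_on_def by (metis atLeast_iff linorder_neqE_nat)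
  have near: "\<bar>?g n s - ?g m s\<bar> < v" if "s \<in> ?S" for s
  proof -
    have "\<lfloor>?g n s / v\<rfloor> = \<lfloor>?g m s / v\<rfloor>" using nm(4) that by (auto simp: h_def)
    then have "\<bar>?g n s / v - ?g m s / v\<bar> < 1" by linarith
    then show ?thesis using v0 by (simp add: abs_if field_simps split: if_splits)
  qed
  have lS: "linked (?g n a) (?g n b) (?g n x) (?g n y)" for n
  proof (induction n)
    case (Suc n)
    have "{?g n a, ?g n b, ?g n x, ?g n y} \<subseteq> {0..<1}" using in01 pow_in by auto
    moreover have "pc s = pc (?g n a)" if "s \<in> {?g n a, ?g n b, ?g n x, ?g n y}" for s
      using that S(3)[of b] S(3)[of x] S(3)[of y] by (auto simp: same_itin_def)
    moreover have "pc (?g n a) \<noteq> 0" using reg by (simp add: regular_def)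
    ultimately have "linked (?g n a) (?g n b) (?g n x) (?g n y) \<longleftrightarrow>
        linked (triple_pt (?g n a)) (triple_pt (?g n b)) (triple_pt (?g n x)) (triple_pt (?g n y))"
      by (rule linked_triple)
    then show ?case using Suc by simp
  qed (simp add: l)
  have dist: "a \<noteq> x" "a \<noteq> y" "b \<noteq> x" "b \<noteq> y"
    using l in01 linked_order[of a b x y] by auto
  have g01: "?g k s \<in> {0..<1}" if "s \<in> ?S" for s k using pow_in S that by blast
  have "linked (?g n a) (?g n b) (?g m x) (?g m y)"
  proof -
    have f: "v < \<bar>?g n s - ?g n t\<bar>" "\<bar>?g n s - ?g n t\<bar> < 1 - v" if "s \<in> ?S" "t \<in> ?S" "s \<noteq> t" for s t
      using far[OF nm(2) that] far[OF nm(2) that(2,1)] that(3) v0 by (auto simp: arc_len_def split: if_splits)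
    \<comment> \<open>Distinct points are more than \<open>v\<close> apart at time \<open>n\<close>,
      so a displacement by less than \<open>v\<close> in \<open>[0, 1)\<close> carries neither
      \<open>x\<close> nor \<open>y\<close> past \<open>a\<close> or \<open>b\<close>.\<close>
    have "?g n a < ?g n x \<longleftrightarrow> ?g n a < ?g m x" "?g n a > ?g n x \<longleftrightarrow> ?g n a > ?g m x"
      "?g n b < ?g n x \<longleftrightarrow> ?g n b < ?g m x" "?g n b > ?g n x \<longleftrightarrow> ?g n b > ?g m x"
      "?g n a < ?g n y \<longleftrightarrow> ?g n a < ?g m y" "?g n a > ?g n y \<longleftrightarrow> ?g n a > ?g m y"
      "?g n b < ?g n y \<longleftrightarrow> ?g n b < ?g m y" "?g n b > ?g n y \<longleftrightarrow> ?g n b > ?g m y"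
      using f(1)[of a x] f(1)[of a y] f(1)[of b x] f(1)[of b y] dist near[of x] near[of y]
      by (auto simp: abs_if split: if_splits)
    then show ?thesis using lS[of n] g01 by (simp add: linked_order)
  qed
  then have "same_itin (?g n a) (?g m x)"
    using g01 same_itin_pow[OF sim(1)] same_itin_pow[OF sim(2)] regular_pow S(2)
    by (intro same_itin_if_linked[of "?g n a" "?g n b" "?g m x" "?g m y"]) auto
  moreover have "same_itin (?g m x) (?g m a)" using same_itin_pow ax same_itin_sym by blast
  ultimately show thesis using that[OF nm(1)] same_itin_trans by blast
qed

text \<open>\<open>leaf\<close> stands for the leaves of the lamination of \<open>a\<close>,
  \<open>b\<close> alone; of the pair \<open>x\<close>, \<open>y\<close> only its itinerary and
  linking are known. A periodic cycle of classes, joined with its antipodes, satisfies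
  \<open>rotating_classes\<close>, and the rotation obtained there makes an image of the leaf cross
  the leaf it came from.\<close>

lemma itinerary_contradiction:
  assumes in01: "{a, b, x, y} \<subseteq> {0..<1}" and sim: "same_itin a b" "same_itin x y"
    and reg: "regular a" "regular x" and l: "linked a b x y" and ab: "leaf a b"
    and leaf_triple: "\<And>s t. leaf s t \<Longrightarrow> leaf (triple_pt s) (triple_pt t)"
    and leaf_half: "\<And>s t. leaf s t \<Longrightarrow> leaf (half_turn s) (half_turn t)"
    and leaf_unlinked: "\<And>s t s' t'. leaf s t \<Longrightarrow> leaf s' t' \<Longrightarrow> \<not> linked s t s' t'"
  shows False
proof -
  let ?g = "\<lambda>n. triple_pt ^^ n"
  have ax: "same_itin a x" by (rule same_itin_if_linked[OF in01 sim reg l])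
  obtain n m where nm: "n < m" "same_itin (?g n a) (?g m a)"
    using recurrence[OF in01 sim reg(1) l ax] .
  define F where "F i = {b \<in> {0..<1}. same_itin (?g i a) b}" for i
  have F01: "s \<in> {0..<1}" "regular s" if "s \<in> F i" for s i
    using that same_itin_regular[OF _ regular_pow[OF reg(1)]] by (auto simp: F_def)
  have finF: "finite (F i)" for i
    unfolding F_def using finite_same_itin pow_in regular_pow reg(1) in01 by simp
  have Fsub: "triple_pt ` F i \<subseteq> F (Suc i)" for i
  proof clarify
    fix s assume "s \<in> F i"
    then have "same_itin (?g i a) s" by (simp add: F_def)
    from same_itin_triple[OF this] show "triple_pt s \<in> F (Suc i)"
      using triple_in[of s] by (simp add: F_def)
  qed
  have Finj: "inj_on triple_pt (F i)" for i
  proof (rule inj_onI)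
    fix s t assume st: "s \<in> F i" "t \<in> F i" "triple_pt s = triple_pt t"
    then have "same_itin (?g i a) s" "same_itin (?g i a) t" by (auto simp: F_def)
    then have "pc (?g i a) = pc s" "pc (?g i a) = pc t" unfolding same_itin_def by (metis funpow_0)+
    moreover have "pc s \<noteq> 0" using F01[OF st(1)] unfolding regular_def by (metis funpow_0)
    ultimately show "s = t" using triple_inj[of s t] F01[OF st(1)] F01[OF st(2)] st(3) by simp
  qed
  have card_le: "card (F i) \<le> card (F (Suc i))" for i
    using card_mono[OF finF Fsub] card_image[OF Finj] by simp
  have card_mono_F: "i \<le> j \<Longrightarrow> card (F i) \<le> card (F j)" for i j
    by (rule lift_Suc_mono_le[of "\<lambda>i. card (F i)"]) (simp_all add: card_le)
  have Fmn: "F m = F n"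
    unfolding F_def using nm(2) same_itin_sym same_itin_trans by blast
  \<comment> \<open>Injectivity makes the class sizes nondecreasing, and \<open>F m = F n\<close>
    closes the cycle, so all sizes agree and tripling is onto.\<close>
  have Feq: "triple_pt ` F i = F (Suc i)" if "n \<le> i" "i < m" for i
  proof (rule card_subset_eq[OF finF Fsub])
    have "card (F (Suc i)) \<le> card (F i)"
      using card_mono_F[of "Suc i" m] card_mono_F[of n i] that Fmn by simp
    then show "card (triple_pt ` F i) = card (F (Suc i))"
      using card_le[of i] card_image[OF Finj, of i] by simp
  qed
  define U0 where "U0 = (\<Union>i\<in>{n..<m}. F i)"
  define U where "U = U0 \<union> half_turn ` U0"
  have U0: "triple_pt ` U0 = U0"
  proof -
    have "triple_pt ` U0 = (\<Union>i\<in>{n..<m}. F (Suc i))"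
      unfolding U0_def image_UN using Feq by (intro SUP_cong) auto
    also have "\<dots> = (\<Union>i\<in>{Suc n..<Suc m}. F i)"
      unfolding image_Suc_atLeastLessThan[symmetric] by blast
    also have "\<dots> = U0"
    proof -
      have "{Suc n..<Suc m} = insert m {Suc n..<m}" "{n..<m} = insert n {Suc n..<m}"
        using nm(1) by auto
      then show ?thesis unfolding U0_def by (simp add: Fmn)
    qed
    finally show ?thesis .
  qed
  have U01: "U \<subseteq> {0..<1}" unfolding U_def U0_def using F01 half_in by blast
  have regU: "regular s" if "s \<in> U" for s
    using that F01(2) regular_half unfolding U_def U0_def by blast
  have finU: "finite U" unfolding U_def U0_def using finF by blast
  have "infinite (crit_value ` {0<..<v})"
  proof
    assume "finite (crit_value ` {0<..<v})"
    moreover have "inj_on crit_value {0<..<v}" by (rule inj_onI) (auto intro: crit_value_inj)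
    ultimately have "finite {0<..<v}" using finite_imageD by blast
    then show False using infinite_Ioo[OF v0] by blast
  qed
  then have "\<not> crit_value ` {0<..<v} \<subseteq> U" using finU finite_subset by blast
  then obtain z where "z \<in> {0<..<v}" "crit_value z \<notin> U" by blast
  then have z: "0 < z" "z < v" "crit_value z \<notin> U" by simp_all
  have half_pow: "half_turn (half_turn s) = s" if "s \<in> U" for s
    using U01 that by (intro half_half) blast
  \<comment> \<open>Every class in \<open>U\<close> contains an image of the four original points,
    possibly after a half turn. This yields the three points that the locale demands and the leaf
    for the final contradiction.\<close>
  have quad: "\<exists>p\<in>U. \<exists>q\<in>U. \<exists>r\<in>U. \<exists>t\<in>U. leaf p q \<and> linked p q r t \<and>
      same_itin s p \<and> same_itin s q \<and> same_itin s r \<and> same_itin s t" if s: "s \<in> U" for s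
  proof -
    have leaf_n: "leaf (?g k a) (?g k b)" for k by (induction k) (simp_all add: ab leaf_triple)
    have sims: "same_itin a a" "same_itin a b" "same_itin a x" "same_itin a y"
      using same_itin_refl sim ax same_itin_trans[OF ax sim(2)] by auto
    have linked_n: "linked (?g k a) (?g k b) (?g k x) (?g k y)" for k
    proof (induction k)
      case (Suc k)
      have "{?g k a, ?g k b, ?g k x, ?g k y} \<subseteq> {0..<1}" using in01 pow_in by auto
      moreover have "pc u = pc (?g k a)" if "u \<in> {?g k a, ?g k b, ?g k x, ?g k y}" for u
        using that sims by (auto simp: same_itin_def)
      moreover have "pc (?g k a) \<noteq> 0" using reg(1) by (simp add: regular_def)
      ultimately have "linked (?g k a) (?g k b) (?g k x) (?g k y) \<longleftrightarrow>
          linked (triple_pt (?g k a)) (triple_pt (?g k b)) (triple_pt (?g k x)) (triple_pt (?g k y))"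
        by (rule linked_triple)
      then show ?case using Suc by simp
    qed (simp add: l)
    have inF: "?g k u \<in> F k" if "u \<in> {a, b, x, y}" for k u
      using that in01 pow_in[of u k] sims by (auto simp: F_def intro!: same_itin_pow)
    from s consider i where "i \<in> {n..<m}" "s \<in> F i" | i u where "i \<in> {n..<m}" "u \<in> F i" "s = half_turn u"
      unfolding U_def U0_def by blast
    then show ?thesis
    proof cases
      case 1
      have "?g i u \<in> U \<and> same_itin s (?g i u)" if "u \<in> {a, b, x, y}" for u
        using inF[OF that, of i] 1 same_itin_trans[OF same_itin_sym] unfolding U_def U0_def F_def by blast
      then show ?thesis using leaf_n[of i] linked_n[of i] by blast
    next
      case 2
      have "half_turn (?g i w) \<in> U \<and> same_itin s (half_turn (?g i w))" if "w \<in> {a, b, x, y}" for w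
      proof
        show "half_turn (?g i w) \<in> U" using inF[OF that, of i] 2(1) unfolding U_def U0_def by blast
        have "same_itin u (?g i w)"
          using inF[OF that, of i] 2(2) same_itin_trans[OF same_itin_sym] unfolding F_def by blast
        then show "same_itin s (half_turn (?g i w))" using 2(3) same_itin_half by simp
      qed
      moreover have "linked (half_turn (?g i a)) (half_turn (?g i b)) (half_turn (?g i x)) (half_turn (?g i y))"
        using linked_n[of i] arc_half pow_in in01 by (simp add: linked_def)
      ultimately show ?thesis using leaf_half[OF leaf_n[of i]] by blast
    qed
  qed
  interpret rotating_classes U same_itin triple_pt half_turn "crit_value z"
  proof
    show "triple_pt ` U = U"
    proof -
      have "triple_pt ` half_turn ` U0 = half_turn ` triple_pt ` U0"
        unfolding image_image by (simp add: triple_half)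
      then show ?thesis unfolding U_def image_Un by (simp add: U0)
    qed
    show "half_turn s \<in> U" if "s \<in> U" for s
    proof -
      have "half_turn (half_turn u) = u" if "u \<in> U0" for u using half_pow that unfolding U_def by blast
      then show ?thesis using that unfolding U_def by fastforce
    qed
    show "same_itin s u" if "s \<in> U" "t \<in> U" "u \<in> U" "w \<in> U" "same_itin s t" "same_itin u w" "linked s t u w"
      for s t u w
      by (rule same_itin_if_linked[of s t u w]) (use that U01 regU in auto)
    have pcU: "pc s \<noteq> 0" if "s \<in> U" for s
      using regU[OF that] unfolding regular_def by (metis funpow_0)
    have pc_eq: "pc s = pc t" if "same_itin s t" for s t
      using that unfolding same_itin_def by (metis funpow_0)
    show "arc_len s t < arc_len s u \<longleftrightarrow> arc_len (triple_pt s) (triple_pt t) < arc_len (triple_pt s) (triple_pt u)"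
      if "s \<in> U" "t \<in> U" "u \<in> U" "same_itin s t" "same_itin s u" for s t u
      using that U01 pcU pc_eq by (intro arc_triple_less) blast+
    show "arc_len (triple_pt s) (triple_pt t) = 3 * arc_len s t \<or>
       arc_len (triple_pt s) (crit_value z) < arc_len (triple_pt s) (triple_pt t) \<or>
       arc_len (triple_pt s) (half_turn (crit_value z)) < arc_len (triple_pt s) (triple_pt t)"
      if "s \<in> U" "t \<in> U" "same_itin s t" "s \<noteq> t" for s t
      using expand_or_wrap[of s t] that U01 pcU pc_eq z by blast
    show "\<exists>t\<in>U. \<exists>u\<in>U. same_itin s t \<and> same_itin s u \<and> t \<noteq> s \<and> u \<noteq> s \<and> t \<noteq> u" if s: "s \<in> U" for s
    proof -
      obtain p q r t where *: "p \<in> U" "q \<in> U" "r \<in> U" "t \<in> U" "linked p q r t"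
        "same_itin s p" "same_itin s q" "same_itin s r" "same_itin s t" using quad[OF s] by blast
      then have "p \<noteq> q" "p \<noteq> r" "q \<noteq> r" by (auto simp: linked_def arc_len_def split: if_splits)
      then show ?thesis using * by metis
    qed
    show "same_itin s t \<Longrightarrow> same_itin t u \<Longrightarrow> same_itin s u" for s t u by (rule same_itin_trans)
  qed (use finU U01 crit_value_in half_in half_half half_pow triple_half same_itin_refl same_itin_sym
      same_itin_triple same_itin_half arc_half z in auto)
  have "U \<noteq> {}"
  proof -
    have "?g n a \<in> F n" using in01 pow_in same_itin_refl by (auto simp: F_def)
    then show ?thesis using nm(1) unfolding U_def U0_def by fastforce
  qed
  from rotation[OF this] obtain a0 i j where a0: "a0 \<in> U"
    and rot: "\<And>s. s \<in> U \<Longrightarrow> same_itin a0 s \<Longrightarrow> mov i j s = succ s" by blast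
  obtain p q r t where q: "p \<in> U" "q \<in> U" "r \<in> U" "t \<in> U" "leaf p q" "linked p q r t"
    "same_itin a0 p" "same_itin a0 q" "same_itin a0 r" "same_itin a0 t" using quad[OF a0] by blast
  have "linked p q (succ p) (succ q)"
    by (rule succ_linked[OF q(1-4) _ _ _ q(6)]) (use q(7-10) same_itin_trans[OF same_itin_sym] in blast)+
  then have "linked p q (mov i j p) (mov i j q)" using rot q by simp
  moreover have "leaf (mov i j p) (mov i j q)"
  proof -
    have "leaf (?g j p) (?g j q)" by (induction j) (simp_all add: q(5) leaf_triple)
    then have "leaf ((half_turn ^^ i) (?g j p)) ((half_turn ^^ i) (?g j q))"
      by (induction i) (simp_all add: leaf_half)
    then show ?thesis by (simp add: mov_def)
  qed
  ultimately show False using leaf_unlinked[OF q(5)] by blast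
qed

end

section \<open>Crossing chords\<close>

text \<open>Twice the signed area of the triangle \<open>a\<close>, \<open>b\<close>,
  \<open>z\<close>; its sign tells the side of the line through \<open>a\<close> and
  \<open>b\<close> on which \<open>z\<close> lies.\<close>

definition orient :: "complex \<Rightarrow> complex \<Rightarrow> complex \<Rightarrow> real" where
  "orient a b z = Im ((z - a) * cnj (b - a))"

lemma orient_endpoints [simp]: "orient a b a = 0" "orient a b b = 0"
  by (simp_all add: orient_def algebra_simps)

lemma orient_affine:
  "orient a b ((1 - u) *\<^sub>R x + u *\<^sub>R y) = (1 - u) * orient a b x + u * orient a b y"
  by (simp add: orient_def algebra_simps)

lemma orient_zero_imp_collinear:
  assumes "a \<noteq> b" "orient a b z = 0"
  obtains r where "z = (1 - r) *\<^sub>R a + r *\<^sub>R b"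
proof
  let ?w = "(z - a) * cnj (b - a)"
  let ?r = "Re ?w / (cmod (b - a))^2"
  have "?w = of_real (Re ?w)" using assms(2) by (simp add: orient_def complex_eq_iff)
  moreover have "?w * (b - a) = (z - a) * (b - a) * cnj (b - a)" by (simp add: algebra_simps)
  ultimately have "of_real (Re ?w) * (b - a) = (z - a) * of_real ((cmod (b - a))^2)"
    by (metis complex_norm_square mult.assoc)
  then have "z - a = ?r *\<^sub>R (b - a)"
    using assms(1) by (simp add: scaleR_conv_of_real field_simps)
  then show "z = (1 - ?r) *\<^sub>R a + ?r *\<^sub>R b"
    by (simp add: algebra_simps)
qed

text \<open>The power of a point on the line through \<open>a\<close> and \<open>b\<close>. It shows
  that the part of this line inside the disk is the open segment.\<close>

lemma norm_affine_sq:
  assumes "norm a = 1" "norm b = 1"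
  shows "(norm ((1 - u) *\<^sub>R a + u *\<^sub>R b))^2 = 1 - u * (1 - u) * (norm (a - b :: complex))^2"
proof -
  have a: "(Re a)^2 + (Im a)^2 = 1" "(Re b)^2 + (Im b)^2 = 1"
    using assms by (simp_all flip: cmod_power2)
  have E: "(norm ((1 - u) *\<^sub>R a + u *\<^sub>R b))^2 =
     (1 - u)^2 * ((Re a)^2 + (Im a)^2) + u^2 * ((Re b)^2 + (Im b)^2) + 2 * u * (1 - u) * (Re a * Re b + Im a * Im b)"
    unfolding cmod_power2 by (simp add: power2_eq_square algebra_simps)
  have N: "(norm (a - b))^2 = ((Re a)^2 + (Im a)^2) + ((Re b)^2 + (Im b)^2) - 2 * (Re a * Re b + Im a * Im b)"
    unfolding cmod_power2 by (simp add: power2_eq_square algebra_simps)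
  have D: "Re a * Re b + Im a * Im b = 1 - (norm (a - b))^2 / 2" using N unfolding a by (simp add: field_simps)
  have "(norm ((1 - u) *\<^sub>R a + u *\<^sub>R b))^2 =
     (1 - u)^2 + u^2 + 2 * u * (1 - u) * (1 - (norm (a - b))^2 / 2)" unfolding E a D by simp
  then show ?thesis by (simp add: power2_eq_square field_simps)
qed

lemma norm_affine_less_iff:
  assumes "norm a = 1" "norm b = 1" "a \<noteq> (b :: complex)"
  shows "norm ((1 - u) *\<^sub>R a + u *\<^sub>R b) < 1 \<longleftrightarrow> 0 < u \<and> u < 1"
proof -
  let ?n = "norm ((1 - u) *\<^sub>R a + u *\<^sub>R b)"
  have "?n < 1 \<longleftrightarrow> ?n^2 < 1^2" using abs_square_less_1[of ?n] by simp
  also have "\<dots> \<longleftrightarrow> 0 < u * (1 - u) * (norm (a - b))^2"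
    unfolding norm_affine_sq[OF assms(1,2)] by simp
  also have "\<dots> \<longleftrightarrow> 0 < u * (1 - u)" using assms(3) by (simp add: zero_less_mult_iff)
  also have "\<dots> \<longleftrightarrow> 0 < u \<and> u < 1" by (auto simp: zero_less_mult_iff)
  finally show ?thesis .
qed

lemma collinear_on_circle:
  assumes "norm a = 1" "norm b = 1" "norm z = 1" "a \<noteq> b" "orient a b z = 0"
  shows "z = a \<or> z = b"
proof -
  obtain r where r: "z = (1 - r) *\<^sub>R a + r *\<^sub>R b"
    using orient_zero_imp_collinear[OF assms(4,5)] .
  have "r * (1 - r) * (norm (a - b))^2 = 0"
    using norm_affine_sq[OF assms(1,2), of r] assms(3) r by simp
  then show ?thesis using assms(4) r by auto
qed

text \<open>If \<open>x\<close> and \<open>y\<close> are strictly on opposite sides, their chord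
  meets the line inside the disk, hence on the other chord. Conversely, if one endpoint lay on the
  line, the meeting point would put the other there too; on the circle the two chords would then
  coincide.\<close>

lemma cross_iff_orient:
  assumes "norm a = 1" "norm b = 1" "norm x = 1" "norm y = 1"
  shows "cross (closed_segment a b) (closed_segment x y) \<longleftrightarrow> orient a b x * orient a b y < 0"
proof
  assume neg: "orient a b x * orient a b y < 0"
  have ab: "a \<noteq> b" using neg by (auto simp: orient_def)
  have xy: "x \<noteq> y" using neg by (auto simp: mult_less_0_iff)
  let ?r = "orient a b x / (orient a b x - orient a b y)"
  let ?z = "(1 - ?r) *\<^sub>R x + ?r *\<^sub>R y"
  have ne: "orient a b x - orient a b y \<noteq> 0" using neg by (auto simp: mult_less_0_iff)
  have r: "0 < ?r" "?r < 1" using neg by (auto simp: mult_less_0_iff field_simps)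
  have "orient a b ?z = 0" unfolding orient_affine using ne by (simp add: field_simps)
  then obtain q where q: "?z = (1 - q) *\<^sub>R a + q *\<^sub>R b"
    using orient_zero_imp_collinear[OF ab] by blast
  have z1: "norm ?z < 1" using norm_affine_less_iff[OF assms(3,4) xy] r by blast
  then have "0 < q \<and> q < 1" using norm_affine_less_iff[OF assms(1,2) ab] q by metis
  then have "?z \<in> closed_segment a b" using q unfolding in_segment by (meson less_imp_le)
  moreover have "?z \<in> closed_segment x y"
    using r unfolding in_segment by (intro exI[of _ ?r]) simp
  moreover have "closed_segment a b \<noteq> closed_segment x y"
    using neg by (auto simp: doubleton_eq_iff)
  moreover have "?z \<in> ball 0 1" unfolding mem_ball_0 by (rule z1)
  ultimately show "cross (closed_segment a b) (closed_segment x y)"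
    unfolding cross_def by blast
next
  assume "cross (closed_segment a b) (closed_segment x y)"
  then obtain z where z: "z \<in> closed_segment a b" "z \<in> closed_segment x y" "norm z < 1"
    and ne: "closed_segment a b \<noteq> closed_segment x y"
    unfolding cross_def by (auto simp: dist_norm)
  have ab: "a \<noteq> b" and xy: "x \<noteq> y" using z assms by auto
  obtain u where u: "z = (1 - u) *\<^sub>R a + u *\<^sub>R b" using z(1) unfolding in_segment by blast
  obtain w where w: "z = (1 - w) *\<^sub>R x + w *\<^sub>R y" using z(2) unfolding in_segment by blast
  have w01: "0 < w" "w < 1" using norm_affine_less_iff[OF assms(3,4) xy, of w] z(3) w by auto
  have "orient a b z = 0" unfolding u orient_affine by simp
  then have eq: "(1 - w) * orient a b x + w * orient a b y = 0" unfolding w orient_affine .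
  have "orient a b x \<noteq> 0"
  proof
    assume 0: "orient a b x = 0"
    then have "orient a b y = 0" using eq w01 by simp
    then have "{x, y} = {a, b}"
      using collinear_on_circle[OF assms(1,2) _ ab] assms(3,4) 0 xy by blast
    then show False using ne by (simp add: doubleton_eq_iff) (metis closed_segment_commute)
  qed
  then have "0 < (1 - w) * (orient a b x)^2" using w01 by simp
  moreover have "w * (orient a b x * orient a b y) = - ((1 - w) * (orient a b x)^2)"
  proof -
    have "w * orient a b y = - ((1 - w) * orient a b x)" using eq by linarith
    then have "orient a b x * (w * orient a b y) = orient a b x * - ((1 - w) * orient a b x)" by simp
    then show ?thesis by (simp add: power2_eq_square mult_ac)
  qed
  ultimately have "w * (orient a b x * orient a b y) < 0" by linarith
  then show "orient a b x * orient a b y < 0" using w01 by (simp add: mult_less_0_iff)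
qed

section \<open>Crossing in terms of angles\<close>

lemma norm_circle_pt [simp]: "norm (circle_pt t) = 1"
  by (simp add: circle_pt_def)

lemma circle_pt_diff:
  "circle_pt s - circle_pt t = 2 * \<i> * sin (pi * (s - t)) * cis (pi * (s + t))"
proof -
  have "circle_pt s = cis (pi * (s - t)) * cis (pi * (s + t))"
    "circle_pt t = cis (- (pi * (s - t))) * cis (pi * (s + t))"
    by (simp_all add: circle_pt_def cis_mult algebra_simps)
  then have "circle_pt s - circle_pt t = (cis (pi * (s - t)) - cis (- (pi * (s - t)))) * cis (pi * (s + t))"
    by (simp add: algebra_simps)
  also have "cis (pi * (s - t)) - cis (- (pi * (s - t))) = 2 * \<i> * sin (pi * (s - t))"
    by (simp add: complex_eq_iff)
  finally show ?thesis by (simp add: mult.assoc)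
qed

lemma orient_circle_pt:
  "orient (circle_pt a) (circle_pt b) (circle_pt x) =
     4 * sin (pi * (x - a)) * sin (pi * (b - a)) * sin (pi * (x - b))"
proof -
  have *: "(2 * \<i> * of_real s * c) * cnj (2 * \<i> * of_real t * d) = of_real (4 * s * t) * (c * cnj d)" for s t c d
    by (simp add: complex_eq_iff algebra_simps)
  have "(circle_pt x - circle_pt a) * cnj (circle_pt b - circle_pt a) =
     of_real (4 * sin (pi * (x - a)) * sin (pi * (b - a))) * (cis (pi * (x + a)) * cis (- (pi * (b + a))))"
    unfolding circle_pt_diff * by (simp add: cis_cnj)
  also have "cis (pi * (x + a)) * cis (- (pi * (b + a))) = cis (pi * (x - b))"
    by (simp add: cis_mult algebra_simps)
  finally show ?thesis by (simp add: orient_def)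
qed

text \<open>By \<open>orient_circle_pt\<close> the two orientations multiply to
  \<open>16 * sin (pi * (b - a))^2\<close> times the product of the four sines. If the first factor
  vanishes, the chord is a point and the product of the sines is a square.\<close>

lemma cross_chord_iff:
  "cross (chord a b) (chord x y) \<longleftrightarrow>
     sin (pi * (x - a)) * sin (pi * (x - b)) * (sin (pi * (y - a)) * sin (pi * (y - b))) < 0"
proof -
  let ?s = "sin (pi * (b - a))" and ?l = "sin (pi * (x - a)) * sin (pi * (x - b)) * (sin (pi * (y - a)) * sin (pi * (y - b)))"
  have "cross (chord a b) (chord x y) \<longleftrightarrow> 16 * ?s^2 * ?l < 0"
    unfolding chord_def by (subst cross_iff_orient) (simp_all add: orient_circle_pt power2_eq_square mult_ac)
  also have "\<dots> \<longleftrightarrow> ?s \<noteq> 0 \<and> ?l < 0" by (auto simp: mult_less_0_iff)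
  also have "\<dots> \<longleftrightarrow> ?l < 0"
  proof -
    have "\<not> ?l < 0" if "?s = 0"
    proof -
      have "sin (pi * (z - b)) = sin (pi * (z - a)) * cos (pi * (b - a))" for z
        using sin_diff[of "pi * (z - a)" "pi * (b - a)"] that by (simp add: algebra_simps)
      then have "?l = (sin (pi * (x - a)) * sin (pi * (y - a)) * cos (pi * (b - a)))^2"
        by (simp add: power2_eq_square mult_ac)
      then show ?thesis by simp
    qed
    then show ?thesis by blast
  qed
  finally show ?thesis .
qed

lemma sgn_sin_pi:
  assumes "\<bar>t\<bar> < 1" shows "sgn (sin (pi * t)) = sgn t"
proof -
  have *: "0 < sin (pi * t)" if "0 < t" "t < 1" for t
    using sin_gt_zero[of "pi * t"] that by simp
  consider "t = 0" | "0 < t" | "t < 0" by linarith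
  then show ?thesis
  proof cases
    case 3
    then show ?thesis using *[of "- t"] assms by (simp add: sgn_if)
  qed (use * assms in auto)
qed

lemma cross_chord_01:
  assumes "a \<in> {0..<1}" "b \<in> {0..<1}" "x \<in> {0..<1}" "y \<in> {0..<1}"
  shows "cross (chord a b) (chord x y) \<longleftrightarrow> (x - a) * (x - b) * ((y - a) * (y - b)) < 0"
proof -
  have *: "sgn (sin (pi * (s - t))) = sgn (s - t)" if "s \<in> {0..<1}" "t \<in> {0..<1}" for s t
    by (rule sgn_sin_pi) (use that in auto)
  have "sgn (sin (pi * (x - a)) * sin (pi * (x - b)) * (sin (pi * (y - a)) * sin (pi * (y - b)))) =
      sgn ((x - a) * (x - b) * ((y - a) * (y - b)))"
    unfolding sgn_mult using assms by (simp add: *)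
  then show ?thesis unfolding cross_chord_iff by (metis sgn_less)
qed

section \<open>Limits of closed sets of endpoint pairs\<close>

text \<open>The last clause is Hausdorff convergence. The first allows subsequences, so that
  witnesses selected by compactness still have their limits in \<open>B\<close>.\<close>

definition set_lim :: "(nat \<Rightarrow> 'a :: metric_space set) \<Rightarrow> 'a set \<Rightarrow> bool" where
  "set_lim A B \<longleftrightarrow>
     (\<forall>k x l. strict_mono k \<longrightarrow> (\<forall>n. x n \<in> A (k n)) \<longrightarrow> x \<longlonglongrightarrow> l \<longrightarrow> l \<in> B) \<and>
     (\<forall>l\<in>B. \<exists>x. (\<forall>n. x n \<in> A n) \<and> x \<longlonglongrightarrow> l) \<and>
     (\<forall>e>0. \<exists>N. \<forall>n\<ge>N. (\<forall>x\<in>A n. \<exists>y\<in>B. dist x y < e) \<and> (\<forall>y\<in>B. \<exists>x\<in>A n. dist x y < e))"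

lemma set_lim_mem:
  "set_lim A B \<Longrightarrow> strict_mono k \<Longrightarrow> (\<And>n. x n \<in> A (k n)) \<Longrightarrow> x \<longlonglongrightarrow> l \<Longrightarrow> l \<in> B"
  unfolding set_lim_def by blast

lemma set_lim_approx:
  assumes "set_lim A B" "l \<in> B" obtains x where "\<And>n. x n \<in> A n" "x \<longlonglongrightarrow> l"
  using assms unfolding set_lim_def by blast

lemma compact_subseq:
  fixes x :: "nat \<Rightarrow> 'a :: metric_space"
  assumes "compact K" "\<And>n. x n \<in> K"
  obtains l s where "l \<in> K" "strict_mono s" "(x \<circ> s) \<longlonglongrightarrow> l"
proof -
  have "\<exists>l\<in>K. \<exists>s. strict_mono s \<and> (x \<circ> s) \<longlonglongrightarrow> l"
    using assms unfolding compact_def by simp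
  then show thesis using that by blast
qed

text \<open>The distance functions of the sets are 1-Lipschitz and uniformly bounded on
  \<open>K\<close>. \<open>B\<close> is the zero set of a uniform limit.\<close>

lemma compact_set_lim:
  fixes A :: "nat \<Rightarrow> 'a :: euclidean_space set"
  assumes K: "compact K" and A: "\<And>n. A n \<subseteq> K" "\<And>n. closed (A n)" "\<And>n. A n \<noteq> {}"
  obtains r B where "strict_mono r" "B \<subseteq> K" "closed B" "set_lim (A \<circ> r) B"
proof -
  obtain M where M: "\<forall>x\<in>K. \<forall>y\<in>K. dist x y \<le> M"
    using compact_imp_bounded[OF K] unfolding bounded_two_points by blast
  have bd: "norm (infdist x (A n)) \<le> M" if "x \<in> K" for x n
  proof -
    obtain a where a: "a \<in> A n" using A(3) by blast
    then have "dist x a \<le> M" using M that A(1) by blast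
    then show ?thesis using infdist_le[OF a, of x] infdist_nonneg[of x "A n"] by simp
  qed
  have eq: "\<exists>d>0. \<forall>n y. y \<in> K \<and> norm (x - y) < d \<longrightarrow> norm (infdist x (A n) - infdist y (A n)) < e"
    if "x \<in> K" "0 < e" for x e
    using that(2) by (intro exI[of _ e]) (auto simp: dist_norm intro: le_less_trans[OF infdist_triangle_abs])
  have "\<exists>g r. continuous_on K g \<and> strict_mono (r :: nat \<Rightarrow> nat) \<and>
      (\<forall>e>0. \<exists>N. \<forall>n x. n \<ge> N \<and> x \<in> K \<longrightarrow> norm (infdist x (A (r n)) - g x) < e)"
  proof (rule Arzela_Ascoli[of K "\<lambda>n x. infdist x (A n)" M, OF K bd eq])
    fix g :: "'a \<Rightarrow> real" and r :: "nat \<Rightarrow> nat"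
    assume "continuous_on K g" "strict_mono r"
      "\<And>e. 0 < e \<Longrightarrow> \<exists>N. \<forall>n x. n \<ge> N \<and> x \<in> K \<longrightarrow> norm (infdist x (A (r n)) - g x) < e"
    then show ?thesis by (intro exI[of _ g] exI[of _ r] conjI allI impI)
  qed
  then obtain g and r :: "nat \<Rightarrow> nat" where g: "continuous_on K g" and r: "strict_mono r"
    and lim: "\<And>e. 0 < e \<Longrightarrow> \<exists>N. \<forall>n x. n \<ge> N \<and> x \<in> K \<longrightarrow> norm (infdist x (A (r n)) - g x) < e"
    by (elim exE conjE) simp
  define B where "B = {x \<in> K. g x = 0}"
  have clB: "closed B"
    unfolding B_def using continuous_closed_preimage_constant[OF g compact_imp_closed[OF K]] .
  have mem: "l \<in> B" if k: "strict_mono k" and x: "\<And>n. x n \<in> A (r (k n))" and xl: "x \<longlonglongrightarrow> l" for k x l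
  proof -
    have xK: "x n \<in> K" for n using x A(1) by blast
    then have lK: "l \<in> K" using compact_imp_closed[OF K] xl closed_sequentially by blast
    have "(\<lambda>n. g (x n)) \<longlonglongrightarrow> g l"
      using continuous_on_tendsto_compose[OF g xl lK] xK by simp
    moreover have "(\<lambda>n. g (x n)) \<longlonglongrightarrow> 0"
    proof (rule LIMSEQ_I)
      fix e :: real assume "0 < e"
      then obtain N where N: "\<And>n x. n \<ge> N \<Longrightarrow> x \<in> K \<Longrightarrow> norm (infdist x (A (r n)) - g x) < e"
        using lim by blast
      have "norm (g (x n) - 0) < e" if "n \<ge> N" for n
      proof -
        have "k n \<ge> N" using seq_suble[OF k, of n] that by simp
        then show ?thesis using N[of "k n" "x n"] xK x by simp
      qed
      then show "\<exists>N. \<forall>n\<ge>N. norm (g (x n) - 0) < e" by blast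
    qed
    ultimately have "g l = 0" using LIMSEQ_unique by blast
    then show ?thesis using lK by (simp add: B_def)
  qed
  have near: "\<exists>N. \<forall>n\<ge>N. \<forall>y\<in>B. infdist y (A (r n)) < e" if "0 < e" for e
    using lim[OF that] by (fastforce simp: B_def)
  have approx: "\<exists>x. (\<forall>n. x n \<in> A (r n)) \<and> x \<longlonglongrightarrow> l" if l: "l \<in> B" for l
  proof -
    have "\<forall>n. \<exists>x. x \<in> A (r n) \<and> infdist l (A (r n)) = dist l x"
      using infdist_attains_inf[OF A(2,3)] by metis
    then obtain x where x: "\<And>n. x n \<in> A (r n)" "\<And>n. infdist l (A (r n)) = dist l (x n)" by metis
    have "x \<longlonglongrightarrow> l"
    proof (rule metric_LIMSEQ_I)
      fix e :: real assume "0 < e"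
      from near[OF this] show "\<exists>N. \<forall>n\<ge>N. dist (x n) l < e" using l x(2) by (metis dist_commute)
    qed
    then show ?thesis using x by blast
  qed
  \<comment> \<open>Otherwise points staying \<open>e\<close> away from \<open>B\<close> would
    subconverge to a point that \<open>mem\<close> places in \<open>B\<close>.\<close>
  have away: "\<exists>N. \<forall>n\<ge>N. \<forall>x\<in>A (r n). \<exists>y\<in>B. dist x y < e" if e: "0 < e" for e
  proof (rule ccontr)
    assume con: "\<not> ?thesis"
    have ex: "\<exists>n. (\<exists>x\<in>A (r n). \<forall>y\<in>B. \<not> dist x y < e) \<and> N < n" for N
      using con Suc_le_lessD by blast
    have "\<exists>k. \<forall>n. (\<exists>x\<in>A (r (k n)). \<forall>y\<in>B. \<not> dist x y < e) \<and> k n < k (Suc n)"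
      by (rule dependent_nat_choice) (use ex in blast)+
    then obtain k where k': "\<forall>n. (\<exists>x\<in>A (r (k n)). \<forall>y\<in>B. \<not> dist x y < e) \<and> k n < k (Suc n)" ..
    then have k: "\<And>n. \<exists>x\<in>A (r (k n)). \<forall>y\<in>B. \<not> dist x y < e" "strict_mono k"
      by (simp_all add: strict_mono_Suc_iff)
    from k(1) obtain x where x: "\<And>n. x n \<in> A (r (k n))" "\<And>n y. y \<in> B \<Longrightarrow> \<not> dist (x n) y < e" by metis
    have "x n \<in> K" for n using x(1) A(1) by blast
    then obtain l s where "l \<in> K" and ls: "strict_mono s" "(x \<circ> s) \<longlonglongrightarrow> l"
      by (rule compact_subseq[OF K])
    have "l \<in> B"
      using mem[OF strict_mono_o[OF k(2) ls(1)], of "x \<circ> s" l] ls x(1) by simp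
    moreover obtain n where "dist ((x \<circ> s) n) l < e"
      using metric_LIMSEQ_D[OF ls(2) e] by blast
    ultimately show False using x(2) by auto
  qed
  have "set_lim (A \<circ> r) B"
    unfolding set_lim_def
  proof (intro conjI allI impI ballI)
    fix k x l assume "strict_mono k" "\<forall>n. x n \<in> (A \<circ> r) (k n)" "x \<longlonglongrightarrow> l"
    then show "l \<in> B" using mem[of k x l] by simp
  next
    fix l assume "l \<in> B"
    then show "\<exists>x. (\<forall>n. x n \<in> (A \<circ> r) n) \<and> x \<longlonglongrightarrow> l" using approx by simp
  next
    fix e :: real assume e: "e > 0"
    obtain N1 where N1: "\<forall>n\<ge>N1. \<forall>x\<in>A (r n). \<exists>y\<in>B. dist x y < e" using away[OF e] by blast
    obtain N2 where N2: "\<forall>n\<ge>N2. \<forall>y\<in>B. infdist y (A (r n)) < e" using near[OF e] by blast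
    have "\<exists>x\<in>A (r n). dist x y < e" if "n \<ge> N2" "y \<in> B" for n y
      using infdist_attains_inf[OF A(2,3), of "r n" y] N2 that by (metis dist_commute)
    then show "\<exists>N. \<forall>n\<ge>N. (\<forall>x\<in>(A \<circ> r) n. \<exists>y\<in>B. dist x y < e) \<and> (\<forall>y\<in>B. \<exists>x\<in>(A \<circ> r) n. dist x y < e)"
      using N1 by (intro exI[of _ "max N1 N2"]) auto
  qed
  then show thesis using that[OF r _ clB] by (auto simp: B_def)
qed

section \<open>Closed conditions on sets of endpoint pairs\<close>

abbreviation torus :: "(complex \<times> complex) set" where "torus \<equiv> sphere 0 1 \<times> sphere 0 1"

lemma compact_torus: "compact torus" by (intro compact_Times compact_sphere)

definition seg :: "complex \<times> complex \<Rightarrow> complex set" where "seg p = closed_segment (fst p) (snd p)"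

definition pairs :: "complex set set \<Rightarrow> (complex \<times> complex) set" where
  "pairs L = {p \<in> torus. seg p \<in> L}"

text \<open>For \<open>a, b\<close> on the unit circle this says that \<open>a\<close> and \<open>b\<close> are distinct with \<open>a\<^sup>3 = b\<^sup>3\<close>;
  the polynomial form passes to limits.\<close>

definition cube_twins :: "complex \<Rightarrow> complex \<Rightarrow> bool" where
  "cube_twins a b \<longleftrightarrow> a^2 + a * b + b^2 = 0"

lemma cube_twins_iff: "a \<noteq> 0 \<Longrightarrow> cube_twins a b \<longleftrightarrow> a^3 = b^3 \<and> a \<noteq> b"
proof -
  assume a: "a \<noteq> 0"
  have *: "a^3 - b^3 = (a - b) * (a^2 + a * b + b^2)"
    by (simp add: power2_eq_square power3_eq_cube algebra_simps)
  have "a^2 + a * a + a^2 = 3 * a^2" by (simp add: power2_eq_square)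
  then show ?thesis using * a unfolding cube_twins_def by (metis mult_eq_0_iff power_not_zero right_minus_eq zero_neq_numeral)
qed

definition siblings :: "(complex \<times> complex) set \<Rightarrow> complex \<times> complex \<Rightarrow> complex \<times> complex \<Rightarrow> complex \<times> complex \<Rightarrow> bool" where
  "siblings A p q r \<longleftrightarrow> p \<in> A \<and> q \<in> A \<and> r \<in> A \<and>
     cube_twins (fst p) (fst q) \<and> cube_twins (fst p) (fst r) \<and> cube_twins (fst q) (fst r) \<and>
     cube_twins (snd p) (snd q) \<and> cube_twins (snd p) (snd r) \<and> cube_twins (snd q) (snd r)"

text \<open>Each clause is put in a form that survives limits: not crossing is a weak inequality,
  and the sibling clause has an open premise, which approximating pairs eventually satisfy. A
  degenerate image needs no separate alternative because the diagonal belongs to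
  \<open>A\<close>.\<close>

definition symmetric_pairs :: "(complex \<times> complex) set \<Rightarrow> bool" where
  "symmetric_pairs A \<longleftrightarrow> A \<subseteq> torus \<and> closed A \<and> (\<forall>a. norm a = 1 \<longrightarrow> (a, a) \<in> A) \<and>
     (\<forall>a b. (a, b) \<in> A \<longrightarrow> (b, a) \<in> A) \<and>
     (\<forall>p\<in>A. \<forall>q\<in>A. 0 \<le> orient (fst p) (snd p) (fst q) * orient (fst p) (snd p) (snd q)) \<and>
     (\<forall>a b. (a, b) \<in> A \<longrightarrow> (a^3, b^3) \<in> A) \<and>
     (\<forall>a b. (a, b) \<in> A \<longrightarrow> (\<exists>p\<in>A. (fst p)^3 = a \<and> (snd p)^3 = b)) \<and>
     (\<forall>p\<in>A. fst p^3 \<noteq> snd p^3 \<longrightarrow> (\<exists>q r. siblings A p q r)) \<and>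
     (\<forall>a b. (a, b) \<in> A \<longrightarrow> (- a, - b) \<in> A)"

lemma set_lim_symmetric_pairs:
  assumes S: "\<And>n. symmetric_pairs (A n)" and B: "B \<subseteq> torus" "closed B" and lim: "set_lim A B"
  shows "symmetric_pairs B"
proof -
  have tor: "x \<in> torus" if "x \<in> A n" for x n using S that unfolding symmetric_pairs_def by blast
  have id: "strict_mono (id :: nat \<Rightarrow> nat)" by (simp add: strict_mono_def)
  note mem = set_lim_mem[OF lim id, simplified]
  show ?thesis unfolding symmetric_pairs_def
  proof (intro conjI allI impI ballI)
    show "B \<subseteq> torus" "closed B" by fact+
  next
    fix a :: complex assume "norm a = 1"
    then show "(a, a) \<in> B" using mem[of "\<lambda>_. (a, a)"] S by (simp add: symmetric_pairs_def)
  next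
    fix a b assume "(a, b) \<in> B"
    then obtain x where x: "\<And>n. x n \<in> A n" "x \<longlonglongrightarrow> (a, b)" using set_lim_approx[OF lim] by blast
    have ab: "(\<lambda>n. fst (x n)) \<longlonglongrightarrow> a" "(\<lambda>n. snd (x n)) \<longlonglongrightarrow> b"
      using tendsto_fst[OF x(2)] tendsto_snd[OF x(2)] by simp_all
    have A: "(fst (x n), snd (x n)) \<in> A n" for n using x(1) by simp
    show "(b, a) \<in> B"
      by (rule mem[of "\<lambda>n. (snd (x n), fst (x n))"])
        (use A S ab in \<open>auto simp: symmetric_pairs_def intro!: tendsto_intros\<close>)
    show "(a^3, b^3) \<in> B"
      by (rule mem[of "\<lambda>n. (fst (x n) ^ 3, snd (x n) ^ 3)"])
        (use A S ab in \<open>auto simp: symmetric_pairs_def intro!: tendsto_intros\<close>)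
    show "(- a, - b) \<in> B"
      by (rule mem[of "\<lambda>n. (- fst (x n), - snd (x n))"])
        (use A S ab in \<open>auto simp: symmetric_pairs_def intro!: tendsto_intros\<close>)
    have "\<exists>p\<in>A n. (fst p)^3 = fst (x n) \<and> (snd p)^3 = snd (x n)" for n
      using A[of n] S[of n] unfolding symmetric_pairs_def by blast
    then obtain p where p: "\<And>n. p n \<in> A n" "\<And>n. (fst (p n))^3 = fst (x n)" "\<And>n. (snd (p n))^3 = snd (x n)"
      by metis
    obtain q s where "q \<in> torus" and q: "strict_mono s" "(p \<circ> s) \<longlonglongrightarrow> q"
      by (rule compact_subseq[OF compact_torus, of p, OF tor[OF p(1)]])
    have "q \<in> B" using set_lim_mem[OF lim q(1) _ q(2)] p(1) by simp
    moreover have "(fst q)^3 = a"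
    proof (rule LIMSEQ_unique)
      show "(\<lambda>n. (fst ((p \<circ> s) n))^3) \<longlonglongrightarrow> (fst q)^3" by (intro tendsto_intros q)
      show "(\<lambda>n. (fst ((p \<circ> s) n))^3) \<longlonglongrightarrow> a"
        using LIMSEQ_subseq_LIMSEQ[OF ab(1) q(1)] p(2) by (simp add: o_def)
    qed
    moreover have "(snd q)^3 = b"
    proof (rule LIMSEQ_unique)
      show "(\<lambda>n. (snd ((p \<circ> s) n))^3) \<longlonglongrightarrow> (snd q)^3" by (intro tendsto_intros q)
      show "(\<lambda>n. (snd ((p \<circ> s) n))^3) \<longlonglongrightarrow> b"
        using LIMSEQ_subseq_LIMSEQ[OF ab(2) q(1)] p(3) by (simp add: o_def)
    qed
    ultimately show "\<exists>p\<in>B. (fst p)^3 = a \<and> (snd p)^3 = b" by blast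
  next
    fix p q assume "p \<in> B" "q \<in> B"
    then obtain x y where x: "\<And>n. x n \<in> A n" "x \<longlonglongrightarrow> p" and y: "\<And>n. y n \<in> A n" "y \<longlonglongrightarrow> q"
      using set_lim_approx[OF lim] by metis
    have "(\<lambda>n. orient (fst (x n)) (snd (x n)) (fst (y n)) * orient (fst (x n)) (snd (x n)) (snd (y n)))
       \<longlonglongrightarrow> orient (fst p) (snd p) (fst q) * orient (fst p) (snd p) (snd q)"
      unfolding orient_def by (intro tendsto_intros x y)
    then show "0 \<le> orient (fst p) (snd p) (fst q) * orient (fst p) (snd p) (snd q)"
    proof (rule LIMSEQ_le_const, intro exI allI impI)
      show "0 \<le> orient (fst (x n)) (snd (x n)) (fst (y n)) * orient (fst (x n)) (snd (x n)) (snd (y n))" for n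
        using S[of n] x(1)[of n] y(1)[of n] unfolding symmetric_pairs_def by blast
    qed
  next
    fix p assume p: "p \<in> B" "fst p^3 \<noteq> snd p^3"
    then obtain x where x: "\<And>n. x n \<in> A n" "x \<longlonglongrightarrow> p" using set_lim_approx[OF lim] by blast
    have "(\<lambda>n. fst (x n)^3 - snd (x n)^3) \<longlonglongrightarrow> fst p^3 - snd p^3" by (intro tendsto_intros x)
    then have "eventually (\<lambda>n. fst (x n)^3 - snd (x n)^3 \<noteq> 0) sequentially"
      by (rule tendsto_imp_eventually_ne) (use p in simp)
    then obtain N where N: "\<And>n. n \<ge> N \<Longrightarrow> fst (x n)^3 \<noteq> snd (x n)^3"
      unfolding eventually_sequentially by auto
    have "\<exists>q r. siblings (A (n + N)) (x (n + N)) q r" for n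
      using S[of "n + N"] N[of "n + N"] x(1)[of "n + N"] unfolding symmetric_pairs_def by simp
    then obtain q r where qr: "\<And>n. siblings (A (n + N)) (x (n + N)) (q n) (r n)" by metis
    have "(q n, r n) \<in> torus \<times> torus" for n using qr[of n] tor unfolding siblings_def by blast
    then obtain l s where "l \<in> torus \<times> torus" and s: "strict_mono s" "((\<lambda>n. (q n, r n)) \<circ> s) \<longlonglongrightarrow> l"
      by (rule compact_subseq[OF compact_Times[OF compact_torus compact_torus]])
    have ql: "(\<lambda>n. q (s n)) \<longlonglongrightarrow> fst l" and rl: "(\<lambda>n. r (s n)) \<longlonglongrightarrow> snd l"
      using tendsto_fst[OF s(2)] tendsto_snd[OF s(2)] by (simp_all add: o_def)
    have sN: "strict_mono (\<lambda>n. s n + N)" using s(1) by (simp add: strict_mono_def)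
    have xl: "(\<lambda>n. x (s n + N)) \<longlonglongrightarrow> p"
      using LIMSEQ_subseq_LIMSEQ[OF x(2) sN] by (simp add: o_def)
    have tw: "cube_twins a b" if "u \<longlonglongrightarrow> a" "w \<longlonglongrightarrow> b" "\<And>n. cube_twins (u n) (w n)" for u w a b
    proof -
      have "(\<lambda>n. (u n)^2 + u n * w n + (w n)^2) \<longlonglongrightarrow> a^2 + a * b + b^2" by (intro tendsto_intros that)
      moreover have "(\<lambda>n. (u n)^2 + u n * w n + (w n)^2) = (\<lambda>n. 0)" using that(3) by (simp add: cube_twins_def)
      ultimately show ?thesis unfolding cube_twins_def by (simp add: LIMSEQ_const_iff)
    qed
    have "siblings B p (fst l) (snd l)" unfolding siblings_def
    proof (intro conjI)
      show "fst l \<in> B" by (rule set_lim_mem[OF lim sN _ ql]) (use qr in \<open>simp add: siblings_def\<close>)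
      show "snd l \<in> B" by (rule set_lim_mem[OF lim sN _ rl]) (use qr in \<open>simp add: siblings_def\<close>)
      show "cube_twins (fst p) (fst (fst l))"
        by (rule tw[OF tendsto_fst[OF xl] tendsto_fst[OF ql]]) (use qr in \<open>simp add: siblings_def\<close>)
      show "cube_twins (snd p) (snd (fst l))"
        by (rule tw[OF tendsto_snd[OF xl] tendsto_snd[OF ql]]) (use qr in \<open>simp add: siblings_def\<close>)
      show "cube_twins (fst p) (fst (snd l))"
        by (rule tw[OF tendsto_fst[OF xl] tendsto_fst[OF rl]]) (use qr in \<open>simp add: siblings_def\<close>)
      show "cube_twins (snd p) (snd (snd l))"
        by (rule tw[OF tendsto_snd[OF xl] tendsto_snd[OF rl]]) (use qr in \<open>simp add: siblings_def\<close>)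
      show "cube_twins (fst (fst l)) (fst (snd l))"
        by (rule tw[OF tendsto_fst[OF ql] tendsto_fst[OF rl]]) (use qr in \<open>simp add: siblings_def\<close>)
      show "cube_twins (snd (fst l)) (snd (snd l))"
        by (rule tw[OF tendsto_snd[OF ql] tendsto_snd[OF rl]]) (use qr in \<open>simp add: siblings_def\<close>)
    qed (rule p(1))
    then show "\<exists>q r. siblings B p q r" by (intro exI)
  qed
qed

section \<open>Laminations as sets of endpoint pairs\<close>

lemma circle_pt_frac: "circle_pt (frac t) = circle_pt t"
  by (simp add: circle_pt_eq_iff frac_def)

lemma circle_pt_cases:
  assumes "norm z = 1" obtains t where "t \<in> {0..<1}" "z = circle_pt t"
proof -
  have "z \<in> range circle_pt" using assms by (simp add: circle_pt_image)
  then obtain t where "z = circle_pt t" by blast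
  then show thesis using that[of "frac t"] by (simp add: circle_pt_frac frac_lt_1)
qed

lemma chords_eq: "chords = seg ` torus"
proof
  show "chords \<subseteq> seg ` torus"
    unfolding chords_def chord_def seg_def by (force intro!: image_eqI[of _ _ "(circle_pt _, circle_pt _)"])
  show "seg ` torus \<subseteq> chords"
  proof clarify
    fix a b :: complex assume "a \<in> sphere 0 1" "b \<in> sphere 0 1"
    then have "norm a = 1" "norm b = 1" by simp_all
    then obtain s t where "a = circle_pt s" "b = circle_pt t" by (metis circle_pt_cases)
    then show "seg (a, b) \<in> chords" unfolding chords_def chord_def seg_def by auto
  qed
qed

lemma seg_eq_iff: "seg p = seg q \<longleftrightarrow> p = q \<or> fst p = snd q \<and> snd p = fst q"
  by (auto simp: seg_def doubleton_eq_iff prod_eq_iff)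

lemma seg_swap: "seg (b, a) = seg (a, b)"
  by (simp add: seg_eq_iff)

lemma degenerate_chords_eq: "degenerate_chords = {{z} | z. norm z = 1}"
proof -
  have "(\<exists>t. l = {circle_pt t}) \<longleftrightarrow> (\<exists>z. l = {z} \<and> norm z = 1)" for l
    by (metis circle_pt_cases norm_circle_pt)
  then show ?thesis unfolding degenerate_chords_def by simp
qed

lemma seg_degenerate:
  assumes "p \<in> torus" shows "seg p \<in> degenerate_chords \<longleftrightarrow> fst p = snd p"
proof
  assume "seg p \<in> degenerate_chords"
  then obtain z where "seg p = {z}" by (auto simp: degenerate_chords_eq)
  then have "fst p \<in> {z}" "snd p \<in> {z}" unfolding seg_def by (metis ends_in_segment)+
  then show "fst p = snd p" by simp
next
  assume "fst p = snd p"
  then show "seg p \<in> degenerate_chords" using assms by (auto simp: degenerate_chords_eq seg_def)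
qed

lemma sigma3_seg:
  assumes "p \<in> torus" shows "sigma3 (seg p) = seg (fst p ^ 3, snd p ^ 3)"
proof -
  have "norm (fst p) = 1" "norm (snd p) = 1" using assms by auto
  then obtain s t where st: "fst p = circle_pt s" "snd p = circle_pt t" by (metis circle_pt_cases)
  have *: "circle_pt t ^ 3 = circle_pt (3 * t)" for t
    by (simp add: circle_pt_def power3_eq_cube cis_mult)
  have "seg p = chord s t" by (simp add: seg_def chord_def st)
  then show ?thesis by (simp add: sigma3_chord) (simp add: chord_def seg_def st *)
qed

lemma uminus_seg: "uminus ` seg p = seg (- fst p, - snd p)"
  by (simp add: seg_def closed_segment_linear_image[OF linear_uminus])

lemma cross_seg_iff:
  assumes "p \<in> torus" "q \<in> torus"
  shows "cross (seg p) (seg q) \<longleftrightarrow> orient (fst p) (snd p) (fst q) * orient (fst p) (snd p) (snd q) < 0"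
  unfolding seg_def by (rule cross_iff_orient) (use assms in auto)

text \<open>Closedness of the union controls points, not chords. The midpoint of a nondegenerate
  limit chord lies on some leaf; were the limit chord not a leaf, that leaf would cross it there,
  and hence cross nearby chords of the sequence, because crossing is an open condition.\<close>

lemma closed_pairs:
  assumes L: "lamination L" shows "closed (pairs L)"
  unfolding closed_sequential_limits
proof (intro allI impI, elim conjE)
  fix x l assume x: "\<forall>n. x n \<in> pairs L" "x \<longlonglongrightarrow> l"
  have xt: "x n \<in> torus" "seg (x n) \<in> L" for n using x(1) by (auto simp: pairs_def)
  have lt: "l \<in> torus"
    by (rule closed_sequentially[OF compact_imp_closed[OF compact_torus] xt(1) x(2)])
  have "seg l \<in> L"
  proof (cases "fst l = snd l")
    case True
    then show ?thesis using seg_degenerate[OF lt] L by (auto simp: lamination_def)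
  next
    case ne: False
    define mid where "mid p = (1 - 1/2) *\<^sub>R fst p + (1/2 :: real) *\<^sub>R (snd p :: complex)" for p
    have mid: "mid p \<in> seg p" for p
      unfolding mid_def seg_def in_segment by (intro exI[of _ "1/2"]) simp
    have lim: "(\<lambda>n. mid (x n)) \<longlonglongrightarrow> mid l" unfolding mid_def by (intro tendsto_intros x)
    have mem: "mid (x n) \<in> \<Union>L" for n using mid[of "x n"] xt(2) by blast
    have cl: "closed (\<Union>L)" using L by (simp add: lamination_def)
    have "mid l \<in> \<Union>L" by (rule closed_sequentially[OF cl mem lim])
    then obtain m where m: "m \<in> L" "mid l \<in> m" by blast
    have "m \<in> seg ` torus" using m(1) L unfolding lamination_def chords_eq by blast
    then obtain q where q: "q \<in> torus" "m = seg q" by blast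
    show ?thesis
    proof (rule ccontr)
      assume nl: "seg l \<notin> L"
      have "norm (mid l) < 1" unfolding mid_def
        using norm_affine_less_iff[of "fst l" "snd l" "1/2"] lt ne by auto
      then have "mid l \<in> ball 0 1" by simp
      moreover have "seg l \<noteq> m" using nl m by blast
      ultimately have "cross (seg l) (seg q)" unfolding cross_def using mid[of l] m(2) q(2) by blast
      then have neg: "orient (fst l) (snd l) (fst q) * orient (fst l) (snd l) (snd q) < 0"
        using cross_seg_iff[OF lt q(1)] by blast
      have "(\<lambda>n. orient (fst (x n)) (snd (x n)) (fst q) * orient (fst (x n)) (snd (x n)) (snd q))
          \<longlonglongrightarrow> orient (fst l) (snd l) (fst q) * orient (fst l) (snd l) (snd q)"
        unfolding orient_def by (intro tendsto_intros x)
      from order_tendstoD(2)[OF this neg]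
      obtain n where "orient (fst (x n)) (snd (x n)) (fst q) * orient (fst (x n)) (snd (x n)) (snd q) < 0"
        unfolding eventually_sequentially by blast
      then have "cross (seg (x n)) m" using cross_seg_iff[OF xt(1) q(1)] q(2) by blast
      then show False using L m(1) xt(2) by (auto simp: lamination_def)
    qed
  qed
  then show "l \<in> pairs L" using lt by (simp add: pairs_def)
qed

lemma seg_on_circle:
  assumes "p \<in> torus" "z \<in> seg p" "norm z = 1" shows "z = fst p \<or> z = snd p"
proof -
  obtain u where u: "0 \<le> u" "u \<le> 1" "z = (1 - u) *\<^sub>R fst p + u *\<^sub>R snd p"
    using assms(2) unfolding seg_def in_segment by blast
  show ?thesis
  proof (cases "fst p = snd p")
    case True
    then show ?thesis using u by (simp flip: scaleR_add_left)
  next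
    case False
    then have "u = 0 \<or> u = 1"
      using norm_affine_less_iff[of "fst p" "snd p" u] assms u by force
    then show ?thesis using u by auto
  qed
qed

lemma seg_norm_le:
  assumes "p \<in> torus" "z \<in> seg p" shows "norm z \<le> 1"
proof -
  have "seg p \<subseteq> cball 0 1" unfolding seg_def by (rule closed_segment_subset) (use assms(1) in auto)
  then have "z \<in> cball 0 1" using assms(2) by blast
  then show ?thesis by simp
qed

lemma uncrossed_disjoint:
  assumes "p \<in> torus" "q \<in> torus" "\<not> cross (seg p) (seg q)" "{fst p, snd p} \<inter> {fst q, snd q} = {}"
  shows "seg p \<inter> seg q = {}"
proof (rule ccontr)
  assume "seg p \<inter> seg q \<noteq> {}"
  then obtain z where z: "z \<in> seg p" "z \<in> seg q" by blast
  have "seg p \<noteq> seg q" using assms(4) by (auto simp: seg_eq_iff)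
  then have "z \<notin> ball 0 1" using assms(3) z unfolding cross_def by blast
  then have "norm z = 1" using seg_norm_le[OF assms(1) z(1)] by simp
  then show False using seg_on_circle[OF assms(1) z(1)] seg_on_circle[OF assms(2) z(2)] assms(4) by blast
qed

lemma torus_nz: "p \<in> torus \<Longrightarrow> fst p \<noteq> 0 \<and> snd p \<noteq> 0" by auto

text \<open>Corresponding endpoints are distinct, and noncorresponding ones have different cubes by
  \<open>ne\<close>. So no endpoint is shared, and uncrossed chords without a common endpoint are
  disjoint.\<close>

lemma siblings_triple:
  assumes nc: "\<And>l m. l \<in> L \<Longrightarrow> m \<in> L \<Longrightarrow> \<not> cross l m"
    and s: "siblings (pairs L) p q r" and ne: "fst p ^ 3 \<noteq> snd p ^ 3"
  shows "sibling_triple L {seg p, seg q, seg r}" "seg p \<noteq> seg q"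
proof -
  have t: "p \<in> torus" "q \<in> torus" "r \<in> torus" and L: "seg p \<in> L" "seg q \<in> L" "seg r \<in> L"
    using s by (auto simp: siblings_def pairs_def)
  have "cube_twins (fst p) (fst q)" "cube_twins (fst p) (fst r)" "cube_twins (fst q) (fst r)"
     "cube_twins (snd p) (snd q)" "cube_twins (snd p) (snd r)" "cube_twins (snd q) (snd r)"
    using s by (auto simp: siblings_def)
  then have tw: "fst p ^ 3 = fst q ^ 3" "fst p \<noteq> fst q" "fst p ^ 3 = fst r ^ 3" "fst p \<noteq> fst r" "fst q \<noteq> fst r"
    "snd p ^ 3 = snd q ^ 3" "snd p \<noteq> snd q" "snd p ^ 3 = snd r ^ 3" "snd p \<noteq> snd r" "snd q \<noteq> snd r"
    using cube_twins_iff t[THEN torus_nz] by blast+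
  have d: "seg p \<inter> seg q = {}" "seg p \<inter> seg r = {}" "seg q \<inter> seg r = {}"
    by (rule uncrossed_disjoint; use t nc L tw ne in force)+
  have n: "fst x \<in> seg x" for x by (simp add: seg_def)
  then have dist: "seg p \<noteq> seg q" "seg p \<noteq> seg r" "seg q \<noteq> seg r" using d by blast+
  then show "seg p \<noteq> seg q" by simp
  have "sigma3 (seg p) = sigma3 (seg q)" "sigma3 (seg p) = sigma3 (seg r)"
    using sigma3_seg t tw by auto
  then show "sibling_triple L {seg p, seg q, seg r}"
    unfolding sibling_triple_def using L dist d by (auto simp: pairwise_def disjnt_def Int_commute)
qed

text \<open>\<open>sigma3\<close> determines the cubes of the endpoints only up to exchange, so each
  leaf is written with its endpoints in the order that matches \<open>p\<close>. Disjointness of the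
  leaves then makes corresponding endpoints distinct.\<close>

lemma triple_siblings:
  assumes LC: "L \<subseteq> chords" and T: "sibling_triple L T" and p: "p \<in> torus" "seg p \<in> T"
    and m: "m \<in> T" "m \<noteq> seg p"
  obtains q r where "siblings (pairs L) p q r" "m = seg q" "T = {seg p, seg q, seg r}"
proof -
  have "card T = 3" and TL: "T \<subseteq> L" and dj: "disjoint T" using T by (auto simp: sibling_triple_def)
  then have "card (T - {seg p, m}) = 1" using p(2) m by (subst card_Diff_subset) auto
  then obtain k where k: "T - {seg p, m} = {k}" by (auto simp: card_1_singleton_iff)
  have ex: "\<exists>q\<in>torus. l = seg q \<and> fst q ^ 3 = fst p ^ 3 \<and> snd q ^ 3 = snd p ^ 3" if l: "l \<in> T" for l
  proof -
    obtain q where q: "q \<in> torus" "l = seg q" using l TL LC chords_eq by blast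
    have "sigma3 l = sigma3 (seg p)" using T l p(2) unfolding sibling_triple_def by blast
    then consider "fst q ^ 3 = fst p ^ 3" "snd q ^ 3 = snd p ^ 3" | "fst q ^ 3 = snd p ^ 3" "snd q ^ 3 = fst p ^ 3"
      unfolding q(2) sigma3_seg[OF q(1)] sigma3_seg[OF p(1)] seg_eq_iff by auto
    then show ?thesis
    proof cases
      case 2
      then show ?thesis using q seg_swap by (intro bexI[of _ "(snd q, fst q)"]) auto
    qed (use q in blast)
  qed
  obtain q where q: "q \<in> torus" "m = seg q" "fst q ^ 3 = fst p ^ 3" "snd q ^ 3 = snd p ^ 3"
    using ex[OF m(1)] by blast
  have kT: "k \<in> T" "k \<noteq> seg p" "k \<noteq> m" using k by auto
  obtain r where r: "r \<in> torus" "k = seg r" "fst r ^ 3 = fst p ^ 3" "snd r ^ 3 = snd p ^ 3"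
    using ex[OF kT(1)] by blast
  have d: "seg p \<inter> seg q = {}" "seg p \<inter> seg r = {}" "seg q \<inter> seg r = {}"
    using dj p(2) m kT q(2) r(2) unfolding pairwise_def disjnt_def by blast+
  have e: "fst x \<in> seg x" "snd x \<in> seg x" for x by (simp_all add: seg_def)
  have dist: "fst p \<noteq> fst q" "fst p \<noteq> fst r" "fst q \<noteq> fst r" "snd p \<noteq> snd q" "snd p \<noteq> snd r" "snd q \<noteq> snd r"
    using d e[of p] e[of q] e[of r] by (metis disjoint_iff)+
  have "p \<in> pairs L" "q \<in> pairs L" "r \<in> pairs L"
    using p q r m(1) kT(1) TL by (auto simp: pairs_def)
  then have "siblings (pairs L) p q r"
    unfolding siblings_def using dist q r cube_twins_iff torus_nz[OF p(1)] torus_nz[OF q(1)] torus_nz[OF r(1)]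
    by auto
  moreover have "T = {seg p, seg q, seg r}" using k p(2) m(1) q(2) r(2) by blast
  ultimately show thesis using that q(2) by blast
qed

lemma symmetric_lamination_pairs:
  assumes "symmetric_lamination L"
  shows "L \<subseteq> chords" "symmetric_pairs (pairs L)"
proof -
  have cub: "cubic_lamination L" and sym: "\<And>l. l \<in> L \<Longrightarrow> uminus ` l \<in> L"
    using assms by (auto simp: symmetric_lamination_def)
  have lam: "lamination L" and D1: "\<And>l. l \<in> L \<Longrightarrow> sigma3 l \<in> L \<or> sigma3 l \<in> degenerate_chords"
    and D2: "\<And>l. l \<in> L \<Longrightarrow> \<exists>l'\<in>L. sigma3 l' = l"
    and D2': "\<And>l. l \<in> L \<Longrightarrow> sigma3 l \<notin> degenerate_chords \<Longrightarrow> \<exists>T. sibling_triple L T \<and> l \<in> T"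
    using cub by (auto simp: cubic_lamination_def)
  show LC: "L \<subseteq> chords" using lam by (simp add: lamination_def)
  have deg: "degenerate_chords \<subseteq> L" and nc: "\<And>l m. l \<in> L \<Longrightarrow> m \<in> L \<Longrightarrow> \<not> cross l m"
    using lam by (auto simp: lamination_def)
  have cube_torus: "(fst p ^ 3, snd p ^ 3) \<in> torus" if "p \<in> torus" for p
    using that by (auto simp: norm_power)
  show "symmetric_pairs (pairs L)" unfolding symmetric_pairs_def
  proof (intro conjI allI impI ballI)
    show "pairs L \<subseteq> torus" by (auto simp: pairs_def)
    show "closed (pairs L)" by (rule closed_pairs[OF lam])
    show "(a, a) \<in> pairs L" if "norm a = 1" for a
      using that deg seg_degenerate[of "(a, a)"] by (auto simp: pairs_def)
    show "(b, a) \<in> pairs L" if "(a, b) \<in> pairs L" for a b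
      using that seg_swap by (auto simp: pairs_def)
    show "0 \<le> orient (fst p) (snd p) (fst q) * orient (fst p) (snd p) (snd q)"
      if "p \<in> pairs L" "q \<in> pairs L" for p q
    proof -
      have "p \<in> torus" "q \<in> torus" "\<not> cross (seg p) (seg q)" using that nc by (auto simp: pairs_def)
      then show ?thesis using cross_seg_iff[of p q] by simp
    qed
    show "(a^3, b^3) \<in> pairs L" if "(a, b) \<in> pairs L" for a b
    proof -
      have ab: "(a, b) \<in> torus" "seg (a, b) \<in> L" using that by (auto simp: pairs_def)
      have "seg (a^3, b^3) \<in> L" using D1[OF ab(2)] sigma3_seg[OF ab(1)] deg by auto
      then show ?thesis using cube_torus[OF ab(1)] by (simp add: pairs_def)
    qed
    show "\<exists>p\<in>pairs L. (fst p)^3 = a \<and> (snd p)^3 = b" if "(a, b) \<in> pairs L" for a b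
    proof -
      have ab: "(a, b) \<in> torus" "seg (a, b) \<in> L" using that by (auto simp: pairs_def)
      obtain l where l: "l \<in> L" "sigma3 l = seg (a, b)" using D2[OF ab(2)] by blast
      obtain q where q: "q \<in> torus" "l = seg q" using l LC chords_eq by blast
      then have "q \<in> pairs L" "(snd q, fst q) \<in> pairs L" using l seg_swap by (auto simp: pairs_def)
      moreover have "fst q ^ 3 = a \<and> snd q ^ 3 = b \<or> fst q ^ 3 = b \<and> snd q ^ 3 = a"
        using l(2) sigma3_seg[OF q(1)] q(2) by (auto simp: seg_eq_iff)
      ultimately show ?thesis by (metis fst_conv snd_conv)
    qed
    show "\<exists>q r. siblings (pairs L) p q r" if "p \<in> pairs L" "fst p^3 \<noteq> snd p^3" for p
    proof -
      have p: "p \<in> torus" "seg p \<in> L" using that by (auto simp: pairs_def)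
      have "sigma3 (seg p) \<notin> degenerate_chords"
        using sigma3_seg[OF p(1)] seg_degenerate[OF cube_torus[OF p(1)]] that(2) by simp
      then obtain T where T: "sibling_triple L T" "seg p \<in> T" using D2'[OF p(2)] by blast
      have "T \<noteq> {seg p}" using T(1) by (auto simp: sibling_triple_def)
      then obtain m where "m \<in> T" "m \<noteq> seg p" using T(2) by blast
      from triple_siblings[OF LC T(1) p(1) T(2) this] show ?thesis by metis
    qed
    show "(- a, - b) \<in> pairs L" if "(a, b) \<in> pairs L" for a b
    proof -
      have "uminus ` seg (a, b) \<in> L" using that sym by (auto simp: pairs_def)
      then show ?thesis using that uminus_seg[of "(a, b)"] by (auto simp: pairs_def)
    qed
  qed
qed

lemma compact_torus_subset: "A \<subseteq> torus \<Longrightarrow> closed A \<Longrightarrow> compact A"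
  using closed_Int_compact[OF _ compact_torus, of A] by (simp add: Int_absorb2)

text \<open>The union of the segments is closed as the continuous image of the compact set
  \<open>A \<times> {0..1}\<close>.\<close>

lemma lamination_seg_image:
  assumes A: "A \<subseteq> torus" "closed A" and diag: "\<And>a. norm a = 1 \<Longrightarrow> (a, a) \<in> A"
    and nc: "\<And>p q. p \<in> A \<Longrightarrow> q \<in> A \<Longrightarrow> \<not> cross (seg p) (seg q)"
  shows "lamination (seg ` A)"
  unfolding lamination_def
proof (intro conjI)
  show "seg ` A \<subseteq> chords" using A(1) chords_eq by blast
  show "degenerate_chords \<subseteq> seg ` A"
  proof
    fix l assume "l \<in> degenerate_chords"
    then obtain z where "l = {z}" "norm z = 1" by (auto simp: degenerate_chords_eq)
    then show "l \<in> seg ` A" using diag[of z] by (intro image_eqI[of _ _ "(z, z)"]) (auto simp: seg_def)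
  qed
  show "\<forall>l\<in>seg ` A. \<forall>m\<in>seg ` A. \<not> cross l m" using nc by blast
  have "compact A" by (rule compact_torus_subset[OF A])
  then have "compact (A \<times> {0..1::real})" by (intro compact_Times) auto
  then have "compact ((\<lambda>x. (1 - snd x) *\<^sub>R fst (fst x) + snd x *\<^sub>R snd (fst x)) ` (A \<times> {0..1}))"
    by (rule compact_continuous_image[rotated]) (intro continuous_intros)
  moreover have "(\<lambda>x. (1 - snd x) *\<^sub>R fst (fst x) + snd x *\<^sub>R snd (fst x)) ` (A \<times> {0..1}) = \<Union> (seg ` A)"
  proof -
    have *: "(\<lambda>x. g (fst x) (snd x)) ` (A \<times> I) = (\<Union>p\<in>A. g p ` I)"
      for g :: "complex \<times> complex \<Rightarrow> real \<Rightarrow> complex" and I by force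
    have "seg p = (\<lambda>u. (1 - u) *\<^sub>R fst p + u *\<^sub>R snd p) ` {0..1}" for p
      unfolding seg_def closed_segment_def by force
    then show ?thesis using *[of "\<lambda>p u. (1 - u) *\<^sub>R fst p + u *\<^sub>R snd p" "{0..1}"] by simp
  qed
  ultimately show "closed (\<Union> (seg ` A))" using compact_imp_closed by metis
qed

lemma symmetric_pairs_lamination:
  assumes A: "symmetric_pairs A"
  shows "symmetric_lamination (seg ` A)" "pairs (seg ` A) = A"
proof -
  have t: "A \<subseteq> torus" "closed A" and diag: "\<And>a. norm a = 1 \<Longrightarrow> (a, a) \<in> A"
    and sw: "\<And>a b. (a, b) \<in> A \<Longrightarrow> (b, a) \<in> A"
    and ori: "\<And>p q. p \<in> A \<Longrightarrow> q \<in> A \<Longrightarrow> 0 \<le> orient (fst p) (snd p) (fst q) * orient (fst p) (snd p) (snd q)"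
    and D1: "\<And>a b. (a, b) \<in> A \<Longrightarrow> (a^3, b^3) \<in> A"
    and D2: "\<And>a b. (a, b) \<in> A \<Longrightarrow> \<exists>p\<in>A. (fst p)^3 = a \<and> (snd p)^3 = b"
    and sib: "\<And>p. p \<in> A \<Longrightarrow> fst p^3 \<noteq> snd p^3 \<Longrightarrow> \<exists>q r. siblings A p q r"
    and neg: "\<And>a b. (a, b) \<in> A \<Longrightarrow> (- a, - b) \<in> A"
    using A unfolding symmetric_pairs_def by - (elim conjE, simp)+
  have nc: "\<not> cross (seg p) (seg q)" if "p \<in> A" "q \<in> A" for p q
    using ori[OF that] cross_seg_iff[of p q] that t(1) by fastforce
  show pA: "pairs (seg ` A) = A"
  proof
    show "A \<subseteq> pairs (seg ` A)" using t(1) by (auto simp: pairs_def)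
    show "pairs (seg ` A) \<subseteq> A"
    proof
      fix p assume "p \<in> pairs (seg ` A)"
      then obtain q where "q \<in> A" "seg p = seg q" by (auto simp: pairs_def)
      then show "p \<in> A" using sw[of "fst q" "snd q"] unfolding seg_eq_iff by (metis prod.collapse)
    qed
  qed
  have lam: "lamination (seg ` A)" using lamination_seg_image[OF t diag nc] .
  then have nc': "\<not> cross l m" if "l \<in> seg ` A" "m \<in> seg ` A" for l m
    using that by (auto simp: lamination_def)
  have "cubic_lamination (seg ` A)" unfolding cubic_lamination_def
  proof (intro conjI ballI impI lam)
    fix l assume "l \<in> seg ` A"
    then obtain p where p: "p \<in> A" "l = seg p" by blast
    then have pt: "p \<in> torus" and p': "(fst p, snd p) \<in> A" using t(1) by auto
    show "sigma3 l \<in> seg ` A \<or> sigma3 l \<in> degenerate_chords"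
      using D1[OF p'] sigma3_seg[OF pt] p(2) by simp
    show "\<exists>l'\<in>seg ` A. sigma3 l' = l"
    proof -
      obtain q where q: "q \<in> A" "fst q ^ 3 = fst p" "snd q ^ 3 = snd p" using D2[OF p'] by blast
      then have "sigma3 (seg q) = seg p" using sigma3_seg[of q] t(1) by auto
      then show ?thesis using q p by blast
    qed
    show "\<exists>T. sibling_triple (seg ` A) T \<and> l \<in> T" if "sigma3 l \<notin> degenerate_chords"
    proof -
      have ne: "fst p ^ 3 \<noteq> snd p ^ 3"
      proof
        assume "fst p ^ 3 = snd p ^ 3"
        moreover have "(fst p ^ 3, snd p ^ 3) \<in> torus" using pt by (auto simp: norm_power)
        ultimately show False using that p(2) sigma3_seg[OF pt] seg_degenerate by simp
      qed
      obtain q r where "siblings A p q r" using sib[OF p(1) ne] by blast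
      then have "siblings (pairs (seg ` A)) p q r" by (simp add: pA)
      from siblings_triple(1)[OF nc' this ne] p(2) show ?thesis by blast
    qed
  qed
  moreover have "uminus ` l \<in> seg ` A" if "l \<in> seg ` A" for l
    using that neg uminus_seg by fastforce
  ultimately show "symmetric_lamination (seg ` A)" unfolding symmetric_lamination_def by blast
qed

section \<open>Passage from endpoint pairs to the two Hausdorff metrics\<close>

lemma seg_pairs: "L \<subseteq> chords \<Longrightarrow> seg ` pairs L = L"
proof -
  assume "L \<subseteq> chords"
  then have "l \<in> seg ` pairs L" if "l \<in> L" for l using that unfolding pairs_def chords_eq by blast
  then show ?thesis unfolding pairs_def by blast
qed

text \<open>Points with the same parameter on both segments are at most \<open>dist p q\<close>
  apart. Thus convergence of endpoint pairs carries over to chords and, through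
  \<open>mdist_seg_image\<close>, to laminations.\<close>

lemma mdist_seg:
  assumes "p \<in> torus" "q \<in> torus"
  shows "mdist chord_metric (seg p) (seg q) \<le> dist p q"
proof -
  have c: "seg x \<in> nonempty_compacts euclidean_metric" for x
    by (simp add: nonempty_compacts_def seg_def)
  have *: "\<exists>b\<in>seg y. dist a b \<le> dist x y" if a: "a \<in> seg x" for a x y
  proof -
    obtain u where u: "0 \<le> u" "u \<le> 1" "a = (1 - u) *\<^sub>R fst x + u *\<^sub>R snd x"
      using a unfolding seg_def in_segment by blast
    let ?b = "(1 - u) *\<^sub>R fst y + u *\<^sub>R snd y"
    have "a - ?b = (1 - u) *\<^sub>R (fst x - fst y) + u *\<^sub>R (snd x - snd y)"
      by (simp add: u(3) algebra_simps)
    then have "dist a ?b \<le> (1 - u) * dist (fst x) (fst y) + u * dist (snd x) (snd y)"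
      unfolding dist_norm using u norm_triangle_ineq[of "(1 - u) *\<^sub>R (fst x - fst y)" "u *\<^sub>R (snd x - snd y)"] by simp
    also have "\<dots> \<le> (1 - u) * dist x y + u * dist x y"
      using u by (intro add_mono mult_left_mono dist_fst_le dist_snd_le) auto
    finally have "dist a ?b \<le> dist x y" by (simp add: algebra_simps)
    moreover have "?b \<in> seg y" using u unfolding seg_def in_segment by blast
    ultimately show ?thesis by blast
  qed
  have "hausdorff_dist (mdist euclidean_metric) (seg p) (seg q) \<le> dist p q"
  proof (rule Metric_space.hausdorff_dist_le[OF Metric_space_mspace_mdist])
    show "seg p \<noteq> {}" "seg q \<noteq> {}" by (simp_all add: seg_def)
    show "\<exists>b\<in>seg q. mdist euclidean_metric a b \<le> dist p q" if "a \<in> seg p" for a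
      using *[OF that] by simp
    show "\<exists>a\<in>seg p. mdist euclidean_metric a b \<le> dist p q" if "b \<in> seg q" for b
      using *[OF that, of p] by (simp add: dist_commute)
  qed
  then show ?thesis
    unfolding chord_metric_def mdist_submetric mdist_hausdorff_metric[OF c c] .
qed

interpretation chord_space: Metric_space "mspace chord_metric" "mdist chord_metric"
  by (rule Metric_space_mspace_mdist)

interpretation lamination_space: Metric_space "mspace lamination_metric" "mdist lamination_metric"
  by (rule Metric_space_mspace_mdist)

lemma seg_image_in_space:
  assumes A: "A \<subseteq> torus" "closed A" "A \<noteq> {}"
  shows "seg ` A \<in> mspace lamination_metric"
proof -
  have cA: "compact A" by (rule compact_torus_subset[OF A(1,2)])
  have sub: "seg ` A \<subseteq> mspace chord_metric" using A(1) chords_eq by (auto simp: mspace_chord_metric)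
  have "compactin chord_space.mtopology (seg ` A)"
    unfolding chord_space.compactin_sequentially
  proof (intro conjI allI impI sub)
    fix s :: "nat \<Rightarrow> complex set" assume "range s \<subseteq> seg ` A"
    then have "\<forall>n. \<exists>p\<in>A. s n = seg p" by blast
    then obtain x where x: "\<And>n. x n \<in> A" "\<And>n. s n = seg (x n)" by metis
    obtain l r where lr: "l \<in> A" "strict_mono r" "(x \<circ> r) \<longlonglongrightarrow> l" by (rule compact_subseq[of A x, OF cA x(1)])
    have "limitin chord_space.mtopology (s \<circ> r) (seg l) sequentially"
      unfolding chord_space.limitin_metric
    proof (intro conjI allI impI)
      show "seg l \<in> mspace chord_metric" using sub lr(1) by blast
      fix e :: real assume "0 < e"
      then have "eventually (\<lambda>n. dist ((x \<circ> r) n) l < e) sequentially" by (rule tendstoD[OF lr(3)])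
      then show "eventually (\<lambda>n. (s \<circ> r) n \<in> mspace chord_metric \<and> mdist chord_metric ((s \<circ> r) n) (seg l) < e) sequentially"
      proof eventually_elim
        case (elim n)
        have "mdist chord_metric (seg (x (r n))) (seg l) \<le> dist (x (r n)) l"
          by (rule mdist_seg) (use x(1) lr(1) A(1) in blast)+
        then show ?case using elim x sub by auto
      qed
    qed
    then show "\<exists>l r. l \<in> seg ` A \<and> strict_mono r \<and> limitin chord_space.mtopology (s \<circ> r) l sequentially"
      using lr by blast
  qed
  then show ?thesis
    using A(3) by (simp add: lamination_metric_def mspace_hausdorff_metric nonempty_compacts_def mtopology_of_def)
qed

lemma mdist_seg_image:
  assumes A: "A \<subseteq> torus" "closed A" "A \<noteq> {}" and B: "B \<subseteq> torus" "closed B" "B \<noteq> {}"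
    and "\<And>x. x \<in> A \<Longrightarrow> \<exists>y\<in>B. dist x y \<le> e" "\<And>y. y \<in> B \<Longrightarrow> \<exists>x\<in>A. dist x y \<le> e"
  shows "mdist lamination_metric (seg ` A) (seg ` B) \<le> e"
proof -
  have "seg ` A \<in> nonempty_compacts chord_metric" "seg ` B \<in> nonempty_compacts chord_metric"
    using seg_image_in_space[OF A] seg_image_in_space[OF B]
    by (simp_all add: lamination_metric_def mspace_hausdorff_metric)
  then have "mdist lamination_metric (seg ` A) (seg ` B) = hausdorff_dist (mdist chord_metric) (seg ` A) (seg ` B)"
    unfolding lamination_metric_def by (rule mdist_hausdorff_metric)
  also have "\<dots> \<le> e"
  proof (rule chord_space.hausdorff_dist_le)
    show "seg ` A \<noteq> {}" "seg ` B \<noteq> {}" using A B by auto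
    fix a assume "a \<in> seg ` A"
    then obtain x where x: "x \<in> A" "a = seg x" by blast
    obtain y where y: "y \<in> B" "dist x y \<le> e" using assms(7)[OF x(1)] by blast
    have "mdist chord_metric a (seg y) \<le> dist x y" unfolding x(2) by (rule mdist_seg) (use x y A B in blast)+
    then show "\<exists>b\<in>seg ` B. mdist chord_metric a b \<le> e" using y by (meson image_eqI order_trans)
  next
    fix b assume "b \<in> seg ` B"
    then obtain y where y: "y \<in> B" "b = seg y" by blast
    obtain x where x: "x \<in> A" "dist x y \<le> e" using assms(8)[OF y(1)] by blast
    have "mdist chord_metric (seg x) b \<le> dist x y" unfolding y(2) by (rule mdist_seg) (use x y A B in blast)+
    then show "\<exists>a\<in>seg ` A. mdist chord_metric a b \<le> e" using x by (meson image_eqI order_trans)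
  qed
  finally show ?thesis .
qed

lemma symmetric_pairs_ne: "symmetric_pairs A \<Longrightarrow> A \<noteq> {}"
proof -
  assume "symmetric_pairs A"
  then have "norm (1 :: complex) = 1 \<longrightarrow> (1, 1) \<in> A" unfolding symmetric_pairs_def by blast
  then show ?thesis by auto
qed

lemma symmetric_pairs_closed: "symmetric_pairs A \<Longrightarrow> A \<subseteq> torus \<and> closed A"
  unfolding symmetric_pairs_def by blast

lemma symmetric_lamination_subseq:
  fixes L :: "nat \<Rightarrow> complex set set"
  assumes L: "\<And>n. symmetric_lamination (L n)"
  obtains r K where "strict_mono r" "symmetric_lamination K" "set_lim (\<lambda>n. pairs (L (r n))) (pairs K)"
proof -
  have S: "symmetric_pairs (pairs (L n))" for n by (rule symmetric_lamination_pairs(2)[OF L])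
  have "pairs (L n) \<subseteq> torus" "closed (pairs (L n))" "pairs (L n) \<noteq> {}" for n
    using symmetric_pairs_closed[OF S] symmetric_pairs_ne[OF S] by blast+
  then obtain r B where rB: "strict_mono r" "B \<subseteq> torus" "closed B" "set_lim ((\<lambda>n. pairs (L n)) \<circ> r) B"
    by (rule compact_set_lim[OF compact_torus, of "\<lambda>n. pairs (L n)"])
  have "symmetric_pairs B" by (rule set_lim_symmetric_pairs[OF _ rB(2-4)]) (use S in simp)
  from symmetric_pairs_lamination[OF this] show thesis
    using that[OF rB(1), of "seg ` B"] rB(4) by (simp add: o_def)
qed

theorem compactin_symmetric_laminations:
  "compactin (mtopology_of lamination_metric) {L. symmetric_lamination L}"
  unfolding mtopology_of_def lamination_space.compactin_sequentially
proof (intro conjI allI impI)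
  have p: "pairs M \<subseteq> torus" "closed (pairs M)" "pairs M \<noteq> {}" "seg ` pairs M = M" if M: "symmetric_lamination M" for M
    using symmetric_pairs_closed[OF symmetric_lamination_pairs(2)[OF M]]
      symmetric_pairs_ne[OF symmetric_lamination_pairs(2)[OF M]]
      seg_pairs[OF symmetric_lamination_pairs(1)[OF M]] by blast+
  have sp: "M \<in> mspace lamination_metric" if M: "symmetric_lamination M" for M
    using seg_image_in_space[OF p(1-3)[OF M]] unfolding p(4)[OF M] .
  then show "{L. symmetric_lamination L} \<subseteq> mspace lamination_metric" by blast
  fix L :: "nat \<Rightarrow> complex set set" assume "range L \<subseteq> {L. symmetric_lamination L}"
  then have L: "symmetric_lamination (L n)" for n by blast
  obtain r K where rK: "strict_mono r" "symmetric_lamination K" "set_lim (\<lambda>n. pairs (L (r n))) (pairs K)"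
    by (rule symmetric_lamination_subseq[OF L])
  have "limitin lamination_space.mtopology (L \<circ> r) K sequentially"
    unfolding lamination_space.limitin_metric
  proof (intro conjI allI impI)
    show "K \<in> mspace lamination_metric" using sp rK(2) .
    fix e :: real assume "0 < e"
    then have "0 < e/2" by simp
    then obtain N where N: "\<forall>n\<ge>N. (\<forall>x\<in>pairs (L (r n)). \<exists>y\<in>pairs K. dist x y < e/2) \<and>
        (\<forall>y\<in>pairs K. \<exists>x\<in>pairs (L (r n)). dist x y < e/2)"
      using rK(3) unfolding set_lim_def by blast
    have "(L \<circ> r) n \<in> mspace lamination_metric \<and> mdist lamination_metric ((L \<circ> r) n) K < e" if "n \<ge> N" for n
    proof
      show "(L \<circ> r) n \<in> mspace lamination_metric" using sp L by simp
      have "mdist lamination_metric (seg ` pairs (L (r n))) (seg ` pairs K) \<le> e/2"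
      proof (rule mdist_seg_image)
        show "\<exists>y\<in>pairs K. dist x y \<le> e/2" if "x \<in> pairs (L (r n))" for x
          using N \<open>n \<ge> N\<close> that less_imp_le by blast
        show "\<exists>x\<in>pairs (L (r n)). dist x y \<le> e/2" if "y \<in> pairs K" for y
          using N \<open>n \<ge> N\<close> that less_imp_le by blast
      qed (rule p(1-3)[OF L] p(1-3)[OF rK(2)])+
      then show "mdist lamination_metric ((L \<circ> r) n) K < e" using p(4)[OF L] p(4)[OF rK(2)] \<open>0 < e\<close> by simp
    qed
    then show "eventually (\<lambda>n. (L \<circ> r) n \<in> mspace lamination_metric \<and>
        mdist lamination_metric ((L \<circ> r) n) K < e) sequentially"
      unfolding eventually_sequentially by blast
  qed
  then show "\<exists>l r. l \<in> {L. symmetric_lamination L} \<and> strict_mono r \<and>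
      limitin lamination_space.mtopology (L \<circ> r) l sequentially"
    using rK by blast
qed

section \<open>Comajors\<close>

lemma arc_dist_commute: "arc_dist s t = arc_dist t s"
  by (simp add: arc_dist_def min.commute)

lemma arc_dist_eqI:
  assumes "t - s - d \<in> \<int>" "0 \<le> d" "d \<le> 1/2" shows "arc_dist s t = d"
proof (cases "d = 0")
  case True
  then have "frac (t - s) = 0" using assms by (intro frac_eqI) auto
  then show ?thesis using True frac_ge_0[of "s - t"] unfolding arc_dist_def by linarith
next
  case False
  have "frac (t - s) = d" using assms by (intro frac_eqI) auto
  moreover have "frac (s - t) = 1 - d"
  proof (rule frac_eqI)
    have "s - t - (1 - d) = - (t - s - d) - 1" by simp
    then show "s - t - (1 - d) \<in> \<int>" using assms(1) by (metis Ints_1 Ints_diff Ints_minus)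
  qed (use assms False in auto)
  ultimately show ?thesis using assms by (simp add: arc_dist_def)
qed

lemma chord_length_eqI:
  "t - s - d \<in> \<int> \<Longrightarrow> 0 \<le> d \<Longrightarrow> d \<le> 1/2 \<Longrightarrow> chord_length (chord s t) = d"
  "s - t - d \<in> \<int> \<Longrightarrow> 0 \<le> d \<Longrightarrow> d \<le> 1/2 \<Longrightarrow> chord_length (chord s t) = d"
  using arc_dist_eqI arc_dist_commute by (metis chord_length_chord)+

lemma chord_commute: "chord s t = chord t s"
  by (simp add: chord_def closed_segment_commute)

lemma chord_normal_form:
  assumes "l \<in> chords"
  obtains p d where "0 \<le> d" "d \<le> 1/2" "l = chord p (p + d)" "chord_length l = d"
proof -
  obtain s t where st: "l = chord s t" using assms by (auto simp: chords_def)
  have I: "frac x - x \<in> \<int>" for x :: real by (simp add: frac_def)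
  show thesis
  proof (cases "frac (t - s) \<le> 1/2")
    case True
    have "chord s t = chord s (s + frac (t - s))"
      unfolding chord_eq_iff using Ints_minus[OF I[of "t - s"]] by (simp add: algebra_simps)
    then show thesis using that[of "frac (t - s)" s] True st chord_length_eqI(1)[of "s + frac (t - s)" s] by simp
  next
    case False
    let ?d = "1 - frac (t - s)"
    have "s - (t + ?d) = (frac (t - s) - (t - s)) - 1" by simp
    then have "s - (t + ?d) \<in> \<int>" using I by (metis Ints_1 Ints_diff)
    then have "chord s t = chord t (t + ?d)" unfolding chord_eq_iff by simp
    then show thesis
      using that[of ?d t] False st frac_lt_1[of "t - s"] chord_length_eqI(1)[of "t + ?d" t ?d] by simp
  qed
qed

lemma chord_length_bounds: "l \<in> chords \<Longrightarrow> 0 \<le> chord_length l \<and> chord_length l \<le> 1/2"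
  by (metis chord_normal_form)

lemma not_Ints: "0 < x \<Longrightarrow> x < 1 \<Longrightarrow> x \<notin> (\<int> :: real set)"
  by (metis Ints_cases of_int_0_less_iff of_int_less_1_iff int_one_le_iff_zero_less linorder_not_less)

lemma degenerate_iff_length: "l \<in> chords \<Longrightarrow> l \<in> degenerate_chords \<longleftrightarrow> chord_length l = 0"
proof -
  assume "l \<in> chords"
  then obtain p d where d: "0 \<le> d" "d \<le> 1/2" "l = chord p (p + d)" "chord_length l = d"
    by (rule chord_normal_form)
  have "l \<in> degenerate_chords \<longleftrightarrow> d \<in> \<int>" unfolding d(3) degenerate_chord_iff by simp
  also have "\<dots> \<longleftrightarrow> d = 0" using d not_Ints[of d] by (cases "d = 0") auto
  finally show ?thesis using d(4) by simp
qed

text \<open>The image length is the distance from \<open>3 * d\<close> to the nearest integer, where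
  \<open>d\<close> is the length of \<open>l\<close>; beyond \<open>1/6\<close> that integer is 1.
  There it equals three times the distance of \<open>d\<close> from \<open>1/3\<close>.\<close>

lemma chord_length_sigma3:
  assumes "l \<in> chords"
  shows "chord_length (sigma3 l) =
    (if chord_length l \<le> 1/6 then 3 * chord_length l else \<bar>3 * chord_length l - 1\<bar>)"
proof -
  obtain p d where d: "0 \<le> d" "d \<le> 1/2" "l = chord p (p + d)" "chord_length l = d"
    using assms by (rule chord_normal_form)
  consider "d \<le> 1/6" | "1/6 < d" "d \<le> 1/3" | "1/3 < d" by linarith
  then show ?thesis
  proof cases
    case 1
    then show ?thesis unfolding d(3) sigma3_chord using d by (subst chord_length_eqI(1)[of _ _ "3 * d"]) auto
  next
    case 2
    have "3 * p - 3 * (p + d) - (1 - 3 * d) = - 1" by simp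
    then have "3 * p - 3 * (p + d) - (1 - 3 * d) \<in> \<int>" by simp
    then show ?thesis using d 2 chord_length_eqI(2)[of "3 * p" "3 * (p + d)" "1 - 3 * d"]
      by (simp add: d(3) sigma3_chord)
  next
    case 3
    have "3 * (p + d) - 3 * p - (3 * d - 1) = 1" by simp
    then have "3 * (p + d) - 3 * p - (3 * d - 1) \<in> \<int>" by simp
    then show ?thesis using d 3 chord_length_eqI(1)[of "3 * (p + d)" "3 * p" "3 * d - 1"]
      by (simp add: d(3) sigma3_chord)
  qed
qed

lemma symmetric_laminationD:
  assumes "symmetric_lamination L"
  shows "lamination L" "L \<subseteq> chords" "degenerate_chords \<subseteq> L"
    "\<And>l m. l \<in> L \<Longrightarrow> m \<in> L \<Longrightarrow> \<not> cross l m" "\<And>l. l \<in> L \<Longrightarrow> sigma3 l \<in> L" "\<And>l. l \<in> L \<Longrightarrow> uminus ` l \<in> L"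
proof -
  have cub: "cubic_lamination L" and sym: "\<forall>l\<in>L. uminus ` l \<in> L"
    using assms by (simp_all add: symmetric_lamination_def)
  show lam: "lamination L" using cub by (simp add: cubic_lamination_def)
  show "L \<subseteq> chords" and deg: "degenerate_chords \<subseteq> L" using lam by (simp_all add: lamination_def)
  show "\<not> cross l m" if "l \<in> L" "m \<in> L" for l m using lam that by (simp add: lamination_def)
  have "sigma3 l \<in> L \<or> sigma3 l \<in> degenerate_chords" if "l \<in> L" for l
    using cub that by (simp add: cubic_lamination_def)
  then show "sigma3 l \<in> L" if "l \<in> L" for l using that deg by blast
  show "uminus ` l \<in> L" if "l \<in> L" for l using sym that by blast
qed

text \<open>Lengths below \<open>1/6\<close> are tripled by \<open>sigma3\<close>, which cannot go
  on forever. Consequently no major is shorter than \<open>1/6\<close>.\<close>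

lemma exists_long_leaf:
  assumes L: "symmetric_lamination L" and l: "l \<in> L" "l \<notin> degenerate_chords"
  shows "\<exists>m\<in>L. m \<notin> degenerate_chords \<and> 1/6 \<le> chord_length m"
proof (rule ccontr)
  assume con: "\<not> ?thesis"
  note LD = symmetric_laminationD[OF L]
  have short: "chord_length m < 1/6" if "m \<in> L" for m
    using con that degenerate_iff_length[of m] LD(2) by force
  have "\<exists>m\<in>L. chord_length m = 3 ^ n * chord_length l" for n
  proof (induction n)
    case (Suc n)
    then obtain m where m: "m \<in> L" "chord_length m = 3 ^ n * chord_length l" by blast
    then have "chord_length (sigma3 m) = 3 ^ Suc n * chord_length l"
      using chord_length_sigma3[of m] short[OF m(1)] LD(2) by auto
    then show ?case using LD(5)[OF m(1)] by blast
  qed (use l in auto)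
  moreover have pos: "0 < chord_length l"
    using chord_length_bounds[of l] degenerate_iff_length[of l] l LD(2) by force
  obtain n where "1 / chord_length l < 3 ^ n" using real_arch_pow[of 3 "1 / chord_length l"] by auto
  then have "1 < 3 ^ n * chord_length l" using pos by (simp add: field_simps)
  ultimately show False using short by (smt (verit, best) divide_le_eq_1)
qed

text \<open>A nondegenerate comajor \<open>c\<close> with endpoints \<open>p\<close> and \<open>p + s\<close> determines its triple: the two
  longer leaves have lengths \<open>1/3 + s\<close> and \<open>1/3 - s\<close>, and both are majors.\<close>

definition comajor_at :: "complex set set \<Rightarrow> real \<Rightarrow> real \<Rightarrow> bool" where
  "comajor_at L p s \<longleftrightarrow> 0 < s \<and> s \<le> 1/6 \<and> chord p (p + s) \<in> L \<and>
     chord (p + 1/3) (p + s + 2/3) \<in> L \<and> chord (p + s + 1/3) (p + 2/3) \<in> L \<and>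
     (\<forall>l\<in>L. l \<notin> degenerate_chords \<longrightarrow> s \<le> \<bar>chord_length l - 1/3\<bar>)"

lemma circle_pt_cube: "circle_pt t ^ 3 = circle_pt (3 * t)"
  by (simp add: circle_pt_def power3_eq_cube cis_mult)

lemma cube_twins_circle_pt:
  assumes "norm z = 1"
  shows "cube_twins (circle_pt p) z \<longleftrightarrow> z = circle_pt (p + 1/3) \<or> z = circle_pt (p + 2/3)"
proof
  obtain t where t: "z = circle_pt t" using assms circle_pt_cases by metis
  assume "cube_twins (circle_pt p) z"
  then have *: "circle_pt p ^ 3 = z ^ 3" "circle_pt p \<noteq> z"
    using cube_twins_iff[of "circle_pt p" z] norm_circle_pt[of p] by (metis norm_zero zero_neq_one)+
  then obtain k where k: "3 * t - 3 * p = of_int k"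
    unfolding t circle_pt_cube circle_pt_eq_iff by (metis Ints_cases Ints_minus minus_diff_eq)
  have "k = 3 * (k div 3) + k mod 3" by simp
  then have "t - p = of_int (k div 3) + of_int (k mod 3) / 3"
    using k by (metis (no_types, opaque_lifting) add_divide_distrib mult.commute nonzero_mult_div_cancel_left of_int_add of_int_mult of_int_numeral right_diff_distrib' zero_neq_numeral)
  then have z: "z = circle_pt (p + of_int (k mod 3) / 3)"
    unfolding t circle_pt_eq_iff by (simp add: algebra_simps)
  have "k mod 3 \<in> {0, 1, 2}" by auto
  then show "z = circle_pt (p + 1/3) \<or> z = circle_pt (p + 2/3)" using z *(2) by auto
next
  assume "z = circle_pt (p + 1/3) \<or> z = circle_pt (p + 2/3)"
  then obtain j :: real where j: "j = 1 \<or> j = 2" "z = circle_pt (p + j/3)" by auto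
  have "circle_pt p ^ 3 = z ^ 3" unfolding j(2) circle_pt_cube circle_pt_eq_iff using j(1) by auto
  moreover have "circle_pt (p + j/3) \<noteq> circle_pt p" unfolding circle_pt_eq_iff using j(1) not_Ints[of "j/3"] by auto
  ultimately show "cube_twins (circle_pt p) z"
    using cube_twins_iff[of "circle_pt p" z] j(2) norm_circle_pt[of p] by (metis norm_zero zero_neq_one)
qed

lemma cube_twins_sym: "cube_twins a b \<longleftrightarrow> cube_twins b a"
  by (simp add: cube_twins_def algebra_simps)

lemma chord_seg: "chord s t = seg (circle_pt s, circle_pt t)"
  by (simp add: chord_def seg_def)

text \<open>The endpoints of a sibling arise from those of \<open>c\<close> by shifts of
  \<open>1/3\<close> or \<open>2/3\<close>. Equal shifts give length \<open>s\<close>, too short for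
  a major, so \<open>M\<close> uses different shifts. The remaining leaf then uses the opposite
  ones, which yields the lengths \<open>1/3 + s\<close> and \<open>1/3 - s\<close>.\<close>

lemma comajor_imp_comajor_at:
  assumes L: "symmetric_lamination L" and c: "comajor L c" "c \<notin> degenerate_chords"
  obtains p s where "comajor_at L p s" "c = chord p (p + s)"
proof -
  note LD = symmetric_laminationD[OF L]
  obtain M where M: "major L M" and Mc: "if chord_length M = 1/3
        then c \<in> degenerate_chords \<and> sigma3 c = sigma3 M \<and> c \<inter> M = {}
        else \<exists>T. sibling_triple L T \<and> M \<in> T \<and> c \<in> T \<and> c \<noteq> M \<and>
               (chord_length c < 1/6 \<or> chord_length c = 1/6 \<and> chord_length M = 1/2)"
    using c(1) unfolding comajor_def by blast
  obtain T where T: "sibling_triple L T" "M \<in> T" "c \<in> T" "c \<noteq> M"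
    and len: "chord_length c < 1/6 \<or> chord_length c = 1/6 \<and> chord_length M = 1/2"
    using Mc c(2) by (auto split: if_splits)
  have TL: "T \<subseteq> L" using T(1) by (simp add: sibling_triple_def)
  then have cC: "c \<in> chords" using T(3) LD(2) by blast
  then obtain p s where ps: "0 \<le> s" "s \<le> 1/2" "c = chord p (p + s)" "chord_length c = s"
    by (rule chord_normal_form)
  have s: "0 < s" "s \<le> 1/6" using ps len degenerate_iff_length[OF cC] c(2) by auto
  let ?P = "(circle_pt p, circle_pt (p + s))"
  have P: "?P \<in> torus" "c = seg ?P" by (simp_all add: ps(3) chord_seg)
  obtain q r where qr: "siblings (pairs L) ?P q r" "M = seg q" "T = {seg ?P, seg q, seg r}"
    by (rule triple_siblings[OF LD(2) T(1) P(1), of M]) (use T P in auto)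
  have tor: "q \<in> torus" "r \<in> torus" and qrL: "seg q \<in> L" "seg r \<in> L"
    using qr(1) by (auto simp: siblings_def pairs_def)
  have n: "norm (fst q) = 1" "norm (snd q) = 1" "norm (fst r) = 1" "norm (snd r) = 1" using tor by auto
  have tw: "cube_twins (circle_pt p) (fst q)" "cube_twins (circle_pt p) (fst r)" "cube_twins (fst q) (fst r)"
    "cube_twins (circle_pt (p + s)) (snd q)" "cube_twins (circle_pt (p + s)) (snd r)" "cube_twins (snd q) (snd r)"
    using qr(1) by (auto simp: siblings_def)
  have ne: "fst q \<noteq> fst r" "snd q \<noteq> snd r"
    using tw(3,6) cube_twins_iff torus_nz[OF tor(1)] torus_nz[OF tor(2)] by blast+
  have f: "fst q = circle_pt (p + 1/3) \<and> fst r = circle_pt (p + 2/3) \<or>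
      fst q = circle_pt (p + 2/3) \<and> fst r = circle_pt (p + 1/3)"
    using tw(1,2) ne(1) unfolding cube_twins_circle_pt[OF n(1)] cube_twins_circle_pt[OF n(3)] by auto
  have g: "snd q = circle_pt (p + s + 1/3) \<and> snd r = circle_pt (p + s + 2/3) \<or>
      snd q = circle_pt (p + s + 2/3) \<and> snd r = circle_pt (p + s + 1/3)"
    using tw(4,5) ne(2) unfolding cube_twins_circle_pt[OF n(2)] cube_twins_circle_pt[OF n(4)] by auto
  have segs: "seg q = chord a b" if "fst q = circle_pt a" "snd q = circle_pt b" for q a b
    unfolding chord_seg using that by (metis prod.collapse)
  have Mmin: "\<bar>chord_length M - 1/3\<bar> \<le> \<bar>chord_length l - 1/3\<bar>" if "l \<in> L" "l \<notin> degenerate_chords" for l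
    using M that unfolding major_def by blast
  \<comment> \<open>The case \<open>s = 1/6\<close> requires \<open>M\<close> to be a diameter, so
    equality leaves only \<open>s < 1/6\<close>. A leaf of length at least \<open>1/6\<close> is
    then closer to \<open>1/3\<close> than \<open>M\<close>.\<close>
  have not_parallel: "chord_length M \<noteq> s"
  proof
    assume Ms: "chord_length M = s"
    then have "s < 1/6" using len ps(4) by auto
    have "c \<in> L" using T(3) TL by blast
    then obtain m where "m \<in> L" "m \<notin> degenerate_chords" "1/6 \<le> chord_length m"
      using exists_long_leaf[OF L] c(2) by blast
    then show False using Mmin[of m] Ms \<open>s < 1/6\<close> chord_length_bounds[of m] LD(2) by force
  qed
  have D: "chord_length (chord (p + 1/3) (p + s + 2/3)) = 1/3 + s"
    and m: "chord_length (chord (p + s + 1/3) (p + 2/3)) = 1/3 - s"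
    using s by (auto intro!: chord_length_eqI(1))
  have par: "chord_length (chord (p + 1/3) (p + s + 1/3)) = s" "chord_length (chord (p + 2/3) (p + s + 2/3)) = s"
    using s by (auto intro!: chord_length_eqI(1))
  have "\<not> (fst q = circle_pt (p + 1/3) \<and> snd q = circle_pt (p + s + 1/3))"
    "\<not> (fst q = circle_pt (p + 2/3) \<and> snd q = circle_pt (p + s + 2/3))"
    using not_parallel segs[of q] par qr(2) by auto
  then have "fst q = circle_pt (p + 1/3) \<and> fst r = circle_pt (p + 2/3) \<and>
        snd q = circle_pt (p + s + 2/3) \<and> snd r = circle_pt (p + s + 1/3) \<or>
      fst q = circle_pt (p + 2/3) \<and> fst r = circle_pt (p + 1/3) \<and>
        snd q = circle_pt (p + s + 1/3) \<and> snd r = circle_pt (p + s + 2/3)"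
    using f g by argo
  then have "chord (p + 1/3) (p + s + 2/3) \<in> L \<and> chord (p + s + 1/3) (p + 2/3) \<in> L \<and>
      \<bar>chord_length M - 1/3\<bar> = s"
  proof
    assume *: "fst q = circle_pt (p + 1/3) \<and> fst r = circle_pt (p + 2/3) \<and>
        snd q = circle_pt (p + s + 2/3) \<and> snd r = circle_pt (p + s + 1/3)"
    then have "seg q = chord (p + 1/3) (p + s + 2/3)" "seg r = chord (p + s + 1/3) (p + 2/3)"
      using segs chord_commute by metis+
    then show ?thesis using qrL qr(2) D s by simp
  next
    assume *: "fst q = circle_pt (p + 2/3) \<and> fst r = circle_pt (p + 1/3) \<and>
        snd q = circle_pt (p + s + 1/3) \<and> snd r = circle_pt (p + s + 2/3)"
    then have "seg q = chord (p + s + 1/3) (p + 2/3)" "seg r = chord (p + 1/3) (p + s + 2/3)"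
      using segs chord_commute by metis+
    then show ?thesis using qrL qr(2) m s by simp
  qed
  then have "comajor_at L p s" unfolding comajor_at_def using s Mmin T(3) TL ps(3) by auto
  then show thesis using that ps(3) by blast
qed

text \<open>The leaf of length \<open>1/3 + s\<close> is taken as the major: for
  \<open>s = 1/6\<close> it is the diameter that \<open>comajor\<close> asks for in this
  case.\<close>

lemma comajor_at_imp_comajor:
  assumes L: "symmetric_lamination L" and ps: "comajor_at L p s"
  shows "comajor L (chord p (p + s))" "chord p (p + s) \<notin> degenerate_chords"
proof -
  note LD = symmetric_laminationD[OF L]
  let ?c = "chord p (p + s)" and ?D = "chord (p + 1/3) (p + s + 2/3)" and ?m = "chord (p + s + 1/3) (p + 2/3)"
  have s: "0 < s" "s \<le> 1/6" and mem: "?c \<in> L" "?D \<in> L" "?m \<in> L"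
    and min: "\<And>l. l \<in> L \<Longrightarrow> l \<notin> degenerate_chords \<Longrightarrow> s \<le> \<bar>chord_length l - 1/3\<bar>"
    using ps by (auto simp: comajor_at_def)
  show nd: "?c \<notin> degenerate_chords"
    unfolding degenerate_chord_iff using not_Ints[of s] s Ints_minus[of "- s"] by auto
  have lc: "chord_length ?c = s" and lD: "chord_length ?D = 1/3 + s"
    using s by (auto intro!: chord_length_eqI(1))
  let ?P = "(circle_pt p, circle_pt (p + s))" and ?Q = "(circle_pt (p + 1/3), circle_pt (p + s + 2/3))"
    and ?R = "(circle_pt (p + 2/3), circle_pt (p + s + 1/3))"
  have eq: "seg ?P = ?c" "seg ?Q = ?D" "seg ?R = ?m" by (simp_all add: chord_seg seg_swap)
  have tw: "cube_twins (circle_pt a) (circle_pt (a + 1/3))" "cube_twins (circle_pt a) (circle_pt (a + 2/3))"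
    "cube_twins (circle_pt (a + 1/3)) (circle_pt (a + 2/3))" "cube_twins (circle_pt (a + 2/3)) (circle_pt (a + 1/3))" for a
  proof -
    show "cube_twins (circle_pt a) (circle_pt (a + 1/3))" "cube_twins (circle_pt a) (circle_pt (a + 2/3))"
      by (simp_all add: cube_twins_circle_pt)
    have "a + 1/3 + 1/3 = a + 2/3" by simp
    then show "cube_twins (circle_pt (a + 1/3)) (circle_pt (a + 2/3))"
      by (metis cube_twins_circle_pt norm_circle_pt)
    then show "cube_twins (circle_pt (a + 2/3)) (circle_pt (a + 1/3))" using cube_twins_sym by blast
  qed
  have "?P \<in> pairs L" "?Q \<in> pairs L" "?R \<in> pairs L" using mem eq by (simp_all add: pairs_def)
  then have sib: "siblings (pairs L) ?P ?Q ?R" unfolding siblings_def using tw by simp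
  have "fst ?P ^ 3 \<noteq> snd ?P ^ 3"
    using s not_Ints[of "3 * s"] Ints_minus[of "- (3 * s)"]
    by (auto simp: circle_pt_cube circle_pt_eq_iff algebra_simps)
  then have "sibling_triple L {seg ?P, seg ?Q, seg ?R}" "seg ?P \<noteq> seg ?Q"
    using siblings_triple[OF LD(4) sib] by blast+
  then have T: "sibling_triple L {?c, ?D, ?m}" "?c \<noteq> ?D" unfolding eq .
  have "?D \<notin> degenerate_chords" using degenerate_iff_length[of ?D] lD s mem LD(2) by auto
  then have "major L ?D" unfolding major_def using mem lD s min by auto
  moreover have "chord_length ?D \<noteq> 1/3" using lD s by simp
  moreover have "chord_length ?c < 1/6 \<or> chord_length ?c = 1/6 \<and> chord_length ?D = 1/2" using lc lD s by auto
  ultimately show "comajor L ?c" unfolding comajor_def using T by (intro exI[of _ ?D]) auto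
qed

section \<open>Limits of comajors\<close>

text \<open>A chord spanning an arc of length \<open>d\<close> has Euclidean length
  \<open>2 * sin (pi * d)\<close>. In this form the length is visibly continuous in the
  endpoints.\<close>

lemma chord_length_seg:
  assumes "p \<in> torus"
  shows "chord_length (seg p) = arcsin (dist (fst p) (snd p) / 2) / pi"
proof -
  have "seg p \<in> chords" using assms chords_eq by blast
  then obtain t d where d: "0 \<le> d" "d \<le> 1/2" "seg p = chord t (t + d)" "chord_length (seg p) = d"
    by (rule chord_normal_form)
  have "dist (fst p) (snd p) = dist (circle_pt t) (circle_pt (t + d))"
    using d(3) unfolding chord_seg seg_eq_iff by (auto simp: dist_commute)
  also have "\<dots> = 2 * \<bar>sin (pi * d)\<bar>"
    unfolding dist_norm circle_pt_diff by (simp add: norm_mult)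
  also have "\<dots> = 2 * sin (pi * d)"
    using d sin_ge_zero[of "pi * d"] by (simp add: mult_left_le)
  finally have "dist (fst p) (snd p) / 2 = sin (pi * d)" by simp
  moreover have "arcsin (sin (pi * d)) = pi * d"
  proof (rule arcsin_sin)
    show "- (pi / 2) \<le> pi * d" using d by (smt (verit) mult_nonneg_nonneg pi_ge_zero pi_half_ge_zero)
    show "pi * d \<le> pi / 2" using d mult_left_mono[of d "1/2" pi] by simp
  qed
  ultimately show ?thesis using d(4) by simp
qed

lemma chord_length_tendsto:
  assumes "\<And>n. x n \<in> torus" "q \<in> torus" "x \<longlonglongrightarrow> q"
  shows "(\<lambda>n. chord_length (seg (x n))) \<longlonglongrightarrow> chord_length (seg q)"
proof -
  have b: "dist (fst p) (snd p) / 2 \<in> {-1..1}" if "p \<in> torus" for p :: "complex \<times> complex"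
  proof -
    have n: "norm (fst p) = 1" "norm (snd p) = 1" using that by auto
    have "dist (fst p) (snd p) \<le> norm (fst p) + norm (snd p)" unfolding dist_norm by (rule norm_triangle_ineq4)
    then show ?thesis using n zero_le_dist[of "fst p" "snd p"] unfolding atLeastAtMost_iff by linarith
  qed
  have "(\<lambda>n. dist (fst (x n)) (snd (x n)) / 2) \<longlonglongrightarrow> dist (fst q) (snd q) / 2"
    by (intro tendsto_intros assms) simp
  from continuous_on_tendsto_compose[OF continuous_on_arcsin' this b[OF assms(2)]]
  have "(\<lambda>n. arcsin (dist (fst (x n)) (snd (x n)) / 2)) \<longlonglongrightarrow> arcsin (dist (fst q) (snd q) / 2)"
    using b[OF assms(1)] by simp
  then have "(\<lambda>n. arcsin (dist (fst (x n)) (snd (x n)) / 2) / pi) \<longlonglongrightarrow> arcsin (dist (fst q) (snd q) / 2) / pi"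
    by (intro tendsto_intros) simp_all
  then show ?thesis using chord_length_seg assms by simp
qed

lemma circle_pt_tendsto: "(x \<longlongrightarrow> a) F \<Longrightarrow> ((\<lambda>n. circle_pt (x n)) \<longlongrightarrow> circle_pt a) F"
  unfolding circle_pt_def cis_conv_exp by (intro tendsto_intros)

text \<open>All conditions are closed except positivity of the length, which \<open>0 < b\<close>
  supplies. For the minimality, a nondegenerate leaf of \<open>K\<close> is a limit of leaves that
  are nondegenerate from some index on.\<close>

lemma comajor_at_limit:
  assumes K: "symmetric_lamination K" and lim: "set_lim (\<lambda>n. pairs (L n)) (pairs K)"
    and p: "p \<longlonglongrightarrow> a" and s: "s \<longlonglongrightarrow> b" and c: "\<And>n. comajor_at (L n) (p n) (s n)" and b: "0 < b"
  shows "comajor_at K a b"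
proof -
  have id: "strict_mono (id :: nat \<Rightarrow> nat)" by (simp add: strict_mono_def)
  have chord_lim: "chord u w \<in> K" if "x \<longlonglongrightarrow> u" "y \<longlonglongrightarrow> w" "\<And>n. chord (x n) (y n) \<in> L n" for x y u w
  proof -
    have "(\<lambda>n. (circle_pt (x n), circle_pt (y n))) \<longlonglongrightarrow> (circle_pt u, circle_pt w)"
      by (intro tendsto_Pair circle_pt_tendsto that)
    moreover have "(circle_pt (x n), circle_pt (y n)) \<in> pairs (L n)" for n
      using that(3)[of n] by (simp add: pairs_def chord_seg)
    ultimately have "(circle_pt u, circle_pt w) \<in> pairs K"
      using set_lim_mem[OF lim id, of "\<lambda>n. (circle_pt (x n), circle_pt (y n))"] by simp
    then show ?thesis by (simp add: pairs_def chord_seg)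
  qed
  have cs: "0 < s n" "s n \<le> 1/6" "chord (p n) (p n + s n) \<in> L n"
     "chord (p n + 1/3) (p n + s n + 2/3) \<in> L n" "chord (p n + s n + 1/3) (p n + 2/3) \<in> L n"
     "l \<in> L n \<Longrightarrow> l \<notin> degenerate_chords \<Longrightarrow> s n \<le> \<bar>chord_length l - 1/3\<bar>" for n l
    using c[of n] unfolding comajor_at_def by blast+
  have "b \<le> 1/6" by (rule LIMSEQ_le_const2[OF s]) (use cs(2) in blast)
  moreover have "chord a (a + b) \<in> K" by (rule chord_lim[OF _ _ cs(3)]) (intro tendsto_intros p s)+
  moreover have "chord (a + 1/3) (a + b + 2/3) \<in> K"
    by (rule chord_lim[OF _ _ cs(4)]) (intro tendsto_intros p s)+
  moreover have "chord (a + b + 1/3) (a + 2/3) \<in> K"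
    by (rule chord_lim[OF _ _ cs(5)]) (intro tendsto_intros p s)+
  moreover have "b \<le> \<bar>chord_length l - 1/3\<bar>" if l: "l \<in> K" "l \<notin> degenerate_chords" for l
  proof -
    have "l \<in> seg ` torus" using l(1) symmetric_laminationD(2)[OF K] chords_eq by blast
    then obtain q where q: "q \<in> torus" "l = seg q" by blast
    then have "q \<in> pairs K" using l(1) by (simp add: pairs_def)
    then obtain x where x: "\<And>n. x n \<in> pairs (L n)" "x \<longlonglongrightarrow> q" using set_lim_approx[OF lim] by blast
    have xt: "x n \<in> torus" "seg (x n) \<in> L n" for n using x(1)[of n] by (simp_all add: pairs_def)
    have ne: "fst q - snd q \<noteq> 0" using l(2) q seg_degenerate by simp
    have "(\<lambda>n. fst (x n) - snd (x n)) \<longlonglongrightarrow> fst q - snd q" by (intro tendsto_intros x)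
    from tendsto_imp_eventually_ne[OF this ne] have "eventually (\<lambda>n. fst (x n) - snd (x n) \<noteq> 0) sequentially"
      .
    then have "eventually (\<lambda>n. s n \<le> \<bar>chord_length (seg (x n)) - 1/3\<bar>) sequentially"
    proof eventually_elim
      case (elim n)
      then have "seg (x n) \<notin> degenerate_chords" using seg_degenerate[OF xt(1)] by simp
      then show ?case using cs(6) xt(2) by blast
    qed
    moreover have "(\<lambda>n. \<bar>chord_length (seg (x n)) - 1/3\<bar>) \<longlonglongrightarrow> \<bar>chord_length (seg q) - 1/3\<bar>"
      by (intro tendsto_intros chord_length_tendsto xt(1) q(1) x(2))
    ultimately show ?thesis
      using tendsto_le[OF sequentially_bot _ s] q(2) by blast
  qed
  ultimately show ?thesis using b unfolding comajor_at_def by blast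
qed

lemma comajor_at_add_int:
  assumes "comajor_at L p s" shows "comajor_at L (p + of_int k) s"
proof -
  have e: "chord (p + of_int k) (p + of_int k + s) = chord p (p + s)"
    "chord (p + of_int k + 1/3) (p + of_int k + s + 2/3) = chord (p + 1/3) (p + s + 2/3)"
    "chord (p + of_int k + s + 1/3) (p + of_int k + 2/3) = chord (p + s + 1/3) (p + 2/3)"
    by (simp_all add: chord_eq_iff)
  show ?thesis using assms unfolding comajor_at_def e .
qed

definition comajor_union :: "complex set set" where
  "comajor_union = {c. c \<notin> degenerate_chords \<and> (\<exists>L. symmetric_lamination L \<and> comajor L c)} \<union> degenerate_chords"

text \<open>A point of the union is coded by the start of a comajor, its length and a position along
  the chord, which range over a compact box; length 0 codes points of the circle. If the limit
  length is positive, the laminations subconverge as well.\<close>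

lemma closed_comajor_union: "closed (\<Union>comajor_union)"
  unfolding closed_sequential_limits
proof (intro allI impI, elim conjE)
  fix z l assume z: "\<forall>n. z n \<in> \<Union>comajor_union" "z \<longlonglongrightarrow> l"
  have ex: "\<exists>x. fst x \<in> {0..1} \<and> fst (snd x) \<in> {0..1/6} \<and> snd (snd x) \<in> {0..1} \<and>
      (fst (snd x) = 0 \<or> (\<exists>L. symmetric_lamination L \<and> comajor_at L (fst x) (fst (snd x)))) \<and>
      z n = (1 - snd (snd x)) *\<^sub>R circle_pt (fst x) + snd (snd x) *\<^sub>R circle_pt (fst x + fst (snd x))"
    (is "\<exists>x. ?P n x") for n
  proof -
    obtain c where c: "c \<in> comajor_union" "z n \<in> c" using z(1) by blast
    have "\<exists>p s. (s = 0 \<or> (\<exists>L. symmetric_lamination L \<and> comajor_at L p s)) \<and> 0 \<le> s \<and> s \<le> 1/6 \<and> c = chord p (p + s)"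
    proof (cases "c \<in> degenerate_chords")
      case True
      then obtain t where "c = {circle_pt t}" by (auto simp: degenerate_chords_def)
      then have "c = chord t (t + 0)" by (simp add: chord_def)
      then show ?thesis by force
    next
      case False
      then obtain L where "symmetric_lamination L" "comajor L c" using c(1) by (auto simp: comajor_union_def)
      moreover from this False obtain p s where "comajor_at L p s" "c = chord p (p + s)"
        by (rule comajor_imp_comajor_at)
      moreover from this have "0 \<le> s" "s \<le> 1/6" by (auto simp: comajor_at_def)
      ultimately show ?thesis by blast
    qed
    then obtain p s where ps: "s = 0 \<or> (\<exists>L. symmetric_lamination L \<and> comajor_at L p s)" "0 \<le> s" "s \<le> 1/6"
        "c = chord p (p + s)" by blast
    have f: "frac p = p + of_int (- \<lfloor>p\<rfloor>)" by (simp add: frac_def)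
    have sL: "s = 0 \<or> (\<exists>L. symmetric_lamination L \<and> comajor_at L (frac p) s)"
      using ps(1) comajor_at_add_int unfolding f by blast
    have "c = chord (frac p) (frac p + s)"
      unfolding ps(4) chord_eq_iff by (simp add: frac_def)
    then have "z n \<in> chord (frac p) (frac p + s)" using c(2) by simp
    then obtain u where "0 \<le> u" "u \<le> 1" "z n = (1 - u) *\<^sub>R circle_pt (frac p) + u *\<^sub>R circle_pt (frac p + s)"
      unfolding chord_def in_segment by blast
    then show ?thesis
      using ps(2,3) sL by (intro exI[of _ "(frac p, s, u)"]) (simp add: less_imp_le[OF frac_lt_1])
  qed
  then have "\<exists>x. \<forall>n. ?P n (x n)" by (intro choice allI)
  then obtain x where x: "\<And>n. ?P n (x n)" by blast
  have "x n \<in> {0..1} \<times> {0..1/6} \<times> {0..1}" for n using x[of n] by (cases "x n") auto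
  moreover have "compact ({0..1} \<times> {0..1/6} \<times> {0..1} :: (real \<times> real \<times> real) set)"
    by (intro compact_Times compact_Icc)
  ultimately obtain q r where "q \<in> {0..1} \<times> {0..1/6} \<times> {0..1}" and r: "strict_mono r" "(x \<circ> r) \<longlonglongrightarrow> q"
    by (metis (no_types, lifting) compact_subseq)
  define p s u where "p n = fst (x (r n))" and "s n = fst (snd (x (r n)))" and "u n = snd (snd (x (r n)))" for n
  obtain a b w where q: "q = (a, b, w)" by (cases q)
  have pa: "p \<longlonglongrightarrow> a" using tendsto_fst[OF r(2)] by (simp add: p_def[abs_def] q o_def)
  have sb: "s \<longlonglongrightarrow> b" using tendsto_fst[OF tendsto_snd[OF r(2)]] by (simp add: s_def[abs_def] q o_def)
  have uw: "u \<longlonglongrightarrow> w" using tendsto_snd[OF tendsto_snd[OF r(2)]] by (simp add: u_def[abs_def] q o_def)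
  have s01: "0 \<le> s n" "0 \<le> u n" "u n \<le> 1" for n using x[of "r n"] by (auto simp: s_def u_def)
  have "0 \<le> b" by (rule LIMSEQ_le_const[OF sb]) (use s01 in blast)
  have w01: "0 \<le> w" "w \<le> 1"
    by (rule LIMSEQ_le_const[OF uw], use s01 in blast) (rule LIMSEQ_le_const2[OF uw], use s01 in blast)
  have "(\<lambda>n. z (r n)) \<longlonglongrightarrow> l" using LIMSEQ_subseq_LIMSEQ[OF z(2) r(1)] by (simp add: o_def)
  moreover have "z (r n) = (1 - u n) *\<^sub>R circle_pt (p n) + u n *\<^sub>R circle_pt (p n + s n)" for n
    using x[of "r n"] by (simp add: p_def s_def u_def)
  moreover have "(\<lambda>n. (1 - u n) *\<^sub>R circle_pt (p n) + u n *\<^sub>R circle_pt (p n + s n))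
      \<longlonglongrightarrow> (1 - w) *\<^sub>R circle_pt a + w *\<^sub>R circle_pt (a + b)"
    by (intro tendsto_intros circle_pt_tendsto pa sb uw)
  ultimately have "l = (1 - w) *\<^sub>R circle_pt a + w *\<^sub>R circle_pt (a + b)"
    using LIMSEQ_unique by simp
  then have l: "l \<in> chord a (a + b)" using w01 unfolding chord_def in_segment by blast
  have "chord a (a + b) \<in> comajor_union"
  proof (cases "b = 0")
    case True
    then have "chord a (a + b) \<in> degenerate_chords" unfolding degenerate_chord_iff by simp
    then show ?thesis by (simp add: comajor_union_def)
  next
    case False
    then have b: "0 < b" using \<open>0 \<le> b\<close> by simp
    then obtain N where N: "\<And>n. n \<ge> N \<Longrightarrow> 0 < s n"
      using order_tendstoD(1)[OF sb b] unfolding eventually_sequentially by blast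
    have "\<exists>L. symmetric_lamination L \<and> comajor_at L (p (n + N)) (s (n + N))" for n
      using x[of "r (n + N)"] N[of "n + N"] by (simp add: p_def s_def)
    then obtain L where L: "\<And>n. symmetric_lamination (L n)" "\<And>n. comajor_at (L n) (p (n + N)) (s (n + N))"
      by metis
    obtain r' K where K: "strict_mono r'" "symmetric_lamination K" "set_lim (\<lambda>n. pairs (L (r' n))) (pairs K)"
      by (rule symmetric_lamination_subseq[OF L(1)])
    have rN: "strict_mono (\<lambda>n. r' n + N)" using K(1) by (simp add: strict_mono_def)
    have "comajor_at K a b"
    proof (rule comajor_at_limit[OF K(2,3) _ _ L(2) b])
      show "(\<lambda>n. p (r' n + N)) \<longlonglongrightarrow> a" using LIMSEQ_subseq_LIMSEQ[OF pa rN] by (simp add: o_def)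
      show "(\<lambda>n. s (r' n + N)) \<longlonglongrightarrow> b" using LIMSEQ_subseq_LIMSEQ[OF sb rN] by (simp add: o_def)
    qed
    from comajor_at_imp_comajor[OF K(2) this] show ?thesis using K(2) by (auto simp: comajor_union_def)
  qed
  then show "l \<in> \<Union>comajor_union" using l by blast
qed

section \<open>Comajors do not cross\<close>

text \<open>The circle is rotated so that the endpoints of the two majors of length \<open>1/3 \<plusminus> s\<close> and of
  their negatives get the coordinates below; \<open>x\<close> and \<open>y\<close> are the endpoints of a leaf.\<close>

locale long_leaf =
  fixes s x y :: real
  assumes s: "0 < s" "s \<le> 1/6" and x: "0 \<le> x" "x < 1" and y: "0 \<le> y" "y < 1"
    and n1: "\<not> (0 < x \<and> x < 1/3 - s \<and> 1/3 - s < y)" "\<not> (0 < y \<and> y < 1/3 - s \<and> 1/3 - s < x)"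
    and n2: "\<not> (1/3 < x \<and> x < 1 - s \<and> (y < 1/3 \<or> 1 - s < y))" "\<not> (1/3 < y \<and> y < 1 - s \<and> (x < 1/3 \<or> 1 - s < x))"
    and n3: "\<not> (1/2 < x \<and> x < 5/6 - s \<and> (y < 1/2 \<or> 5/6 - s < y))" "\<not> (1/2 < y \<and> y < 5/6 - s \<and> (x < 1/2 \<or> 5/6 - s < x))"
    and n4: "\<not> (1/2 - s < x \<and> x < 5/6 \<and> (y < 1/2 - s \<or> 5/6 < y))" "\<not> (1/2 - s < y \<and> y < 5/6 \<and> (x < 1/2 - s \<or> 5/6 < x))"
    and l1: "s < \<bar>x - y\<bar>" "\<bar>x - y\<bar> < 1 - s"
    and l2: "\<not> (1/3 - s < \<bar>x - y\<bar> \<and> \<bar>x - y\<bar> < 1/3 + s)" "\<not> (2/3 - s < \<bar>x - y\<bar> \<and> \<bar>x - y\<bar> < 2/3 + s)"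
begin

lemma swap: "long_leaf s y x"
  by unfold_locales (use s x y n1 n2 n3 n4 l1 l2 in \<open>simp_all add: abs_minus_commute\<close>)

lemma dist:
  "\<not> (x - y \<le> s \<and> y - x \<le> s)" "x - y < 1 - s" "y - x < 1 - s"
  "\<not> (1/3 - s < x - y \<and> x - y < 1/3 + s)" "\<not> (1/3 - s < y - x \<and> y - x < 1/3 + s)"
  "\<not> (2/3 - s < x - y \<and> x - y < 2/3 + s)" "\<not> (2/3 - s < y - x \<and> y - x < 2/3 + s)"
  using l1 l2 s by linarith+

text \<open>An end strictly inside a strip forces the other end into the same strip, since leaving
  it would cross a major or its antipode. The length would be at most \<open>s\<close> or strictly
  within \<open>s\<close> of \<open>1/3\<close>.\<close>

lemma piece_nonzero: "piece s x \<noteq> 0"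
proof -
  have False if a: "1/3 - s < x" "x < 1/3"
  proof -
    have "y \<le> 0 \<or> 1/3 - s \<le> y" "y \<le> 1/3 \<or> 1 - s \<le> y" using n1(2) n2(2) a by auto
    \<comment> \<open>The value 0 is the endpoint 1 of the strip arc
      \<open>[1 - s, 1]\<close>.\<close>
    then consider "y = 0" | "1/3 - s \<le> y" "y \<le> 1/3" | "1 - s \<le> y" using y s by linarith
    then show False by cases (use dist a y s in linarith)+
  qed
  moreover have False if a: "1/2 - s < x" "x < 1/2"
  proof -
    have "y \<le> 1/2 \<or> 5/6 - s \<le> y" "1/2 - s \<le> y \<and> y \<le> 5/6" using n3(2) n4(1) a by auto
    then show False using dist a y s by linarith
  qed
  moreover have False if a: "5/6 - s < x" "x < 5/6"
  proof -
    have "y \<le> 1/2 \<or> 5/6 - s \<le> y" "1/2 - s \<le> y \<and> y \<le> 5/6" using n3(2) n4(1) a s by auto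
    then show False using dist a y s by linarith
  qed
  moreover have False if a: "1 - s < x"
  proof -
    have "y \<le> 0 \<or> 1/3 - s \<le> y" "y \<le> 1/3 \<or> 1 - s \<le> y" using n1(2) n2(2) a s by auto
    then consider "y = 0" | "1/3 - s \<le> y" "y \<le> 1/3" | "1 - s \<le> y" using y s by linarith
    then show False by cases (use dist a x y s in linarith)+
  qed
  ultimately show ?thesis using s x unfolding piece_def by fastforce
qed

text \<open>A leaf leaving piece 1 can only join corners of the strip, on account of the chords
  bounding it. The lengths of such leaves are \<open>s\<close> and \<open>1/3\<close>, both
  excluded.\<close>

lemma pieces_1: "x \<le> 1/3 - s \<Longrightarrow> y < 1/3"
proof (rule ccontr)
  assume a: "x \<le> 1/3 - s" "\<not> y < 1/3"
  have "y \<le> 1 - s"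
  proof -
    interpret sw: long_leaf s y x by (rule swap)
    show ?thesis using sw.piece_nonzero y s unfolding piece_def by (auto split: if_splits)
  qed
  have "x = 0 \<or> x = 1/3 - s" using n1(1) a x s by linarith
  moreover have "y = 1/3 \<or> y = 1 - s" using n2(2) a s \<open>y \<le> 1 - s\<close> by linarith
  ultimately show False using dist s by (elim disjE) linarith+
qed

lemma pieces_2_3: "1/3 \<le> x \<Longrightarrow> x \<le> 1/2 - s \<or> 5/6 \<le> x \<Longrightarrow> 1/2 \<le> y \<Longrightarrow> y \<le> 5/6 - s \<Longrightarrow> False"
proof -
  assume a: "1/3 \<le> x" "x \<le> 1/2 - s \<or> 5/6 \<le> x" "1/2 \<le> y" "y \<le> 5/6 - s"
  have "x = 1/2 - s \<or> x = 5/6" using n4(2) a s by linarith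
  moreover have "y = 1/2 \<or> y = 5/6 - s" using n3(2) a s by linarith
  ultimately show False using dist s by (elim disjE) linarith+
qed

lemma same_piece: "piece s x = piece s y \<and> piece s x \<noteq> 0"
proof -
  interpret sw: long_leaf s y x by (rule swap)
  have pos: "t \<le> 1/3 - s \<and> piece s t = 1 \<or> 1/3 \<le> t \<and> (t \<le> 1/2 - s \<or> 5/6 \<le> t) \<and> piece s t = 2 \<or>
      1/2 \<le> t \<and> t \<le> 5/6 - s \<and> piece s t = 3"
    if "piece s t \<noteq> 0" for t
    using that s unfolding piece_def by (auto split: if_splits)
  have *: "piece s x = 1 \<longleftrightarrow> piece s y = 1"
    using pos[OF piece_nonzero] pos[OF sw.piece_nonzero] pieces_1 sw.pieces_1 s by auto
  show ?thesis
    using pos[OF piece_nonzero] pos[OF sw.piece_nonzero] * pieces_2_3 sw.pieces_2_3 piece_nonzero by auto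
qed

end

section \<open>Pieces visited by the images of a comajor\<close>

lemma cross_chord_shift: "cross (chord (a - c) (b - c)) (chord (x - c) (y - c)) \<longleftrightarrow> cross (chord a b) (chord x y)"
  unfolding cross_chord_iff by simp

lemma chord_frac: "chord (frac a) (frac b) = chord a b"
  unfolding chord_def circle_pt_frac ..

lemma uncrossed_frac:
  assumes "\<not> cross (chord a b) (chord x y)"
  shows "0 \<le> (frac (x - c) - frac (a - c)) * (frac (x - c) - frac (b - c)) *
    ((frac (y - c) - frac (a - c)) * (frac (y - c) - frac (b - c)))"
proof -
  have "\<not> cross (chord (frac (a - c)) (frac (b - c))) (chord (frac (x - c)) (frac (y - c)))"
    unfolding chord_frac cross_chord_shift by (rule assms)
  then show ?thesis using cross_chord_01[OF frac_in frac_in frac_in frac_in] by force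
qed

lemma not_separated:
  fixes x y a b :: real
  assumes "0 \<le> (x - a) * (x - b) * ((y - a) * (y - b))"
  shows "\<not> (a < x \<and> x < b \<and> (y < a \<or> b < y))" "\<not> (a < y \<and> y < b \<and> (x < a \<or> b < x))"
proof -
  have *: "(x - a) * (x - b) * ((y - a) * (y - b)) < 0" if "a < x" "x < b" "y < a \<or> b < y" for x y
  proof (rule mult_neg_pos)
    show "(x - a) * (x - b) < 0" using that by (simp add: mult_pos_neg)
    show "0 < (y - a) * (y - b)" using that by (auto intro: mult_pos_pos mult_neg_neg)
  qed
  show "\<not> (a < x \<and> x < b \<and> (y < a \<or> b < y))" using *[of x y] assms by auto
  show "\<not> (a < y \<and> y < b \<and> (x < a \<or> b < x))"
    using *[of y x] assms by (auto simp: mult.commute[of "(y - a) * (y - b)"])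
qed

lemma leaf_same_piece:
  assumes L: "symmetric_lamination L" and ps: "comajor_at L p s" and xy: "chord x y \<in> L" "s < chord_length (chord x y)"
  \<comment> \<open>With this origin the comajor has coordinates \<open>1/6 - s\<close> and
    \<open>1/6\<close>, centred in piece 1, and the four strip arcs are its translates by
    \<open>1/6\<close>, \<open>1/3\<close>, \<open>2/3\<close> and \<open>5/6\<close>.\<close>
  defines "c \<equiv> p + s - 1/6"
  shows "piece s (frac (x - c)) = piece s (frac (y - c)) \<and> piece s (frac (x - c)) \<noteq> 0"
proof -
  note LD = symmetric_laminationD[OF L]
  have s: "0 < s" "s \<le> 1/6" and D: "chord (p + 1/3) (p + s + 2/3) \<in> L" and m: "chord (p + s + 1/3) (p + 2/3) \<in> L"
    and min: "\<And>l. l \<in> L \<Longrightarrow> l \<notin> degenerate_chords \<Longrightarrow> s \<le> \<bar>chord_length l - 1/3\<bar>"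
    using ps by (auto simp: comajor_at_def)
  have D': "chord (p + 1/3 + 1/2) (p + s + 2/3 + 1/2) \<in> L" and m': "chord (p + s + 1/3 + 1/2) (p + 2/3 + 1/2) \<in> L"
    using LD(6)[OF D] LD(6)[OF m] unfolding uminus_chord by blast+
  let ?x = "frac (x - c)" and ?y = "frac (y - c)"
  have nc: "0 \<le> (?x - frac (a - c)) * (?x - frac (b - c)) * ((?y - frac (a - c)) * (?y - frac (b - c)))"
    if "chord a b \<in> L" for a b
    by (rule uncrossed_frac) (rule LD(4)[OF that xy(1)])
  have "frac (p + 1/3 - c) = 1/2 - s" "frac (p + s + 2/3 - c) = 5/6" "frac (p + s + 1/3 - c) = 1/2"
    "frac (p + 2/3 - c) = 5/6 - s" "frac (p + 1/3 + 1/2 - c) = 1 - s" "frac (p + s + 2/3 + 1/2 - c) = 1/3"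
    "frac (p + s + 1/3 + 1/2 - c) = 0" "frac (p + 2/3 + 1/2 - c) = 1/3 - s"
    unfolding c_def by (rule frac_eqI; use s in simp)+
  note fr = this
  note n4 = not_separated[OF nc[OF D, unfolded fr]]
  note n3 = not_separated[OF nc[OF m, unfolded fr]]
  have "0 \<le> (?x - 1/3) * (?x - (1 - s)) * ((?y - 1/3) * (?y - (1 - s)))"
    using nc[OF D', unfolded fr] by (simp add: mult_ac)
  note n2 = not_separated[OF this]
  note n1 = not_separated[OF nc[OF m', unfolded fr]]
  have b: "0 \<le> ?x" "?x < 1" "0 \<le> ?y" "?y < 1" by (simp_all add: frac_lt_1)
  let ?d = "chord_length (chord x y)"
  have "chord x y \<notin> degenerate_chords" using degenerate_iff_length[of "chord x y"] xy s LD(2) by auto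
  then have dmin: "s \<le> \<bar>?d - 1/3\<bar>" using min xy(1) by blast
  have d: "?d = min \<bar>?x - ?y\<bar> (1 - \<bar>?x - ?y\<bar>)"
  proof -
    have "\<bar>frac (y - x) - arc_len ?x ?y\<bar> = 0" by (simp add: arc_frac)
    then have 1: "frac (y - x) = arc_len ?x ?y" by simp
    have 2: "frac (x - y) = arc_len ?y ?x" by (simp add: arc_frac)
    have "?x \<noteq> ?y"
    proof
      assume "?x = ?y"
      then have "arc_len ?x ?y = 0" by (simp add: arc_len_def)
      then have "?d = 0" using 1 frac_ge_0[of "x - y"] unfolding chord_length_chord arc_dist_def by linarith
      then show False using xy(2) s by simp
    qed
    then show ?thesis unfolding chord_length_chord arc_dist_def 1 2 arc_len_def by (auto simp: min_def abs_if)
  qed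
  show ?thesis
  proof (rule long_leaf.same_piece, rule long_leaf.intro[OF s b])
    show "\<not> (0 < ?x \<and> ?x < 1/3 - s \<and> 1/3 - s < ?y)" "\<not> (0 < ?y \<and> ?y < 1/3 - s \<and> 1/3 - s < ?x)" using n1 by blast+
    show "s < \<bar>?x - ?y\<bar>" "\<bar>?x - ?y\<bar> < 1 - s" using d xy(2) by linarith+
    show "\<not> (1/3 - s < \<bar>?x - ?y\<bar> \<and> \<bar>?x - ?y\<bar> < 1/3 + s)" "\<not> (2/3 - s < \<bar>?x - ?y\<bar> \<and> \<bar>?x - ?y\<bar> < 2/3 + s)"
      using d dmin s by (auto simp: min_def abs_if split: if_splits)
  qed (use n2 n3 n4 in blast)+
qed

text \<open>An image length is \<open>3 * d\<close> or three times the distance of \<open>d\<close>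
  from \<open>1/3\<close>, and both \<open>d\<close> and that distance are at least
  \<open>s\<close>.\<close>

lemma comajor_orbit_length:
  assumes L: "symmetric_lamination L" and ps: "comajor_at L p s"
  defines "a \<equiv> \<lambda>n. (triple_pt ^^ n) (frac p)" and "b \<equiv> \<lambda>n. (triple_pt ^^ n) (frac (p + s))"
  shows "chord (a n) (b n) \<in> L \<and> s \<le> chord_length (chord (a n) (b n)) \<and> (n > 0 \<longrightarrow> s < chord_length (chord (a n) (b n)))"
proof (induction n)
  case 0
  have "s \<le> 1/6" "0 < s" "chord p (p + s) \<in> L" using ps by (auto simp: comajor_at_def)
  moreover from this have "chord_length (chord p (p + s)) = s" by (intro chord_length_eqI(1)) auto
  ultimately show ?case by (simp add: a_def b_def chord_frac)
next
  case (Suc n)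
  note LD = symmetric_laminationD[OF L]
  let ?l = "chord (a n) (b n)"
  have s: "0 < s" "s \<le> 1/6" using ps by (auto simp: comajor_at_def)
  have eq: "chord (a (Suc n)) (b (Suc n)) = sigma3 ?l"
    by (simp add: a_def b_def triple_pt_def chord_frac sigma3_chord)
  have lC: "?l \<in> chords" using Suc LD(2) by blast
  have "?l \<notin> degenerate_chords" using degenerate_iff_length[OF lC] Suc s by auto
  then have "s \<le> \<bar>chord_length ?l - 1/3\<bar>" using ps Suc by (simp add: comajor_at_def)
  then have "s < chord_length (sigma3 ?l)"
    unfolding chord_length_sigma3[OF lC] using Suc s chord_length_bounds[OF lC] by (auto simp: abs_if split: if_splits)
  then show ?case unfolding eq using LD(5) Suc by auto
qed

text \<open>The comajor has length exactly \<open>s\<close>, so it is located directly in piece 1;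
  its proper images are longer and fall under \<open>leaf_same_piece\<close>.\<close>

lemma comajor_orbit_piece:
  assumes L: "symmetric_lamination L" and ps: "comajor_at L p s"
  defines "c \<equiv> p + s - 1/6"
  shows "piece s (frac ((triple_pt ^^ n) (frac p) - c)) = piece s (frac ((triple_pt ^^ n) (frac (p + s)) - c)) \<and>
    piece s (frac ((triple_pt ^^ n) (frac p) - c)) \<noteq> 0"
proof (cases n)
  case 0
  have s: "0 < s" "s \<le> 1/6" using ps by (auto simp: comajor_at_def)
  have "frac p - c - (1/6 - s) = - of_int \<lfloor>p\<rfloor>" by (simp add: c_def frac_def)
  then have 1: "frac (frac p - c) = 1/6 - s" using s by (intro frac_eqI) auto
  have "frac (p + s) - c - 1/6 = - of_int \<lfloor>p + s\<rfloor>" by (simp add: c_def frac_def)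
  then have 2: "frac (frac (p + s) - c) = 1/6" by (intro frac_eqI) auto
  show ?thesis using s by (simp add: 0 1 2 piece_def)
next
  case (Suc m)
  then show ?thesis
    using leaf_same_piece[OF L ps] comajor_orbit_length[OF L ps, of n] unfolding c_def by blast
qed

section \<open>Comparison of two laminations\<close>

text \<open>Narrowing the strips enlarges the pieces. The narrow strip arcs keep the starts of the
  wide ones in the first conclusion and their ends in the second.\<close>

lemma piece_narrow:
  assumes "piece s x = k" "k \<noteq> 0" "0 < v" "v \<le> s" "s \<le> 1/6" "0 \<le> x"
  shows "piece v (x + (s - v)) = k" "piece v x = k"
  using assms unfolding piece_def by (auto split: if_splits)

text \<open>Strip arcs are translates of the comajors, by the same amounts in both laminations. So
  the translates of the overlap from \<open>p2\<close> to \<open>p1 + s1\<close> lie in the strips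
  of both, and orbits avoiding the wider strips avoid the interior of the common one.\<close>

lemma overlapping_comajors_contradiction:
  assumes L1: "symmetric_lamination L1" and c1: "comajor_at L1 p1 s1"
    and L2: "symmetric_lamination L2" and c2: "comajor_at L2 p2 s2"
    and ord: "p1 < p2" "p2 < p1 + s1" "p1 + s1 < p2 + s2"
  shows False
proof -
  define v where "v = p1 + s1 - p2"
  define c where "c = p1 + s1 - 1/6"
  have s: "0 < s1" "s1 \<le> 1/6" "0 < s2" "s2 \<le> 1/6" using c1 c2 by (auto simp: comajor_at_def)
  have v: "0 < v" "v \<le> 1/6" "v \<le> s1" "v \<le> s2" using ord s by (auto simp: v_def)
  interpret strips v c using v by unfold_locales
  let ?g = "\<lambda>n. triple_pt ^^ n"
  let ?a = "frac p1" and ?b = "frac (p1 + s1)" and ?x = "frac p2" and ?y = "frac (p2 + s2)"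
  note LD = symmetric_laminationD[OF L1]
  have ab: "pc (?g n ?a) = pc (?g n ?b) \<and> pc (?g n ?a) \<noteq> 0" for n
    using comajor_orbit_piece[OF L1 c1, of n, folded c_def] piece_narrow(2)[OF _ _ v(1,3) s(2) frac_ge_0]
    unfolding pc_def tau_def by metis
  \<comment> \<open>The two coordinates differ by \<open>s2 - v\<close>. A point of a piece has
    coordinate at most \<open>1 - s2\<close> in the second lamination, so the change of origin
    causes no wrap.\<close>
  have shift: "piece v (frac (t - c)) = k" if k: "piece s2 (frac (t - (p2 + s2 - 1/6))) = k" "k \<noteq> 0" for t k
  proof -
    let ?r = "frac (t - (p2 + s2 - 1/6))"
    have "?r \<le> 1 - s2" using k s unfolding piece_def by (auto split: if_splits)
    then have "frac (t - c) = ?r + (s2 - v)"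
    proof (intro frac_eqI)
      have "t - c - (?r + (s2 - v)) = of_int \<lfloor>t - (p2 + s2 - 1/6)\<rfloor>"
        by (simp add: c_def v_def frac_def)
      then show "t - c - (?r + (s2 - v)) \<in> \<int>" by simp
    qed (use v frac_ge_0[of "t - (p2 + s2 - 1/6)"] in auto)
    then show ?thesis using piece_narrow(1)[OF k v(1,4) s(4) frac_ge_0] by simp
  qed
  have xy: "pc (?g n ?x) = pc (?g n ?y) \<and> pc (?g n ?x) \<noteq> 0" for n
    using comajor_orbit_piece[OF L2 c2, of n] shift unfolding pc_def tau_def by metis
  define leaf where "leaf s t \<longleftrightarrow> s \<in> {0..<1} \<and> t \<in> {0..<1} \<and> chord s t \<in> L1" for s t
  show False
  proof (rule itinerary_contradiction[of ?a ?b ?x ?y leaf])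
    show "{?a, ?b, ?x, ?y} \<subseteq> {0..<1}" using frac_in by blast
    show "same_itin ?a ?b" "same_itin ?x ?y" using ab xy unfolding same_itin_def by blast+
    show "regular ?a" "regular ?x" using ab xy unfolding regular_def by metis+
    have "arc_len ?a ?x = p2 - p1" "arc_len ?a ?b = s1" "arc_len ?a ?y = p2 + s2 - p1"
      unfolding arc_frac using ord s by (auto intro!: frac_eqI)
    then show "linked ?a ?b ?x ?y" using ord by (simp add: linked_def)
    show "leaf ?a ?b" using c1 by (simp add: leaf_def frac_lt_1 chord_frac comajor_at_def)
    show "leaf (triple_pt t) (triple_pt u)" if "leaf t u" for t u
      using LD(5)[of "chord t u"] that triple_in
      by (simp add: leaf_def sigma3_chord triple_pt_def chord_frac frac_lt_1)
    show "leaf (half_turn t) (half_turn u)" if "leaf t u" for t u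
      using LD(6)[of "chord t u"] that
      by (simp add: leaf_def uminus_chord half_turn_def chord_frac frac_lt_1)
    show "\<not> linked t u t' u'" if "leaf t u" "leaf t' u'" for t u t' u'
    proof
      assume l: "linked t u t' u'"
      have 01: "t \<in> {0..<1}" "u \<in> {0..<1}" "t' \<in> {0..<1}" "u' \<in> {0..<1}" using that by (auto simp: leaf_def)
      have "(t' - t) * (t' - u) * ((u' - t) * (u' - u)) < 0"
        using l unfolding linked_order[OF 01] by (auto simp: mult_less_0_iff zero_less_mult_iff)
      then have "cross (chord t u) (chord t' u')" using cross_chord_01[OF 01] by blast
      then show False using LD(4) that by (auto simp: leaf_def)
    qed
  qed
qed

text \<open>After an integer shift the second comajor starts at distance \<open>u\<close> after
  \<open>p1\<close>. Either it starts inside the first arc and ends beyond it, or it runs past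
  \<open>p1 + 1\<close> and ends inside the translated first arc; the second case is the first with
  the roles exchanged.\<close>

lemma comajors_uncrossed:
  assumes L1: "symmetric_lamination L1" and c1: "comajor_at L1 p1 s1"
    and L2: "symmetric_lamination L2" and c2: "comajor_at L2 p2 s2"
  shows "\<not> cross (chord p1 (p1 + s1)) (chord p2 (p2 + s2))"
proof
  assume cr: "cross (chord p1 (p1 + s1)) (chord p2 (p2 + s2))"
  define p2' where "p2' = p2 + of_int (- \<lfloor>p2 - p1\<rfloor>)"
  define u where "u = p2' - p1"
  have "u = frac (p2 - p1)" by (simp add: u_def p2'_def frac_def)
  then have u: "0 \<le> u" "u < 1" by (simp_all add: frac_lt_1)
  have c2': "comajor_at L2 p2' s2" unfolding p2'_def by (rule comajor_at_add_int[OF c2])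
  have s: "0 < s1" "s1 \<le> 1/6" "0 < s2" "s2 \<le> 1/6" using c1 c2 by (auto simp: comajor_at_def)
  have "chord p2 (p2 + s2) = chord p2' (p2' + s2)" unfolding p2'_def chord_eq_iff by simp
  then have "cross (chord p1 (p1 + s1)) (chord p2' (p2' + s2))" using cr by simp
  define S where "S t = sin (pi * t)" for t
  have neg: "S u * S (u - s1) * (S (u + s2) * S (u + s2 - s1)) < 0"
    using \<open>cross (chord p1 (p1 + s1)) (chord p2' (p2' + s2))\<close>
    unfolding cross_chord_iff u_def S_def by (simp add: algebra_simps)
  have pos: "0 < S t" if "0 < t" "t < 1" for t
    using sin_gt_zero[of "pi * t"] that by (simp add: S_def)
  have S0: "S 0 = 0" "S 1 = 0" by (simp_all add: S_def)
  have below: "S t < 0" if "- 1 < t" "t < 0" for t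
    using pos[of "- t"] that by (simp add: S_def)
  have above: "S t < 0" if "1 < t" "t < 2" for t
    using pos[of "t - 1"] that by (simp add: S_def right_diff_distrib sin_diff)
  show False
  proof (cases "u < s1")
    case True
    have "u \<noteq> 0" using neg S0 by auto
    then have u0: "0 < u" using u by simp
    have "S u * S (u - s1) \<le> 0"
      using pos[of u] below[of "u - s1"] u0 u True s by (simp add: mult_le_0_iff)
    moreover have "0 < S (u + s2)" using pos[of "u + s2"] u0 True s by simp
    ultimately have "s1 < u + s2"
    proof -
      have "S (u + s2 - s1) \<le> 0" if "\<not> s1 < u + s2"
        using that below[of "u + s2 - s1"] u0 s S0 by (cases "s1 = u + s2") auto
      then have "S (u + s2) * S (u + s2 - s1) \<le> 0" if "\<not> s1 < u + s2"
        using that \<open>0 < S (u + s2)\<close> by (simp add: mult_le_0_iff)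
      then have "0 \<le> S u * S (u - s1) * (S (u + s2) * S (u + s2 - s1))" if "\<not> s1 < u + s2"
        using that \<open>S u * S (u - s1) \<le> 0\<close> mult_nonpos_nonpos by blast
      then show ?thesis using neg by linarith
    qed
    then show False
      using overlapping_comajors_contradiction[OF L1 c1 L2 c2'] True u0 by (simp add: u_def)
  next
    case False
    have "0 \<le> S u" using pos[of u] u S0 by (cases "u = 0") auto
    moreover have "0 \<le> S (u - s1)" using pos[of "u - s1"] u s S0 False by (cases "u = s1") auto
    ultimately have "0 \<le> S u * S (u - s1)" by simp
    then have neg2: "S (u + s2) * S (u + s2 - s1) < 0"
      using neg mult_nonneg_nonneg[of "S u * S (u - s1)"] by (meson not_le)
    have "1 < u + s2"
    proof (rule ccontr)
      assume a: "\<not> 1 < u + s2"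
      have "0 \<le> S (u + s2)" using pos[of "u + s2"] a u s S0 by (cases "u + s2 = 1") auto
      moreover have "0 < S (u + s2 - s1)" using pos[of "u + s2 - s1"] a False s by simp
      ultimately show False using neg2 by (auto simp: mult_less_0_iff)
    qed
    then have "S (u + s2) < 0" using above[of "u + s2"] u s by simp
    then have "0 < S (u + s2 - s1)" using neg2 by (simp add: mult_less_0_iff)
    then have "u + s2 - s1 \<noteq> 1" "\<not> 1 < u + s2 - s1"
      using above[of "u + s2 - s1"] u s S0 by auto
    then have "u + s2 - s1 < 1" by linarith
    then show False
      using overlapping_comajors_contradiction[OF L2 c2' L1 comajor_at_add_int[OF c1, of 1]] \<open>1 < u + s2\<close> u
      by (simp add: u_def)
  qed
qed

lemma cross_degenerate: "l \<in> chords \<Longrightarrow> m \<in> degenerate_chords \<Longrightarrow> \<not> cross l m \<and> \<not> cross m l"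
  unfolding cross_def degenerate_chords_def by auto

lemma lamination_comajor_union: "lamination comajor_union"
  unfolding lamination_def
proof (intro conjI)
  have ca: "\<exists>L p s. symmetric_lamination L \<and> comajor_at L p s \<and> c = chord p (p + s)"
    if c: "c \<in> comajor_union" "c \<notin> degenerate_chords" for c
  proof -
    obtain L where L: "symmetric_lamination L" "comajor L c"
      using c unfolding comajor_union_def by blast
    from L c(2) obtain p s where "comajor_at L p s" "c = chord p (p + s)"
      by (rule comajor_imp_comajor_at)
    then show ?thesis using L(1) by blast
  qed
  show sub: "comajor_union \<subseteq> chords"
  proof
    fix c assume "c \<in> comajor_union"
    then show "c \<in> chords"
    proof (cases "c \<in> degenerate_chords")
      case True
      then obtain t where "c = chord t t" by (auto simp: degenerate_chords_def chord_def)
      then show ?thesis unfolding chords_def by blast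
    next
      case False
      then show ?thesis using ca[OF \<open>c \<in> comajor_union\<close>] unfolding chords_def by blast
    qed
  qed
  show "degenerate_chords \<subseteq> comajor_union" by (simp add: comajor_union_def)
  show "closed (\<Union> comajor_union)" by (rule closed_comajor_union)
  show "\<forall>l\<in>comajor_union. \<forall>m\<in>comajor_union. \<not> cross l m"
  proof (intro ballI)
    fix l m assume lm: "l \<in> comajor_union" "m \<in> comajor_union"
    show "\<not> cross l m"
    proof (cases "l \<in> degenerate_chords \<or> m \<in> degenerate_chords")
      case True
      then show ?thesis using cross_degenerate lm sub by blast
    next
      case False
      then show ?thesis using ca[OF lm(1)] ca[OF lm(2)] comajors_uncrossed by metis
    qed
  qed
qed

theorem theorem5p15:
  shows "compactin (mtopology_of lamination_metric) {L. symmetric_lamination L} \<and>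
         lamination ({c. c \<notin> degenerate_chords \<and> (\<exists>L. symmetric_lamination L \<and> comajor L c)}
                     \<union> degenerate_chords)"
  using compactin_symmetric_laminations lamination_comajor_union unfolding comajor_union_def by blast

end
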